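(* Let $p\in\{2,3,5,7,13\}$, $k=\frac{24}{p-1}$, and let $\ell\ne p$ be a prime with $\ell>3$. Let $s>0$ and $r<0$ be integers of opposite parity with $$0<r+sp<24\qquad\text{and}\qquad -24<s+rp<0.$$ Define $c^*(n)$ by $\phi^*(q)=\sum_{n\ge0}c^*(n)q^n=\prod_{n\ge1}(1-q^n)^s\prod_{n\ge1}(1-q^{pn})^r$, with $c^*(x)=0$ unless $x$ is a nonnegative integer. Put $\varepsilon=\frac12(r+s)$, $\theta^*=(-1)^{\frac12-\frac12(r+s)}\,2p^{r}$, $\Delta^*=(s+rp)\frac{\ell^2-1}{24}$, and $$G^*=\frac{1}{\phi^*(q)}\sum_{n=\Delta^*}^\infty\left(\ell^{2-2\varepsilon}c^*(n\ell^2+\Delta^* )+\left(\frac{\theta^*}{\ell}\right)\ell^{\frac12-\varepsilon}\left(\frac{n-\Delta^*}{\ell}\right)c^*(n)+c^*\!\left(\frac{n-\Delta^*}{\ell^2}\right)\right)q^n .$$ Let $\Phi_p^{-1}=q^{-1}\prod_{n\ge1}\frac{(1-q^n)^k}{(1-q^{pn})^k}$, and define polynomials $\mathfrak{B}_{r,s,p}(m,x)$ by $$\sum_{m=0}^\infty\mathfrak{B}_{r,s,p}(m,x)q^m=\frac{\delta_q(\Phi_p^{-1})}{\phi^*(q)}\cdot\frac{1}{x-\Phi_p^{-1}},\qquad \delta_q=q\frac{d}{dq}.$$ Then, as formal Laurent series in $q$, $$G^*=\mathfrak{B}_{r,s,p}(-\Delta^*,\Phi_p^{-1})+\left(\fr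ac{\theta^*}{\ell}\right)\ell^{\frac12-\varepsilon}\left(\frac{-\Delta^*}{\ell}\right).$$
   Context: $\Phi_p^{-1}$ is the $q$-expansion of $(\eta(\tau)/\eta(p\tau))^{k}$, where $\eta(\tau)=q^{1/24}\prod_{n\ge1}(1-q^n)$, $q=e^{2\pi i\tau}$. The expression $\frac{1}{x-\Phi_p^{-1}}=-\sum_{j\ge0}x^j\Phi_p^{j+1}$ with $\Phi_p=q\prod_{n\ge1}(1-q^{pn})^k/(1-q^n)^k$ makes the right side a power series in $q$ with coefficients polynomials in $x$. $\left(\frac{\cdot}{\ell}\right)$ is the Legendre symbol; for a rational number $a/b$ with $\ell\nmid ab$ one sets $\left(\frac{a/b}{\ell}\right)=\left(\frac{ab}{\ell}\right)$ (this applies to $\theta^*$, since $r<0$). Since $r+s$ is odd, $2-2\varepsilon$ and $\frac12-\varepsilon$ are integers, and $\Delta^*$ is a negative integer. *)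

theory Defs
  imports
    "HOL-Analysis.Analysis"
    "HOL-Computational_Algebra.Computational_Algebra"
    "HOL-Number_Theory.Number_Theory"
begin

unbundle fps_syntax

text \<open>
  All series are formal, with complex coefficients. Infinite products and sums of formal power
  series are the library's \<^const>\<open>prodinf\<close> and \<^const>\<open>suminf\<close>, taken in the \<open>q\<close>-adic topology on
  \<^typ>\<open>complex fps\<close>; the index \<open>n :: nat\<close> is shifted so that \<open>Suc n\<close> runs over the positive integers.
\<close>

section \<open>Convergence of formal products and sums\<close>

lemma fps_prod_nth_stable:
  fixes f :: "nat \<Rightarrow> 'a :: idom fps"
  assumes "\<And>n i. i \<le> n \<Longrightarrow> f n $ i = 1 $ i" and "m \<le> N"
  shows "(\<Prod>i<N. f i) $ m = (\<Prod>i<m. f i) $ m"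
  using assms(2)
proof (induction N rule: dec_induct)
  case (step N)
  have "(\<Prod>i<Suc N. f i) $ m = ((\<Prod>i<N. f i) * f N) $ m"
    by simp
  also have "\<dots> = ((\<Prod>i<N. f i) * 1) $ m"
    unfolding fps_mult_nth by (intro sum.cong refl) (use step.hyps in \<open>simp add: assms(1)\<close>)
  finally show ?case using step.IH by simp
qed simp

lemma fps_has_prod:
  fixes f :: "nat \<Rightarrow> 'a :: idom fps"
  assumes f: "\<And>n i. i \<le> n \<Longrightarrow> f n $ i = 1 $ i"
  shows "f has_prod (\<Prod>n. f n)" and "m \<le> N \<Longrightarrow> (\<Prod>n. f n) $ m = (\<Prod>i<N. f i) $ m"
proof -
  define P where "P = Abs_fps (\<lambda>m. (\<Prod>i<m. f i) $ m)"
  have P: "P $ m = (\<Prod>i<N. f i) $ m" if "m \<le> N" for m N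
    using fps_prod_nth_stable[of f m N, OF f that] by (simp add: P_def)
  have "(\<lambda>n. \<Prod>i\<le>n. f (i + 0)) \<longlonglongrightarrow> P"
  proof (rule tendsto_fpsI)
    fix m
    show "\<forall>\<^sub>F n in sequentially. (\<Prod>i\<le>n. f (i + 0)) $ m = P $ m"
      using eventually_ge_at_top[of m]
    proof eventually_elim
      case (elim n)
      thus ?case using P[of m "Suc n"] by (simp only: lessThan_Suc_atMost add_0_right)
    qed
  qed
  moreover have "P $ 0 = 1"
    by (simp add: P_def)
  hence "P \<noteq> 0" by auto
  ultimately have "f has_prod P"
    by (auto simp: has_prod_def raw_has_prod_def)
  moreover from this have "(\<Prod>n. f n) = P"
    by (rule has_prod_unique[symmetric])
  ultimately show "f has_prod (\<Prod>n. f n)" and "m \<le> N \<Longrightarrow> (\<Prod>n. f n) $ m = (\<Prod>i<N. f i) $ m"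
    using P by simp_all
qed

lemma fps_sums:
  fixes f :: "nat \<Rightarrow> 'a :: ring_1 fps"
  assumes f: "\<And>j i. i \<le> j \<Longrightarrow> f j $ i = 0"
  shows "f sums (\<Sum>j. f j)" and "m \<le> N \<Longrightarrow> (\<Sum>j. f j) $ m = (\<Sum>j<N. f j) $ m"
proof -
  define S where "S = Abs_fps (\<lambda>m. (\<Sum>j<m. f j) $ m)"
  have S: "S $ m = (\<Sum>j<N. f j) $ m" if "m \<le> N" for m N
    using that by (induction N rule: dec_induct) (simp_all add: S_def f)
  have "f sums S"
    unfolding sums_def
  proof (rule tendsto_fpsI)
    fix m
    show "\<forall>\<^sub>F n in sequentially. (\<Sum>j<n. f j) $ m = S $ m"
      using eventually_ge_at_top[of m] by eventually_elim (use S in simp)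
  qed
  moreover from this have "(\<Sum>j. f j) = S"
    by (simp add: sums_unique[symmetric])
  ultimately show "f sums (\<Sum>j. f j)" and "m \<le> N \<Longrightarrow> (\<Sum>j. f j) $ m = (\<Sum>j<N. f j) $ m"
    using S by simp_all
qed

section \<open>The eta quotient and its coefficients\<close>

definition phi_star :: "nat \<Rightarrow> int \<Rightarrow> int \<Rightarrow> complex fps" where
  "phi_star p r s =
     (\<Prod>n. (1 - fps_X ^ Suc n) powi s) * (\<Prod>n. (1 - fps_X ^ (p * Suc n)) powi r)"

text \<open>The argument is rational so that \<open>c_star p r s ((n - \<Delta>) / \<ell>\<^sup>2)\<close> makes sense for all \<open>n\<close>.\<close>

definition c_star :: "nat \<Rightarrow> int \<Rightarrow> int \<Rightarrow> rat \<Rightarrow> complex" where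
  "c_star p r s x = (if x \<in> \<int> \<and> x \<ge> 0 then phi_star p r s $ nat \<lfloor>x\<rfloor> else 0)"

lemma fps_power_int_nth_eq_one:
  fixes f :: "complex fps"
  assumes f: "\<And>i. i \<le> n \<Longrightarrow> f $ i = 1 $ i" and i: "i \<le> n"
  shows "(f powi e) $ i = 1 $ i"
proof -
  have cong: "(g * h) $ i = 1 $ i"
    if "\<And>i. i \<le> n \<Longrightarrow> g $ i = 1 $ i" "\<And>i. i \<le> n \<Longrightarrow> h $ i = 1 $ i" "i \<le> n" for g h :: "complex fps" and i
  proof -
    have "(g * h) $ i = (1 * 1 :: complex fps) $ i"
      unfolding fps_mult_nth by (intro sum.cong refl) (use that in simp)
    thus ?thesis by simp
  qed
  have pow: "(g ^ k) $ i = 1 $ i"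
    if "\<And>i. i \<le> n \<Longrightarrow> g $ i = 1 $ i" "i \<le> n" for g :: "complex fps" and k i
    using that(2)
  proof (induction k arbitrary: i)
    case (Suc k)
    show ?case
      unfolding power_Suc by (rule cong[OF that(1) Suc.IH Suc.prems])
  qed simp
  have inv: "inverse f $ i = 1 $ i" if "i \<le> n" for i
  proof -
    have "f $ 0 \<noteq> 0" using f[of 0] by simp
    have "(f * inverse f) $ i = (1 * inverse f) $ i"
      unfolding fps_mult_nth by (intro sum.cong refl) (use that f in simp)
    thus ?thesis using \<open>f $ 0 \<noteq> 0\<close> by (simp add: inverse_mult_eq_1')
  qed
  show ?thesis
    unfolding power_int_def using pow f inv i by auto
qed

lemma euler_factor_nth:
  assumes "a > 0" "i \<le> n"
  shows "((1 - fps_X ^ (a * Suc n)) powi e :: complex fps) $ i = 1 $ i"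
proof (rule fps_power_int_nth_eq_one[where n = n])
  fix i assume "i \<le> n"
  hence "i < a * Suc n"
    using assms(1) by (cases a) auto
  thus "(1 - fps_X ^ (a * Suc n) :: complex fps) $ i = 1 $ i"
    by (simp add: fps_X_power_nth)
qed (use assms in auto)

text \<open>Both products in the definition of \<^const>\<open>phi_star\<close> converge.\<close>

lemma euler_power_has_prod:
  assumes "a > 0"
  shows "(\<lambda>n. (1 - fps_X ^ (a * Suc n)) powi e :: complex fps) has_prod
           (\<Prod>n. (1 - fps_X ^ (a * Suc n)) powi e)"
  by (rule fps_has_prod(1)) (rule euler_factor_nth[OF assms])

lemma phi_star_nth_0: "p > 0 \<Longrightarrow> phi_star p r s $ 0 = 1"
  using fps_has_prod(2)[of "\<lambda>n. (1 - fps_X ^ (1 * Suc n)) powi s :: complex fps" 0 0]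
        fps_has_prod(2)[of "\<lambda>n. (1 - fps_X ^ (p * Suc n)) powi r :: complex fps" 0 0]
        euler_factor_nth[of 1 _ _ s] euler_factor_nth[of p _ _ r]
  by (simp add: phi_star_def fps_mult_nth)

section \<open>The Hauptmodul\<close>

definition Phi_inv :: "nat \<Rightarrow> nat \<Rightarrow> complex fls" where
  "Phi_inv p k = fls_X_inv *
     fps_to_fls (\<Prod>n. (1 - fps_X ^ Suc n) ^ k / (1 - fps_X ^ (p * Suc n)) ^ k)"

definition Phi :: "nat \<Rightarrow> nat \<Rightarrow> complex fps" where
  "Phi p k = fps_X * (\<Prod>n. (1 - fps_X ^ (p * Suc n)) ^ k / (1 - fps_X ^ Suc n) ^ k)"

lemma euler_quotient_nth:
  assumes "a > 0" "b > 0" "i \<le> n"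
  shows "((1 - fps_X ^ (a * Suc n)) ^ k / (1 - fps_X ^ (b * Suc n)) ^ k :: complex fps) $ i = 1 $ i"
proof -
  let ?A = "(1 - fps_X ^ (a * Suc n)) ^ k :: complex fps"
  let ?B = "inverse ((1 - fps_X ^ (b * Suc n)) ^ k) :: complex fps"
  have A: "?A $ i = 1 $ i" if "i \<le> n" for i
    using euler_factor_nth[OF assms(1) that, of "int k"] by simp
  have B: "?B $ i = 1 $ i" if "i \<le> n" for i
    using euler_factor_nth[OF assms(2) that, of "- int k"]
    by (cases "k = 0") (simp_all add: power_int_def fps_inverse_power)
  have "((1 - fps_X ^ (b * Suc n)) ^ k :: complex fps) $ 0 \<noteq> 0"
    using euler_factor_nth[OF assms(2), of 0 n "int k"] by simp
  hence "?A / (1 - fps_X ^ (b * Suc n)) ^ k = ?A * ?B"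
    by (rule fps_divide_unit)
  moreover have "(?A * ?B) $ i = (1 * 1 :: complex fps) $ i"
    unfolding fps_mult_nth by (intro sum.cong refl) (use A B assms(3) in simp)
  ultimately show ?thesis by simp
qed

lemma Phi_inv_has_prod:
  assumes "a > 0" "b > 0"
  shows "(\<lambda>n. (1 - fps_X ^ (a * Suc n)) ^ k / (1 - fps_X ^ (b * Suc n)) ^ k :: complex fps) has_prod
           (\<Prod>n. (1 - fps_X ^ (a * Suc n)) ^ k / (1 - fps_X ^ (b * Suc n)) ^ k)"
  by (rule fps_has_prod(1)) (rule euler_quotient_nth[OF assms])

lemma Phi_inv_times_Phi:
  assumes "p > 0"
  shows "Phi_inv p k * fps_to_fls (Phi p k) = 1"
proof -
  define f where "f n = ((1 - fps_X ^ Suc n) ^ k / (1 - fps_X ^ (p * Suc n)) ^ k :: complex fps)" for n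
  define g where "g n = ((1 - fps_X ^ (p * Suc n)) ^ k / (1 - fps_X ^ Suc n) ^ k :: complex fps)" for n
  have f: "f n $ i = 1 $ i" if "i \<le> n" for n i
    using euler_quotient_nth[of 1 p i n k] assms that by (simp add: f_def)
  have g: "g n $ i = 1 $ i" if "i \<le> n" for n i
    using euler_quotient_nth[of p 1 i n k] assms that by (simp add: g_def)
  have fg: "f n * g n = 1" for n
  proof -
    have "((1 - fps_X ^ Suc n) ^ k :: complex fps) $ 0 \<noteq> 0"
         "((1 - fps_X ^ (p * Suc n)) ^ k :: complex fps) $ 0 \<noteq> 0"
      using euler_factor_nth[of 1 0 n "int k"] euler_factor_nth[OF assms, of 0 n "int k"]
      by simp_all
    thus ?thesis
      unfolding f_def g_def
      by (simp add: fps_divide_unit inverse_mult_eq_1 inverse_mult_eq_1' algebra_simps del: power_Suc)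
  qed
  have "(\<Prod>n. f n) * (\<Prod>n. g n) = 1"
  proof (rule fps_ext)
    fix m
    have "((\<Prod>n. f n) * (\<Prod>n. g n)) $ m = ((\<Prod>i<m. f i) * (\<Prod>i<m. g i)) $ m"
      unfolding fps_mult_nth
      by (intro sum.cong refl arg_cong2[of _ _ _ _ "(*)"] fps_has_prod(2) f g) auto
    thus "((\<Prod>n. f n) * (\<Prod>n. g n)) $ m = 1 $ m"
      by (simp add: fg flip: prod.distrib)
  qed
  hence "fps_to_fls (\<Prod>n. f n) * fps_to_fls (\<Prod>n. g n) = 1"
    by (simp flip: fls_times_fps_to_fls)
  moreover have "Phi_inv p k = fls_X_inv * fps_to_fls (\<Prod>n. f n)"
    by (simp add: Phi_inv_def f_def)
  moreover have "fps_to_fls (Phi p k) = fls_X * fps_to_fls (\<Prod>n. g n)"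
    by (simp add: Phi_def g_def fls_times_fps_to_fls)
  moreover have "fls_X_inv * fls_X = (1 :: complex fls)"
    by (simp add: fls_X_inv_times_conv_shift)
  ultimately show ?thesis
    by (metis (no_types, lifting) mult.assoc mult.commute mult_1)
qed

section \<open>The polynomials\<close>

text \<open>
  A series in \<open>q\<close> over \<open>\<complex>\<close> regarded as a series over \<open>\<complex>[x]\<close> with constant coefficients.
\<close>

definition fps_lift :: "complex fps \<Rightarrow> complex poly fps" where
  "fps_lift f = Abs_fps (\<lambda>n. [:f $ n:])"

definition fls_lift :: "complex fls \<Rightarrow> complex poly fls" where
  "fls_lift f = Abs_fls (\<lambda>n. [:f $$ n:])"

text \<open>
  The expansion \<open>- (\<Sum>j. x\<^sup>j \<Phi>\<^sup>j\<^sup>+\<^sup>1)\<close> of \<open>1 / (x - \<Phi>\<^sup>-\<^sup>1)\<close>; lemma \<open>kernel_inverse\<close> below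
  shows that it is the inverse of \<open>x - \<Phi>\<^sup>-\<^sup>1\<close> in \<^typ>\<open>complex poly fls\<close>.
\<close>

definition kernel :: "nat \<Rightarrow> nat \<Rightarrow> complex poly fps" where
  "kernel p k = - (\<Sum>j. fps_const (Polynomial.monom 1 j) * fps_lift (Phi p k) ^ (j + 1))"

definition delta_q :: "'a :: ring_1 fls \<Rightarrow> 'a fls" where
  "delta_q f = fls_X * fls_deriv f"

definition frakB :: "nat \<Rightarrow> nat \<Rightarrow> int \<Rightarrow> int \<Rightarrow> nat \<Rightarrow> complex poly" where
  "frakB p k r s m =
     (fls_lift (delta_q (Phi_inv p k) / fps_to_fls (phi_star p r s)) * fps_to_fls (kernel p k)) $$ int m"

lemma fls_lift_nth [simp]: "fls_lift f $$ n = [:f $$ n:]"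
  unfolding fls_lift_def
  by (rule nth_Abs_fls_lower_bound[of "fls_subdegree f"]) simp

lemma fls_lift_mult: "fls_lift (f * g) = fls_lift f * fls_lift g"
proof (rule fls_eqI)
  fix n
  have sd: "fls_subdegree (fls_lift h) = fls_subdegree h" for h
  proof (cases "h = 0")
    case True
    hence "fls_lift h = 0" by (intro fls_eqI) simp
    thus ?thesis using True by simp
  next
    case False
    thus ?thesis by (intro fls_subdegree_eqI) auto
  qed
  have sum: "[:(\<Sum>i\<in>A. h i):] = (\<Sum>i\<in>A. [:h i:])" for h :: "int \<Rightarrow> complex" and A
  proof (induction A rule: infinite_finite_induct)
    case (insert a A)
    thus ?case by (simp flip: insert.IH)
  qed auto
  show "fls_lift (f * g) $$ n = (fls_lift f * fls_lift g) $$ n"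
    by (simp add: fls_times_nth(2) sd sum mult.commute)
qed

lemma fps_to_fls_lift: "fps_to_fls (fps_lift f) = fls_lift (fps_to_fls f)"
  by (rule fls_eqI) (simp add: fps_lift_def)

lemma kernel_term_nth:
  assumes "i \<le> j"
  shows "(fps_const (Polynomial.monom 1 j) * fps_lift (Phi p k) ^ (j + 1)) $ i = 0"
proof -
  have "fps_lift (Phi p k) $ 0 = 0"
    by (simp add: fps_lift_def Phi_def)
  hence "(fps_lift (Phi p k) ^ (j + 1)) $ i = 0"
    using assms by (intro startsby_zero_power_prefix[rule_format]) auto
  thus ?thesis by simp
qed

lemma kernel_sums:
  "(\<lambda>j. fps_const (Polynomial.monom 1 j) * fps_lift (Phi p k) ^ (j + 1)) sums (- kernel p k)"
  unfolding kernel_def minus_minus by (rule fps_sums(1)) (rule kernel_term_nth)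

lemma kernel_inverse:
  assumes "p > 0"
  shows "(fls_const [:0, 1:] - fls_lift (Phi_inv p k)) * fps_to_fls (kernel p k) = 1"
proof -
  define F where "F = fps_lift (Phi p k)"
  define x :: "complex poly fps" where "x = fps_const [:0, 1:]"
  define t where "t j = x ^ j * F ^ (j + 1)" for j
  have t_eq: "t j = fps_const (Polynomial.monom 1 j) * F ^ (j + 1)" for j
    by (simp add: t_def x_def fps_const_power monom_altdef)
  have t0: "t j $ i = 0" if "i \<le> j" for i j
    using kernel_term_nth[OF that] by (simp only: t_eq F_def)
  have K: "kernel p k = - (\<Sum>j. t j)"
    by (simp only: kernel_def t_eq F_def)
  have F0: "F $ 0 = 0"
    by (simp add: F_def fps_lift_def Phi_def)
  have geo: "(1 - x * F) * (\<Sum>j<N. t j) = F - t N" for N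
  proof (induction N)
    case 0
    show ?case by (simp add: t_def)
  next
    case (Suc N)
    have "(1 - x * F) * (\<Sum>j<Suc N. t j) = (1 - x * F) * (\<Sum>j<N. t j) + (t N - x * F * t N)"
      by (simp add: algebra_simps)
    also have "\<dots> = F - x * F * t N"
      by (simp add: Suc.IH)
    also have "x * F * t N = t (Suc N)"
      by (simp add: t_def mult_ac)
    finally show ?case .
  qed
  have main: "(1 - x * F) * (\<Sum>j. t j) = F"
  proof (rule fps_ext)
    fix m
    have "((1 - x * F) * (\<Sum>j. t j)) $ m = ((1 - x * F) * (\<Sum>j<m. t j)) $ m"
      unfolding fps_mult_nth
      by (intro sum.cong refl arg_cong2[of _ _ _ _ "(*)"] fps_sums(2) t0) auto
    also have "\<dots> = F $ m"
      by (simp only: geo fps_sub_nth t0[of m m]) simp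
    finally show "((1 - x * F) * (\<Sum>j. t j)) $ m = F $ m" .
  qed
  define P where "P = fls_lift (Phi_inv p k)"
  have PF: "P * fps_to_fls F = 1"
  proof -
    have "P * fps_to_fls F = fls_lift 1"
      by (simp add: P_def F_def fps_to_fls_lift Phi_inv_times_Phi[OF assms] flip: fls_lift_mult)
    also have "\<dots> = 1"
      by (rule fls_eqI) simp
    finally show ?thesis .
  qed
  let ?x = "fps_to_fls x" and ?F = "fps_to_fls F" and ?S = "fps_to_fls (\<Sum>j. t j)"
  have "(1 - ?x * ?F) * ?S = ?F"
    using arg_cong[OF main, of fps_to_fls] by (simp add: fls_times_fps_to_fls)
  have "(?x - P) * (- ?S) = (P - ?x * 1) * ?S"
    by (simp add: algebra_simps)
  also have "\<dots> = P * ((1 - ?x * ?F) * ?S)"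
    by (subst PF[symmetric]) (simp add: algebra_simps)
  also have "\<dots> = 1"
    using \<open>(1 - ?x * ?F) * ?S = ?F\<close> PF by simp
  finally show ?thesis
    by (simp add: K P_def x_def)
qed

text \<open>The series defining \<^const>\<open>frakB\<close> has no terms of negative exponent.\<close>

lemma frakB_generating_series:
  assumes "p > 0"
  shows "fps_to_fls (Abs_fps (frakB p k r s)) =
           fls_lift (delta_q (Phi_inv p k) / fps_to_fls (phi_star p r s)) * fps_to_fls (kernel p k)"
proof -
  define A where "A = delta_q (Phi_inv p k) / fps_to_fls (phi_star p r s)"
  have Pinv: "Phi_inv p k $$ n = 0" if "n < -1" for n
    using that by (simp add: Phi_inv_def fls_X_inv_times_conv_shift)
  have dPinv: "delta_q (Phi_inv p k) $$ n = 0" if "n < -1" for n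
    using that by (simp add: delta_q_def fls_X_times_conv_shift Pinv)
  have "inverse (fps_to_fls (phi_star p r s)) = fps_to_fls (inverse (phi_star p r s))"
    by (rule fls_inverse_fps_to_fls) (use phi_star_nth_0[OF assms, of r s] in \<open>auto simp: subdegree_eq_0_iff\<close>)
  hence A: "A = delta_q (Phi_inv p k) * fps_to_fls (inverse (phi_star p r s))"
    by (simp add: A_def divide_inverse)
  have A0: "A $$ n = 0" if "n < -1" for n
  proof (cases "delta_q (Phi_inv p k) = 0")
    case False
    hence "fls_subdegree (delta_q (Phi_inv p k)) \<ge> -1"
      by (intro fls_subdegree_geI) (use dPinv in auto)
    thus ?thesis
      unfolding A using that fls_subdegree_fls_to_fps_gt0[of "inverse (phi_star p r s)"]
      by (intro fls_times_nth_eq0) linarith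
  qed (simp add: A)
  have K0: "fps_to_fls (kernel p k) $$ n = 0" if "n < 1" for n
  proof (cases "n = 0")
    case True
    have "(- kernel p k) $ 0 = 0"
      using fps_sums(2)[OF kernel_term_nth, where m = 0 and N = 0] by (simp add: kernel_def)
    thus ?thesis using True by simp
  qed (use that in simp)
  have neg: "(fls_lift A * fps_to_fls (kernel p k)) $$ n = 0" if "n < 0" for n
  proof (cases "fls_lift A = 0 \<or> fps_to_fls (kernel p k) = 0")
    case False
    hence "fls_subdegree (fls_lift A) \<ge> -1" "fls_subdegree (fps_to_fls (kernel p k)) \<ge> 1"
      using A0 K0 by (auto intro!: fls_subdegree_geI simp del: fps_to_fls_eq_0_iff fps_to_fls_nth)
    thus ?thesis using that by (intro fls_times_nth_eq0) linarith
  qed auto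
  show ?thesis
    by (rule fls_eqI) (use neg in \<open>auto simp: frakB_def A_def\<close>)
qed

definition eval_poly_fls :: "complex poly \<Rightarrow> complex fls \<Rightarrow> complex fls" where
  "eval_poly_fls P f = poly (map_poly fls_const P) f"

section \<open>The arithmetic data\<close>

text \<open>The Legendre symbol of a rational number \<open>a/b\<close> in lowest terms is that of \<open>a b\<close>.\<close>

definition Legendre_rat :: "rat \<Rightarrow> int \<Rightarrow> int" where
  "Legendre_rat x l = (case quotient_of x of (a, b) \<Rightarrow> Legendre (a * b) l)"

text \<open>
  For \<open>r + s\<close> odd the division by \<open>2\<close> is exact, so this is \<open>1/2 - \<epsilon>\<close> with \<open>\<epsilon> = (r + s)/2\<close>.
  Correspondingly \<open>2 - 2\<epsilon>\<close> is written \<open>2 - (r + s)\<close> below.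
\<close>

definition half_minus_eps :: "int \<Rightarrow> int \<Rightarrow> int" where
  "half_minus_eps r s = (1 - (r + s)) div 2"

definition theta_star :: "nat \<Rightarrow> int \<Rightarrow> int \<Rightarrow> rat" where
  "theta_star p r s = (-1) powi half_minus_eps r s * 2 * of_nat p powi r"

text \<open>\<open>24\<close> divides \<open>\<ell>\<^sup>2 - 1\<close> for every prime \<open>\<ell> > 3\<close>, so the division is exact.\<close>

definition Delta_star :: "nat \<Rightarrow> int \<Rightarrow> int \<Rightarrow> nat \<Rightarrow> int" where
  "Delta_star p r s l = (s + r * int p) * ((int l ^ 2 - 1) div 24)"

definition theta_factor :: "nat \<Rightarrow> int \<Rightarrow> int \<Rightarrow> nat \<Rightarrow> complex" where
  "theta_factor p r s l =
     of_int (Legendre_rat (theta_star p r s) (int l)) * of_nat l powi half_minus_eps r s"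

definition hecke_coeff :: "nat \<Rightarrow> int \<Rightarrow> int \<Rightarrow> nat \<Rightarrow> int \<Rightarrow> complex" where
  "hecke_coeff p r s l n = (let \<Delta> = Delta_star p r s l in
     of_nat l powi (2 - (r + s)) * c_star p r s (of_int (n * int l ^ 2 + \<Delta>))
     + theta_factor p r s l * of_int (Legendre (n - \<Delta>) (int l)) * c_star p r s (of_int n)
     + c_star p r s (of_int (n - \<Delta>) / of_nat l ^ 2))"

definition G_star :: "nat \<Rightarrow> int \<Rightarrow> int \<Rightarrow> nat \<Rightarrow> complex fls" where
  "G_star p r s l = 1 / fps_to_fls (phi_star p r s) *
     Abs_fls (\<lambda>n. if n \<ge> Delta_star p r s l then hecke_coeff p r s l n else 0)"

lemma G_star_series_nth:
  "Abs_fls (\<lambda>n. if n \<ge> Delta_star p r s l then hecke_coeff p r s l n else 0) $$ n =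
     (if n \<ge> Delta_star p r s l then hecke_coeff p r s l n else 0)"
  by (rule nth_Abs_fls_lower_bound[of "Delta_star p r s l"]) simp

end

(*
  The Hecke operator T(l^2) on weight (r+s)/2 is applied to f(t) = eta(t)^s eta(pt)^r. Its summands, divided by f, have
  weight 0 and are products of powers of eta quotients such as eta((t+b)/l^2)/eta(t). Expressing these quotients through
  Klein forms at points of order l and l^2 gives a family indexed by row vectors mod l^2 on which SL_2(Z) acts by right
  multiplication of the index, with no multiplier. The summands of the Hecke sum form an orbit, so the sum is invariant
  under Gamma_0(p), and no eta multiplier ever has to be computed; the constants are quadratic Gauss sums. The Hecke sum is
  G* up to a constant factor.

  The involution t -> -1/(pt) exchanges r and s, and since 0 < r + sp the sum for (s, r) is bounded at infinity, so G* is
  bounded at the cusp 0. Let P be the polynomial for which P(Phi_p^-1) matches the principal part of G* at infinity, and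
  subtract P(Phi_p^-1) and the constant term. The difference is Gamma_0(p)-invariant, vanishes at infinity and is bounded
  at 0, hence is 0 by the maximum principle, applied to its norm to SL_2(Z).

  That P = B(-Delta*, x) is a residue computation: the constant terms of Y^i delta(Y) / Y^(j+1) for Y = Phi_p^-1 are
  -1 for i = j and 0 otherwise, so pairing with the kernel 1/(x - Y) recovers polynomials in Y.
*)
theory Submission
  imports Defs "HOL-Complex_Analysis.Complex_Analysis"
begin

text \<open>The multiplier is removed by the functions \<open>torsion_unit x y\<close>. For a
  primitive index each is a product of Klein forms at the nonzero multiples of (x, y) / l^2, one
  from every pair z, -z, times eta^(l^2 - 1). A Klein form transforms exactly as long as its index
  moves with the matrix; only reducing the index modulo the lattice costs a root of unity. In the
  products these roots cancel: doubled points remove the signs, a centred range removes linear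
  terms, and what remains is governed by 1^2 + ... + h^2, which l = 2h + 1 divides because l > 3.
  The weight is cancelled by eta^(l^2 - 1), a power of eta^24. The constants are products over half
  systems, where Gauss's lemma produces the Legendre symbols. The odd parity of r + s lets a sign
  survive the powers s and r. The bounds by 24 give |Delta| < l^2 at both cusps, so that before
  division by phi the only exponent that can be negative is Delta.\<close>

section \<open>The normalised exponential exp(2 pi i z)\<close>

definition ee :: "complex \<Rightarrow> complex" where
  "ee z = exp (2 * of_real pi * \<i> * z)"

lemma ee_add: "ee (a + b) = ee a * ee b"
  by (simp add: ee_def distrib_left exp_add)

lemma ee_0 [simp]: "ee 0 = 1"
  by (simp add: ee_def)

lemma ee_nonzero [simp]: "ee z \<noteq> 0"
  by (simp add: ee_def)

lemma ee_minus: "ee (- a) = inverse (ee a)"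
  by (simp add: ee_def exp_minus)

lemma ee_diff: "ee (a - b) = ee a / ee b"
  by (simp add: ee_def right_diff_distrib exp_diff)

lemma ee_of_int [simp]: "ee (of_int n) = 1"
proof -
  have "ee (of_int n) = exp (2 * of_int n * of_real pi * \<i>)"
    by (simp add: ee_def mult_ac)
  thus ?thesis using exp_integer_2pi[of "of_int n"] by simp
qed

lemma ee_1 [simp]: "ee 1 = 1"
  using ee_of_int[of 1] by simp

lemma ee_add_of_int [simp]: "ee (z + of_int n) = ee z"
  by (simp add: ee_add)

lemma ee_Ints: "z \<in> \<int> \<Longrightarrow> ee z = 1"
  by (auto elim!: Ints_cases)

lemma ee_power: "ee z ^ n = ee (of_nat n * z)"
  by (simp add: ee_def exp_of_nat_mult [symmetric] mult_ac)

lemma ee_half [simp]: "ee (1 / 2) = - 1"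
  by (simp add: ee_def)

lemma norm_ee: "norm (ee z) = exp (- 2 * pi * Im z)"
  by (simp add: ee_def norm_exp_eq_Re)

lemma norm_ee_less_1: "Im z > 0 \<Longrightarrow> norm (ee z) < 1"
  by (simp add: norm_ee)

lemma ee_eq_1_iff: "ee z = 1 \<longleftrightarrow> z \<in> \<int>"
proof
  assume "ee z = 1"
  then obtain n where n: "Re (2 * of_real pi * \<i> * z) = 0" "Im (2 * of_real pi * \<i> * z) = of_int (2 * n) * pi"
    by (auto simp: ee_def exp_eq_1)
  from n have "z = of_int n"
    by (simp add: complex_eq_iff)
  thus "z \<in> \<int>" by simp
qed (rule ee_Ints)

lemma ee_sum: "ee (\<Sum>i\<in>A. f i) = (\<Prod>i\<in>A. ee (f i))"
  by (induction A rule: infinite_finite_induct) (auto simp: ee_add)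

lemma ee_holomorphic [holomorphic_intros]: "f holomorphic_on A \<Longrightarrow> (\<lambda>z. ee (f z)) holomorphic_on A"
  unfolding ee_def by (intro holomorphic_intros)

lemma ee_surj_ex:
  assumes "w \<noteq> 0"
  obtains z where "ee z = w"
proof
  show "ee (Ln w / (2 * of_real pi * \<i>)) = w"
    using assms by (simp add: ee_def)
qed

section \<open>The odd theta product\<close>

text \<open>The q-Pochhammer symbol (w; q) with infinitely many factors; w = q gives Euler's
  product.\<close>

definition qp :: "complex \<Rightarrow> complex \<Rightarrow> complex" where
  "qp w q = (\<Prod>n. 1 - w * q ^ n)"

lemma qp_convergent:
  fixes w q :: complex
  assumes "norm q < 1"
  shows "convergent_prod (\<lambda>n. 1 - w * q ^ n)"
proof -
  have "summable (\<lambda>n. norm w * norm q ^ n)"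
    using assms by (intro summable_mult summable_geometric) simp
  hence "summable (\<lambda>n. norm ((1 - w * q ^ n) - 1))"
    by (simp add: norm_mult norm_power)
  hence "abs_convergent_prod (\<lambda>n. 1 - w * q ^ n)"
    by (rule summable_imp_abs_convergent_prod)
  thus ?thesis
    by (rule abs_convergent_prod_imp_convergent_prod)
qed

lemma qp_has_prod: "norm q < 1 \<Longrightarrow> (\<lambda>n. 1 - w * q ^ n) has_prod qp w q"
  unfolding qp_def by (rule convergent_prod_has_prod[OF qp_convergent])

lemma qp_eq_0_iff: "norm q < 1 \<Longrightarrow> qp w q = 0 \<longleftrightarrow> (\<exists>n. w * q ^ n = 1)"
  using has_prod_eq_0_iff[OF qp_has_prod, of q w] by auto

lemma qp_LIMSEQ: "norm q < 1 \<Longrightarrow> (\<lambda>n. \<Prod>i<n. 1 - w * q ^ i) \<longlonglongrightarrow> qp w q"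
  using has_prod_imp_tendsto'[OF qp_has_prod] .

lemma qp_shift:
  assumes "norm q < 1"
  shows "qp w q = (1 - w) * qp (w * q) q"
proof (rule LIMSEQ_unique)
  show "(\<lambda>n. \<Prod>i<Suc n. 1 - w * q ^ i) \<longlonglongrightarrow> qp w q"
    using qp_LIMSEQ[OF assms, of w] by (rule LIMSEQ_Suc)
  have "(\<lambda>n. (1 - w) * (\<Prod>i<n. 1 - w * q * q ^ i)) \<longlonglongrightarrow> (1 - w) * qp (w * q) q"
    by (intro tendsto_intros qp_LIMSEQ assms)
  thus "(\<lambda>n. \<Prod>i<Suc n. 1 - w * q ^ i) \<longlonglongrightarrow> (1 - w) * qp (w * q) q"
    by (simp add: prod.lessThan_Suc_shift mult.assoc del: prod.lessThan_Suc)
qed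

text \<open>Identities between the n-th factors pass to the infinite products, because partial
  products may be rearranged before the limit is taken. The factors will run over 1 and -1, or over
  all l-th roots of unity.\<close>

lemma qp_prod:
  assumes "finite I" "norm q < 1" "norm q' < 1"
    and "\<And>n. (\<Prod>i\<in>I. 1 - w i * q ^ n) = 1 - w' * q' ^ n"
  shows "(\<Prod>i\<in>I. qp (w i) q) = qp w' q'"
proof (rule LIMSEQ_unique)
  show "(\<lambda>n. \<Prod>i\<in>I. \<Prod>j<n. 1 - w i * q ^ j) \<longlonglongrightarrow> (\<Prod>i\<in>I. qp (w i) q)"
    by (intro tendsto_prod qp_LIMSEQ assms)
  have "(\<Prod>i\<in>I. \<Prod>j<n. 1 - w i * q ^ j) = (\<Prod>j<n. 1 - w' * q' ^ j)" for n
    by (subst prod.swap) (simp add: assms(4))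
  thus "(\<lambda>n. \<Prod>i\<in>I. \<Prod>j<n. 1 - w i * q ^ j) \<longlonglongrightarrow> qp w' q'"
    using qp_LIMSEQ[OF assms(3), of w'] by simp
qed

text \<open>The M-test with majorant M * r^n, where M bounds \<open>f\<close> on the compact
  set.\<close>

lemma qp_uniform_limit:
  assumes "compact A" "r < 1" "\<And>x. x \<in> A \<Longrightarrow> norm (g x) \<le> r" "continuous_on A f" "continuous_on A g"
  shows "uniform_limit A (\<lambda>n x. \<Prod>i<n. 1 - f x * g x ^ i) (\<lambda>x. qp (f x) (g x)) sequentially"
proof -
  obtain M where M: "\<And>x. x \<in> A \<Longrightarrow> norm (f x) \<le> M"
    using compact_imp_bounded[OF compact_continuous_image[OF assms(4,1)]]
    by (auto simp: bounded_iff)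
  have r: "r \<ge> 0" if "A \<noteq> {}" using that assms(3) norm_ge_zero order_trans by blast
  have "uniformly_convergent_on A (\<lambda>n x. \<Prod>i<n. 1 - f x * g x ^ i)"
  proof (cases "A = {}")
    case False
    show ?thesis
    proof (rule uniformly_convergent_on_prod')
      show "uniformly_convergent_on A (\<lambda>N x. \<Sum>n<N. norm (1 - f x * g x ^ n - 1))"
      proof (rule Weierstrass_m_test'_ev)
        show "\<forall>\<^sub>F n in sequentially. \<forall>x\<in>A. norm (norm (1 - f x * g x ^ n - 1)) \<le> M * r ^ n"
          using r[OF False] assms(3) M norm_ge_zero
          by (auto simp: norm_mult norm_power intro!: always_eventually mult_mono power_mono) 
             (meson M False ex_in_conv order_trans norm_ge_zero)
        show "summable (\<lambda>n. M * r ^ n)"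
          using r[OF False] assms(2) by (intro summable_mult summable_geometric) auto
      qed
    qed (use assms in \<open>auto intro!: continuous_intros\<close>)
  qed auto
  then obtain L where L: "uniform_limit A (\<lambda>n x. \<Prod>i<n. 1 - f x * g x ^ i) L sequentially"
    by (auto simp: uniformly_convergent_on_def)
  have "L x = qp (f x) (g x)" if "x \<in> A" for x
    using tendsto_uniform_limitI[OF L that] qp_LIMSEQ[of "g x" "f x"] assms(2,3) that
    by (meson LIMSEQ_unique order_le_less_trans)
  with L show ?thesis
    by (simp cong: uniform_limit_cong')
qed

lemma qp_holomorphic:
  assumes "open S" "f holomorphic_on S" "g holomorphic_on S" "\<And>x. x \<in> S \<Longrightarrow> norm (g x) < 1"
  shows "(\<lambda>x. qp (f x) (g x)) holomorphic_on S"
proof (rule holomorphic_uniform_sequence[OF assms(1)])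
  show "(\<lambda>x. \<Prod>i<n. 1 - f x * g x ^ i) holomorphic_on S" for n
    by (intro holomorphic_intros assms)
  fix x assume "x \<in> S"
  then obtain d where d: "d > 0" "cball x d \<subseteq> S"
    using assms(1) open_contains_cball by blast
  have cont: "continuous_on (cball x d) f" "continuous_on (cball x d) g"
    using assms d holomorphic_on_imp_continuous_on continuous_on_subset by blast+
  have "continuous_on (cball x d) (\<lambda>x. norm (g x))"
    by (intro continuous_intros cont)
  then obtain y where y: "y \<in> cball x d" "\<And>z. z \<in> cball x d \<Longrightarrow> norm (g z) \<le> norm (g y)"
    using continuous_attains_sup[OF compact_cball, of x d] d(1) by (metis centre_in_cball empty_iff less_imp_le)
  have "uniform_limit (cball x d) (\<lambda>n x. \<Prod>i<n. 1 - f x * g x ^ i) (\<lambda>x. qp (f x) (g x)) sequentially"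
    by (rule qp_uniform_limit[where r = "norm (g y)"]) (use y d assms cont in auto)
  thus "\<exists>d>0. cball x d \<subseteq> S \<and> uniform_limit (cball x d) (\<lambda>n x. \<Prod>i<n. 1 - f x * g x ^ i) (\<lambda>x. qp (f x) (g x)) sequentially"
    using d by blast
qed

text \<open>Up to a constant, Jacobi's odd theta function divided by eta^3. With this normalisation
  the derivative at z = 0 does not depend on t, and the weight is -1.\<close>

definition theta0 :: "complex \<Rightarrow> complex \<Rightarrow> complex" where
  "theta0 z t = (ee (z / 2) - ee (- z / 2)) * qp (ee z * ee t) (ee t) * qp (ee (- z) * ee t) (ee t)
                  / qp (ee t) (ee t) ^ 2"

lemma qp_self_nonzero: "norm q < 1 \<Longrightarrow> q \<noteq> 0 \<Longrightarrow> qp q q \<noteq> 0"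
proof
  assume q: "norm q < 1" "q \<noteq> 0" "qp q q = 0"
  then obtain n where "q ^ Suc n = 1"
    by (auto simp: qp_eq_0_iff)
  hence "norm q ^ Suc n = 1"
    by (metis norm_one norm_power)
  moreover have "norm q ^ Suc n < 1"
    using q by (intro power_less_one_iff[THEN iffD2]) auto
  ultimately show False by simp
qed

lemma theta0_minus: "theta0 (- z) t = - theta0 z t"
  by (simp add: theta0_def algebra_simps diff_divide_distrib)

lemma theta0_add_1: "theta0 (z + 1) t = - theta0 z t"
proof -
  have *: "ee ((z + 1) / 2) = - ee (z / 2)" "ee (- (z + 1) / 2) = - ee (- z / 2)"
    using ee_add[of "z / 2" "1 / 2"] ee_diff[of "- z / 2" "1 / 2"]
    by (simp_all add: add_divide_distrib diff_divide_distrib)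
  have **: "ee (z + 1) = ee z" "ee (- (z + 1)) = ee (- z)"
    using ee_diff[of "-z" 1] by (simp_all add: ee_add)
  show ?thesis
    unfolding theta0_def * ** by (simp add: algebra_simps diff_divide_distrib)
qed

text \<open>Adding t multiplies \<open>ee z\<close> by q: one Pochhammer symbol loses its first
  factor, the other gains one, and the exponential prefactor accounts for the rest.\<close>

lemma theta0_add_tau:
  assumes "Im t > 0"
  shows "theta0 (z + t) t = - ee (- t / 2 - z) * theta0 z t"
proof -
  define q where "q = ee t"
  define w where "w = ee (z / 2)"
  define u where "u = ee (t / 2)"
  have q: "norm q < 1" "q = u ^ 2" "u \<noteq> 0"
    using norm_ee_less_1[OF assms] ee_power[of "t/2" 2] by (simp_all add: q_def u_def)
  have w: "ee z = w ^ 2" "w \<noteq> 0" "ee (- z) = inverse (w ^ 2)" "ee (-z/2) = inverse w"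
    using ee_power[of "z/2" 2] ee_minus[of z] ee_minus[of "z/2"] by (simp_all add: w_def)
  have zt: "ee (z + t) = w ^ 2 * q" "ee (-(z + t)) = inverse (w ^ 2 * q)"
    "ee ((z + t) / 2) = w * u" "ee (- (z + t) / 2) = inverse (w * u)"
    using ee_minus[of "z + t"] ee_minus[of "(z+t)/2"]
    by (simp_all add: ee_add w q_def w_def u_def add_divide_distrib minus_divide_left del: minus_add_distrib)
  have e: "ee (- t / 2 - z) = inverse (u * w ^ 2)"
    using ee_diff[of "-t/2" z] ee_minus[of "t/2"] w by (simp add: u_def field_simps)
  have 1: "qp (w\<^sup>2 * q) q = (1 - w\<^sup>2 * q) * qp (w\<^sup>2 * q * q) q"
    by (rule qp_shift) (use q in auto)
  have 2: "qp (inverse (w\<^sup>2)) q = (1 - inverse (w\<^sup>2)) * qp (inverse (w\<^sup>2) * q) q"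
    by (rule qp_shift) (use q in auto)
  have q0: "q \<noteq> 0" by (simp add: q_def)
  have 3: "inverse (w ^ 2 * q) * q = inverse (w ^ 2)"
    using q0 by simp
  have key: "(w * u - inverse (w * u)) * (1 - inverse (w\<^sup>2)) = - inverse (u * w^2) * (w - inverse w) * (1 - w\<^sup>2 * q)"
    using q w unfolding q(2) by (simp add: field_simps power2_eq_square)
  have "theta0 (z + t) t = ((w * u - inverse (w * u)) * (1 - inverse (w\<^sup>2))) * qp (w\<^sup>2 * q * q) q * qp (inverse (w\<^sup>2) * q) q / qp q q ^ 2"
    unfolding theta0_def zt q_def[symmetric] 3 2 by simp
  also have "\<dots> = - ee (- t / 2 - z) * theta0 z t"
    unfolding key theta0_def q_def[symmetric] w(1,3,4) w_def[symmetric] e 1 by (simp add: field_simps)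
  finally show ?thesis .
qed

lemma theta0_add_of_nat: "theta0 (z + of_nat n) t = (-1) ^ n * theta0 z t"
proof (induction n)
  case (Suc n)
  have "theta0 (z + of_nat (Suc n)) t = theta0 ((z + of_nat n) + 1) t"
    by (simp add: algebra_simps)
  thus ?case by (simp only: theta0_add_1 Suc.IH) simp
qed auto

lemma theta0_add_of_int: "theta0 (z + of_int n) t = (-1) powi n * theta0 z t"
proof (cases "n \<ge> 0")
  case True
  thus ?thesis using theta0_add_of_nat[of z "nat n" t] by (simp add: power_int_def)
next
  case False
  thus ?thesis using theta0_add_of_nat[of "z + of_int n" "nat (- n)" t]
    by (auto simp: power_int_def minus_one_power_iff split: if_splits)
qed

lemma theta0_add_nat_tau:
  assumes "Im t > 0"
  shows "theta0 (z + of_nat m * t) t = (-1) ^ m * ee (- (of_nat m ^ 2 * t / 2) - of_nat m * z) * theta0 z t"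
proof (induction m)
  case (Suc m)
  have "theta0 (z + of_nat (Suc m) * t) t = theta0 ((z + of_nat m * t) + t) t"
    by (simp add: algebra_simps)
  also have "\<dots> = (-1) ^ Suc m * (ee (- t / 2 - (z + of_nat m * t)) * ee (- (of_nat m ^ 2 * t / 2) - of_nat m * z)) * theta0 z t"
    by (simp only: theta0_add_tau[OF assms] Suc.IH) simp
  also have "ee (- t / 2 - (z + of_nat m * t)) * ee (- (of_nat m ^ 2 * t / 2) - of_nat m * z)
     = ee (- (of_nat (Suc m) ^ 2 * t / 2) - of_nat (Suc m) * z)"
    unfolding ee_add [symmetric] by (rule arg_cong[where f = ee]) (simp add: field_simps power2_eq_square)
  finally show ?case .
qed auto

lemma theta0_add_int_tau:
  assumes "Im t > 0"
  shows "theta0 (z + of_int m * t) t = (-1) powi m * ee (- (of_int m ^ 2 * t / 2) - of_int m * z) * theta0 z t"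
proof (cases "m \<ge> 0")
  case True
  thus ?thesis using theta0_add_nat_tau[OF assms, of z "nat m"] by (simp add: power_int_def)
next
  case False
  define n where "n = nat (- m)"
  have m: "m = - int n" using False by (simp add: n_def)
  have "theta0 z t = (-1) ^ n * ee (- (of_nat n ^ 2 * t / 2) - of_nat n * (z + of_int m * t)) * theta0 (z + of_int m * t) t"
    using theta0_add_nat_tau[OF assms, of "z + of_int m * t" n] by (simp add: m)
  hence "(-1) powi m * ee (- (of_int m ^ 2 * t / 2) - of_int m * z) * theta0 z t =
     ((-1) powi m * (-1) ^ n) * (ee (- (of_int m ^ 2 * t / 2) - of_int m * z) * ee (- (of_nat n ^ 2 * t / 2) - of_nat n * (z + of_int m * t))) * theta0 (z + of_int m * t) t"
    by (simp add: mult_ac)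
  also have "ee (- (of_int m ^ 2 * t / 2) - of_int m * z) * ee (- (of_nat n ^ 2 * t / 2) - of_nat n * (z + of_int m * t)) = 1"
    unfolding ee_add [symmetric] by (subst ee_0 [symmetric], rule arg_cong[where f = ee]) (simp add: field_simps power2_eq_square m)
  also have "(-1) powi m * (-1 :: complex) ^ n = 1"
    by (auto simp: m power_int_minus minus_one_power_iff)
  finally show ?thesis by simp
qed

lemma theta0_add_lattice:
  assumes "Im t > 0"
  shows "theta0 (z + (of_int m * t + of_int n)) t =
     (-1) powi (m + n) * ee (- (of_int m ^ 2 * t / 2) - of_int m * z) * theta0 z t"
proof -
  have "theta0 (z + (of_int m * t + of_int n)) t = theta0 ((z + of_int m * t) + of_int n) t"
    by (simp add: add.assoc)
  thus ?thesis
    by (simp only: theta0_add_of_int theta0_add_int_tau[OF assms]) (simp add: power_int_add)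
qed

lemma theta0_holomorphic:
  assumes "Im t > 0"
  shows "(\<lambda>z. theta0 z t) holomorphic_on A"
proof -
  have "(\<lambda>z. theta0 z t) holomorphic_on UNIV"
    unfolding theta0_def
    by (intro holomorphic_intros qp_holomorphic)
       (use assms in \<open>auto simp: norm_ee_less_1 qp_self_nonzero\<close>)
  thus ?thesis using holomorphic_on_subset by blast
qed

lemma theta0_0 [simp]: "theta0 0 t = 0"
  by (simp add: theta0_def)

lemma theta0_eq_0_iff:
  assumes "Im t > 0"
  shows "theta0 z t = 0 \<longleftrightarrow> (\<exists>m n :: int. z = of_int m * t + of_int n)"
proof
  assume "\<exists>m n :: int. z = of_int m * t + of_int n"
  then obtain m n :: int where "z = of_int m * t + of_int n" by blast
  thus "theta0 z t = 0"
    using theta0_add_lattice[OF assms, of 0 m n] by simp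
next
  have q: "norm (ee t) < 1" "qp (ee t) (ee t) \<noteq> 0"
    using norm_ee_less_1[OF assms] by (auto simp: qp_self_nonzero)
  assume "theta0 z t = 0"
  then consider "ee (z / 2) = ee (- z / 2)" | "\<exists>n. ee z * ee t * ee t ^ n = 1" | "\<exists>n. ee (-z) * ee t * ee t ^ n = 1"
    using q by (auto simp: theta0_def qp_eq_0_iff)
  thus "\<exists>m n :: int. z = of_int m * t + of_int n"
  proof cases
    case 1
    hence "ee z = 1" using ee_diff[of "z/2" "-z/2"] by simp
    hence "z \<in> \<int>" by (simp add: ee_eq_1_iff)
    then obtain n where "z = of_int n" by (auto elim: Ints_cases)
    thus ?thesis by (intro exI[of _ 0] exI[of _ n]) simp
  next
    case 2
    then obtain n where "ee (z + t + of_nat n * t) = 1"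
      by (auto simp: ee_add ee_power)
    hence "z + t + of_nat n * t \<in> \<int>" by (simp add: ee_eq_1_iff)
    then obtain k where "z + t + of_nat n * t = of_int k" by (auto elim: Ints_cases)
    hence "z = of_int (- int n - 1) * t + of_int k"
      by (simp add: algebra_simps)
    thus ?thesis by blast
  next
    case 3
    then obtain n where "ee (- z + t + of_nat n * t) = 1"
      unfolding ee_add ee_power by blast
    hence "- z + t + of_nat n * t \<in> \<int>" by (simp add: ee_eq_1_iff)
    then obtain k where "- z + t + of_nat n * t = of_int k" by (auto elim: Ints_cases)
    hence "z = of_int (int n + 1) * t + of_int (- k)"
      by (simp add: algebra_simps)
    thus ?thesis by blast
  qed
qed

text \<open>Only the first factor of \<open>theta0\<close> vanishes at 0, and the remaining quotient
  has the value 1 there. This fixes the constant in \<open>theta0_modular\<close>.\<close>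

lemma theta0_deriv_0:
  assumes "Im t > 0"
  shows "((\<lambda>z. theta0 z t) has_field_derivative 2 * of_real pi * \<i>) (at 0)"
proof -
  have q: "norm (ee t) < 1" "qp (ee t) (ee t) \<noteq> 0"
    using norm_ee_less_1[OF assms] by (auto simp: qp_self_nonzero)
  define g where "g z = qp (ee z * ee t) (ee t) * qp (ee (- z) * ee t) (ee t) / qp (ee t) (ee t) ^ 2" for z
  have "g holomorphic_on UNIV"
    unfolding g_def by (intro holomorphic_intros qp_holomorphic) (use q in auto)
  then obtain g' where g': "(g has_field_derivative g') (at 0)"
    by (meson UNIV_I field_differentiable_def holomorphic_on_def at_within_open open_UNIV)
  have [simp]: "g 0 = 1"
    using q by (simp add: g_def power2_eq_square)
  have "((\<lambda>z. ee (z / 2) - ee (- z / 2)) has_field_derivative 2 * of_real pi * \<i>) (at 0)"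
    unfolding ee_def by (auto intro!: derivative_eq_intros)
  from DERIV_mult[OF this g']
  have "((\<lambda>z. (ee (z / 2) - ee (- z / 2)) * g z) has_field_derivative 2 * of_real pi * \<i>) (at 0)"
    by simp
  thus ?thesis
    by (simp add: g_def theta0_def mult.assoc)
qed

lemma moebius_aux:
  fixes A B C D :: int and t :: complex
  assumes "Im t > 0" "A * D - B * C = 1"
  shows "of_int C * t + of_int D \<noteq> 0" and "Im ((of_int A * t + of_int B) / (of_int C * t + of_int D)) > 0"
proof -
  show *: "of_int C * t + of_int D \<noteq> 0"
  proof
    assume 0: "of_int C * t + of_int D = 0"
    hence "Im (of_int C * t + of_int D) = 0" "Re (of_int C * t + of_int D) = 0" by simp_all
    hence "C = 0" "D = 0" using assms(1) by auto
    thus False using assms(2) by simp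
  qed
  have "Im ((of_int A * t + of_int B) / (of_int C * t + of_int D)) =
    (of_int (A * D - B * C) * Im t) / (cmod (of_int C * t + of_int D))\<^sup>2"
    unfolding Im_divide cmod_power2 by (simp add: algebra_simps)
  thus "Im ((of_int A * t + of_int B) / (of_int C * t + of_int D)) > 0"
    using assms * by simp
qed

lemma lattice_reduction:
  assumes "Im t > 0"
  obtains m n :: int and a b :: real where
    "z = (of_real a * t + of_real b) + (of_int m * t + of_int n)" "a \<in> {0..1}" "b \<in> {0..1}"
proof
  define x where "x = Im z / Im t"
  define y where "y = Re z - x * Re t"
  show "z = (of_real (frac x) * t + of_real (frac y)) + (of_int \<lfloor>x\<rfloor> * t + of_int \<lfloor>y\<rfloor>)"
    using assms by (simp add: complex_eq_iff frac_def algebra_simps x_def y_def)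
qed (auto simp: frac_lt_1 less_imp_le)

text \<open>As functions of \<open>z\<close> both sides have the same simple zeros and the same quasi-periods up to constants of
  modulus 1, so their quotient is bounded, hence constant, and its value is read off at \<open>z = 0\<close>.\<close>

theorem theta0_modular:
  fixes A B C D :: int and t :: complex
  assumes t: "Im t > 0" and det: "A * D - B * C = 1"
  defines "j \<equiv> of_int C * t + of_int D" and "t' \<equiv> (of_int A * t + of_int B) / (of_int C * t + of_int D)"
  shows "theta0 (z / j) t' * ee (- (of_int C * z ^ 2 / (2 * j))) = theta0 z t / j"
proof -
  have j0: "j \<noteq> 0" and t': "Im t' > 0"
    using moebius_aux[OF t det] by (simp_all add: j_def t'_def)
  have jt': "j * t' = of_int A * t + of_int B"
    using j0 by (simp add: t'_def flip: j_def)
  have detc: "of_int A * of_int D - of_int B * of_int C = (1 :: complex)"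
    using det by (metis of_int_1 of_int_diff of_int_mult)
  define F where "F z = theta0 (z / j) t' * ee (- (of_int C * z ^ 2 / (2 * j)))" for z
  define h where "h z = F z / theta0 z t" for z
  define L where "L = {z. theta0 z t = 0}"
  have L_iff: "z \<in> L \<longleftrightarrow> (\<exists>m n :: int. z = of_int m * t + of_int n)" for z
    using theta0_eq_0_iff[OF t] by (simp add: L_def)
  have quasi: "\<exists>c. norm c = 1 \<and> (\<forall>z. h (z + w) = c * h z)" if w_in: "w \<in> L" for w
  proof -
    obtain m n :: int where w: "w = of_int m * t + of_int n"
      using w_in L_iff by blast
    \<comment> \<open>The coordinates of w / j in the lattice of t', found by inverting the
      matrix.\<close>
    define m' where "m' = m * D - n * C"
    define n' where "n' = n * A - m * B"
    have w': "w = j * (of_int m' * t' + of_int n')"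
    proof -
      have "j * (of_int m' * t' + of_int n') = of_int m' * (of_int A * t + of_int B) + of_int n' * j"
        unfolding jt' [symmetric] by (simp add: algebra_simps)
      also have "\<dots> = (of_int m * t + of_int n) * (of_int A * of_int D - of_int B * of_int C)"
        unfolding m'_def n'_def j_def by (simp add: algebra_simps)
      also have "\<dots> = of_int m * t + of_int n"
        by (simp add: detc)
      finally show ?thesis by (simp add: w)
    qed
    define c1 :: complex where "c1 = (-1) powi (m' + n') * ee ((of_int m' * of_int n' - of_int m * of_int n) / 2)"
    define c2 :: complex where "c2 = (-1) powi (m + n)"
    have Fw: "F (z + w) = c1 * ee (- (of_int m ^ 2 * t / 2) - of_int m * z) * F z" for z
    proof -
      have "(z + w) / j = z / j + (of_int m' * t' + of_int n')"
        using j0 by (simp add: w' add_divide_distrib)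
      hence "theta0 ((z + w) / j) t' = (-1) powi (m' + n') * ee (- (of_int m' ^ 2 * t' / 2) - of_int m' * (z / j)) * theta0 (z / j) t'"
        by (simp only: theta0_add_lattice[OF t'])
      hence "F (z + w) = (-1) powi (m' + n') * theta0 (z / j) t' *
        (ee (- (of_int m' ^ 2 * t' / 2) - of_int m' * (z / j)) * ee (- (of_int C * (z + w) ^ 2 / (2 * j))))"
        by (simp add: F_def)
      also have "ee (- (of_int m' ^ 2 * t' / 2) - of_int m' * (z / j)) * ee (- (of_int C * (z + w) ^ 2 / (2 * j))) =
        ee ((of_int m' * of_int n' - of_int m * of_int n) / 2) * ee (- (of_int m ^ 2 * t / 2) - of_int m * z) * ee (- (of_int C * z ^ 2 / (2 * j)))"
        unfolding ee_add [symmetric]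
      proof (rule arg_cong[where f = ee])
        \<comment> \<open>The exponents agree after multiplication by 2 j: their difference contains
          the factor A D - B C - 1.\<close>
        have "(of_int m' ^ 2 * (of_int A * t + of_int B) + 2 * of_int m' * z + of_int C * (z + w) ^ 2) -
          (- (of_int m' * of_int n' - of_int m * of_int n) * j + of_int m ^ 2 * t * j + 2 * of_int m * z * j + of_int C * z ^ 2) =
          of_int m' * w * (of_int A * of_int D - of_int B * of_int C - 1)"
          unfolding w m'_def n'_def j_def by (simp add: algebra_simps power2_eq_square)
        hence "of_int m' ^ 2 * (of_int A * t + of_int B) + 2 * of_int m' * z + of_int C * (z + w) ^ 2 =
          - (of_int m' * of_int n' - of_int m * of_int n) * j + of_int m ^ 2 * t * j + 2 * of_int m * z * j + of_int C * z ^ 2"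
          by (simp add: detc)
        hence "of_int m' ^ 2 * (j * t') + 2 * of_int m' * z + of_int C * (z + w) ^ 2 =
          - (of_int m' * of_int n' - of_int m * of_int n) * j + of_int m ^ 2 * t * j + 2 * of_int m * z * j + of_int C * z ^ 2"
          by (simp only: jt')
        note E = this
        have "- (of_int m' ^ 2 * t' / 2) - of_int m' * (z / j) + - (of_int C * (z + w) ^ 2 / (2 * j)) =
          - ((of_int m' ^ 2 * (j * t') + 2 * of_int m' * z + of_int C * (z + w) ^ 2) / (2 * j))"
          using j0 by (simp add: add_divide_distrib)
        also have "\<dots> = (of_int m' * of_int n' - of_int m * of_int n) / 2 + (- (of_int m ^ 2 * t / 2) - of_int m * z) + - (of_int C * z ^ 2 / (2 * j))"
          unfolding E using j0 by (simp add: add_divide_distrib diff_divide_distrib left_diff_distrib)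
        finally show "- (of_int m' ^ 2 * t' / 2) - of_int m' * (z / j) + - (of_int C * (z + w) ^ 2 / (2 * j)) =
          (of_int m' * of_int n' - of_int m * of_int n) / 2 + (- (of_int m ^ 2 * t / 2) - of_int m * z) + - (of_int C * z ^ 2 / (2 * j))" .
      qed
      finally show ?thesis by (simp add: F_def c1_def)
    qed
    have Tw: "theta0 (z + w) t = c2 * ee (- (of_int m ^ 2 * t / 2) - of_int m * z) * theta0 z t" for z
      unfolding w c2_def by (rule theta0_add_lattice[OF t])
    have "norm (ee ((of_int m' * of_int n' - of_int m * of_int n) / 2)) = 1"
      by (simp add: norm_ee)
    hence "norm (c1 / c2) = 1"
      by (simp add: c1_def c2_def norm_mult norm_divide norm_power_int)
    moreover have "h (z + w) = c1 / c2 * h z" for z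
      unfolding h_def Fw Tw by simp
    ultimately show ?thesis by blast
  qed
  have F_hol: "F holomorphic_on UNIV"
  proof -
    have "((\<lambda>z. theta0 z t') \<circ> (\<lambda>z. z / j)) holomorphic_on UNIV"
      by (intro holomorphic_on_compose holomorphic_intros theta0_holomorphic t') (use j0 in auto)
    thus ?thesis unfolding F_def
      by (intro holomorphic_intros) (use j0 in \<open>auto simp: o_def\<close>)
  qed
  have lim0: "h \<midarrow>0\<rightarrow> 1 / j"
  proof -
    have 1: "((\<lambda>z. theta0 z t) has_field_derivative 2 * of_real pi * \<i>) (at 0)"
      by (rule theta0_deriv_0[OF t])
    have "((\<lambda>z. theta0 z t') has_field_derivative 2 * of_real pi * \<i>) (at (0 / j))"
      using theta0_deriv_0[OF t'] by simp
    moreover have "((\<lambda>z. z / j) has_field_derivative 1 / j) (at 0)"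
      using j0 by (auto intro!: derivative_eq_intros)
    ultimately have "((\<lambda>z. theta0 (z / j) t') has_field_derivative 2 * of_real pi * \<i> * (1 / j)) (at 0)"
      by (rule DERIV_chain2)
    moreover have "((\<lambda>z. ee (- (of_int C * z ^ 2 / (2 * j)))) has_field_derivative 0) (at 0)"
      unfolding ee_def using j0 by (auto intro!: derivative_eq_intros)
    ultimately have 2: "(F has_field_derivative 2 * of_real pi * \<i> * (1 / j)) (at 0)"
      unfolding F_def by (auto intro!: derivative_eq_intros simp: j0)
    have "(\<lambda>z. (F z / z) / (theta0 z t / z)) \<midarrow>0\<rightarrow> (2 * of_real pi * \<i> * (1 / j)) / (2 * of_real pi * \<i>)"
      by (intro tendsto_divide) (use 1 2 in \<open>auto simp: has_field_derivative_iff F_def\<close>)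
    also have "(2 * of_real pi * \<i> * (1 / j)) / (2 * of_real pi * \<i>) = 1 / j"
      by simp
    finally show ?thesis
      by (rule Lim_transform_eventually) (auto simp: eventually_at_filter h_def)
  qed
  have limL: "\<exists>c. norm c = norm (1 / j) \<and> h \<midarrow>w\<rightarrow> c" if w_in: "w \<in> L" for w
  proof -
    obtain c where c: "norm c = 1" "\<And>z. h (z + w) = c * h z"
      using quasi[OF w_in] by blast
    have "(\<lambda>z. c * h z) \<midarrow>0\<rightarrow> c * (1 / j)"
      by (intro tendsto_intros lim0)
    hence "(\<lambda>z. h (z + w)) \<midarrow>0\<rightarrow> c * (1 / j)"
      by (simp only: c(2))
    hence "h \<midarrow>w\<rightarrow> c * (1 / j)"
      using LIM_offset_zero_cancel[of h w] by (simp add: add.commute)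
    thus ?thesis using c(1) by (intro exI[of _ "c * (1 / j)"]) (simp add: norm_mult norm_divide)
  qed
  have an: "F analytic_on {z}" "(\<lambda>z. theta0 z t) analytic_on {z}" for z
    using F_hol theta0_holomorphic[OF t, of UNIV] by (auto intro: holomorphic_on_imp_analytic_at)
  have ana: "h analytic_on {z}" if "z \<notin> L" for z
    unfolding h_def using that by (intro analytic_intros an) (auto simp: L_def)
  \<comment> \<open>At lattice points \<open>h\<close> is 0, the default value of a division by
    zero; \<open>remove_sings\<close> puts the limit from \<open>limL\<close> in its place.\<close>
  define g where "g = remove_sings h"
  have g_eq: "g z = h z" if "z \<notin> L" for z
    unfolding g_def by (rule remove_sings_at_analytic[OF ana[OF that]])
  have g_L: "norm (g w) = norm (1 / j)" if "w \<in> L" for w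
    using limL[OF that] by (auto simp: g_def remove_sings_eqI)
  have "g analytic_on {z}" for z
  proof (cases "z \<in> L")
    case True
    have "isolated_singularity_at h z"
      unfolding h_def by (intro isolated_singularity_at_divide isolated_singularity_at_analytic not_essential_analytic an)
    thus ?thesis
      unfolding g_def using limL[OF True] remove_sings_analytic_at by blast
  next
    case False
    show ?thesis unfolding g_def by (rule remove_sings_analytic_on[OF ana[OF False]])
  qed
  hence "g analytic_on UNIV"
    by (subst analytic_on_analytic_at) blast
  hence g_hol: "g holomorphic_on UNIV"
    by (rule analytic_imp_holomorphic)
  have per: "norm (g (z + w)) = norm (g z)" if "w \<in> L" for z w
  proof (cases "z \<in> L")
    case True
    then obtain m n m' n' :: int where "z = of_int m * t + of_int n" "w = of_int m' * t + of_int n'"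
      using \<open>w \<in> L\<close> unfolding L_iff by blast
    hence "z + w = of_int (m + m') * t + of_int (n + n')"
      by (simp add: algebra_simps)
    hence "z + w \<in> L"
      using L_iff by blast
    thus ?thesis using g_L True by simp
  next
    case False
    have "z + w \<notin> L"
    proof
      assume "z + w \<in> L"
      then obtain m n m' n' :: int where "z + w = of_int m * t + of_int n" "w = of_int m' * t + of_int n'"
        using \<open>w \<in> L\<close> unfolding L_iff by blast
      hence "z = of_int (m - m') * t + of_int (n - n')"
        by (simp add: algebra_simps)
      thus False using False L_iff by blast
    qed
    thus ?thesis using False quasi[OF that] by (auto simp: g_eq norm_mult)
  qed
  define K where "K = (\<lambda>(a :: real, b :: real). of_real a * t + of_real b) ` ({0..1} \<times> {0..1})"
  have "compact K"
    unfolding K_def by (intro compact_continuous_image compact_Times) (auto intro!: continuous_intros simp: case_prod_unfold)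
  hence "compact (g ` K)"
    using g_hol holomorphic_on_imp_continuous_on continuous_on_subset compact_continuous_image by (metis subset_UNIV)
  then obtain M where M: "\<And>z. z \<in> K \<Longrightarrow> norm (g z) \<le> M"
    by (force dest!: compact_imp_bounded simp: bounded_iff)
  have "norm (g z) \<le> M" for z
  proof -
    obtain m n a b where z: "z = (of_real a * t + of_real b) + (of_int m * t + of_int n)" "a \<in> {0..1}" "b \<in> {0..1}"
      by (rule lattice_reduction[OF t])
    have "norm (g z) = norm (g (of_real a * t + of_real b))"
      unfolding z(1) by (rule per) (use L_iff in blast)
    also have "\<dots> \<le> M"
      by (rule M, unfold K_def, rule image_eqI[of _ _ "(a, b)"]) (use z in auto)
    finally show ?thesis .
  qed
  hence "bounded (range g)"
    by (auto simp: bounded_iff)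
  then obtain c where c: "\<And>z. g z = c"
    using Liouville_theorem[OF g_hol] by (auto simp: constant_on_def)
  have "g 0 = 1 / j"
    using lim0 by (auto simp: g_def)
  hence c': "c = 1 / j" using c by simp
  show ?thesis
  proof (cases "z \<in> L")
    case False
    thus ?thesis
      using c[of z] g_eq[OF False] by (auto simp: c' h_def F_def L_def field_simps)
  next
    \<comment> \<open>At lattice points \<open>g\<close> and \<open>h\<close> differ, so the
      constancy of \<open>g\<close> says nothing there; both sides of the claim vanish
      instead.\<close>
    case True
    then obtain m n :: int where "z = of_int m * t + of_int n"
      using L_iff by blast
    moreover have "j * (of_int (m * D - n * C) * t' + of_int (n * A - m * B)) =
        of_int (m * D - n * C) * (of_int A * t + of_int B) + of_int (n * A - m * B) * j"
      unfolding jt' [symmetric] by (simp add: algebra_simps)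
    moreover have "\<dots> = (of_int m * t + of_int n) * (of_int A * of_int D - of_int B * of_int C)"
      unfolding j_def by (simp add: algebra_simps)
    moreover have "\<dots> = of_int m * t + of_int n"
      by (simp add: detc)
    ultimately have "z / j = of_int (m * D - n * C) * t' + of_int (n * A - m * B)"
      using j0 by (metis nonzero_mult_div_cancel_left)
    hence "theta0 (z / j) t' = 0"
      using theta0_eq_0_iff[OF t'] by blast
    thus ?thesis using True by (simp add: L_def)
  qed
qed

section \<open>Klein forms and the eta function\<close>

definition klein :: "real \<Rightarrow> real \<Rightarrow> complex \<Rightarrow> complex" where
  "klein a b t = ee (of_real a * (of_real a * t + of_real b) / 2) * theta0 (of_real a * t + of_real b) t"

text \<open>With (a, b) times the matrix as coordinates of z, the point a t' + b is z / j. The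
  change of the quadratic prefactor, equation \<open>e\<close>, absorbs the Gaussian factor of
  \<open>theta0_modular\<close>, and only the weight -1 is left.\<close>

theorem klein_modular:
  fixes A B C D :: int
  assumes t: "Im t > 0" and det: "A * D - B * C = 1"
  shows "klein a b ((of_int A * t + of_int B) / (of_int C * t + of_int D)) =
    klein (a * of_int A + b * of_int C) (a * of_int B + b * of_int D) t / (of_int C * t + of_int D)"
proof -
  define j where "j = of_int C * t + of_int D"
  define z where "z = of_real (a * of_int A + b * of_int C) * t + of_real (a * of_int B + b * of_int D)"
  define t' where "t' = (of_int A * t + of_int B) / j"
  have j0: "j \<noteq> 0"
    using moebius_aux[OF t det] by (simp add: j_def)
  have detc: "of_int A * of_int D - of_int B * of_int C = (1 :: complex)"
    using det by (metis of_int_1 of_int_diff of_int_mult)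
  have z': "of_real a * t' + of_real b = z / j"
    using j0 by (simp add: t'_def z_def divide_simps) (simp add: j_def algebra_simps)
  have e: "of_real a * (z / j) / 2 = of_real (a * of_int A + b * of_int C) * z / 2 + - (of_int C * z ^ 2 / (2 * j))"
  proof -
    have "of_real a + of_int C * z - of_real (a * of_int A + b * of_int C) * j =
      of_real a * (1 - (of_int A * of_int D - of_int B * of_int C))"
      unfolding z_def j_def by (simp add: algebra_simps)
    hence "of_real a + of_int C * z = of_real (a * of_int A + b * of_int C) * j"
      using detc by simp
    hence "of_real a = of_real (a * of_int A + b * of_int C) * j - of_int C * z"
      by (simp add: algebra_simps)
    hence "of_real a * z = of_real (a * of_int A + b * of_int C) * z * j - of_int C * z ^ 2"
      by (simp only: ring_distribs power2_eq_square mult_ac left_diff_distrib)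
    thus ?thesis using j0 by (simp add: divide_simps)
  qed
  have "klein a b t' = ee (of_real (a * of_int A + b * of_int C) * z / 2) * (theta0 (z / j) t' * ee (- (of_int C * z ^ 2 / (2 * j))))"
    unfolding klein_def z' e ee_add by simp
  also have "theta0 (z / j) t' * ee (- (of_int C * z ^ 2 / (2 * j))) = theta0 z t / j"
    using theta0_modular[OF t det, of z] by (simp add: j_def t'_def)
  finally show ?thesis
    by (simp add: klein_def z_def t'_def j_def)
qed

text \<open>The symplectic pairing a n - b m of index and shift is the source of all roots of unity
  that the later products have to cancel.\<close>

lemma klein_shift:
  assumes "Im t > 0"
  shows "klein (a + of_int m) (b + of_int n) t =
    (-1) powi (m + n) * ee ((of_real a * of_int n - of_real b * of_int m + of_int (m * n)) / 2) * klein a b t"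
proof -
  define z where "z = of_real a * t + of_real b"
  have z': "of_real (a + of_int m) * t + of_real (b + of_int n) = z + (of_int m * t + of_int n)"
    by (simp add: z_def algebra_simps)
  have "klein (a + of_int m) (b + of_int n) t = (-1) powi (m + n) *
    (ee (of_real (a + of_int m) * (z + (of_int m * t + of_int n)) / 2) * ee (- (of_int m ^ 2 * t / 2) - of_int m * z)) * theta0 z t"
    unfolding klein_def z' theta0_add_lattice[OF assms] by (simp only: mult_ac)
  also have "ee (of_real (a + of_int m) * (z + (of_int m * t + of_int n)) / 2) * ee (- (of_int m ^ 2 * t / 2) - of_int m * z) =
    ee ((of_real a * of_int n - of_real b * of_int m + of_int (m * n)) / 2) * ee (of_real a * z / 2)"
    unfolding ee_add [symmetric]
    by (rule arg_cong[where f = ee]) (simp add: z_def field_simps power2_eq_square)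
  finally show ?thesis
    by (simp add: klein_def z_def)
qed

section \<open>The eta function and its transformation laws\<close>

definition eta :: "complex \<Rightarrow> complex" where
  "eta t = ee (t / 24) * qp (ee t) (ee t)"

lemma eta_nonzero: "Im t > 0 \<Longrightarrow> eta t \<noteq> 0"
  by (simp add: eta_def qp_self_nonzero norm_ee_less_1)

lemma eta_holomorphic:
  assumes "open S" "f holomorphic_on S" "\<And>x. x \<in> S \<Longrightarrow> Im (f x) > 0"
  shows "(\<lambda>x. eta (f x)) holomorphic_on S"
  unfolding eta_def
  by (intro holomorphic_intros qp_holomorphic assms) (auto simp: norm_ee_less_1 assms)

lemma eta_add_24: "eta (t + 24 * of_int n) = eta t"
proof -
  have 1: "(t + 24 * of_int n) / 24 = t / 24 + of_int n" and 2: "ee (t + 24 * of_int n) = ee t"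
    using ee_add_of_int[of t "24 * n"] by (simp_all add: add_divide_distrib)
  show ?thesis unfolding eta_def 1 2 by simp
qed

lemma qp_even_odd:
  assumes "norm q < 1"
  shows "qp q q = qp q (q ^ 2) * qp (q ^ 2) (q ^ 2)"
proof (rule LIMSEQ_unique)
  have q2: "norm (q ^ 2) < 1"
    using assms by (simp add: norm_power power_less_one_iff)
  have "(\<lambda>n. \<Prod>i<2 * n. 1 - q * q ^ i) \<longlonglongrightarrow> qp q q"
    using LIMSEQ_subseq_LIMSEQ[OF qp_LIMSEQ[OF assms, of q], of "\<lambda>n. 2 * n"]
    by (simp add: strict_mono_def o_def)
  moreover have "(\<Prod>i<2 * n. 1 - q * q ^ i) = (\<Prod>i<n. 1 - q * (q ^ 2) ^ i) * (\<Prod>i<n. 1 - q ^ 2 * (q ^ 2) ^ i)" for n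
  proof (induction n)
    case (Suc n)
    have "q * q ^ (2 * n) = q * (q ^ 2) ^ n" "q * q ^ Suc (2 * n) = q ^ 2 * (q ^ 2) ^ n"
      by (simp_all add: power_mult power2_eq_square)
    thus ?case using Suc.IH by simp
  qed simp
  ultimately show "(\<lambda>n. (\<Prod>i<n. 1 - q * (q ^ 2) ^ i) * (\<Prod>i<n. 1 - q ^ 2 * (q ^ 2) ^ i)) \<longlonglongrightarrow> qp q q"
    by simp
  show "(\<lambda>n. (\<Prod>i<n. 1 - q * (q ^ 2) ^ i) * (\<Prod>i<n. 1 - q ^ 2 * (q ^ 2) ^ i)) \<longlonglongrightarrow> qp q (q ^ 2) * qp (q ^ 2) (q ^ 2)"
    by (intro tendsto_mult qp_LIMSEQ q2)
qed

lemma qp_pm: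
  assumes "norm q < 1"
  shows "qp w q * qp (- w) q = qp (w ^ 2) (q ^ 2)"
proof -
  have q2: "norm (q ^ 2) < 1"
    using assms by (simp add: norm_power power_less_one_iff)
  have "(\<Prod>i\<in>{1, -1}. qp (i * w) q) = qp (w ^ 2) (q ^ 2)"
    by (rule qp_prod) (use assms q2 in \<open>auto simp: algebra_simps power2_eq_square power_mult_distrib\<close>)
  thus ?thesis by simp
qed

text \<open>At a half period \<open>ee (- z) * ee t = ee z\<close>, so the two Pochhammer symbols
  agree up to the factor 1 - \<open>ee z\<close>, which the prefactor supplies.\<close>

lemma theta0_half_period:
  assumes t: "Im t > 0" and z: "2 * z = t + of_int n"
  shows "theta0 z t = - ee (- z / 2) * qp (ee z) (ee t) ^ 2 / qp (ee t) (ee t) ^ 2"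
proof -
  have q: "norm (ee t) < 1" by (rule norm_ee_less_1[OF t])
  have zz: "ee t = ee z * ee z"
    using arg_cong[OF z, of ee] ee_add[of z z] by simp
  have 1: "ee (- z) * ee t = ee z"
    by (simp add: zz ee_minus)
  have w: "ee z = ee (z / 2) * ee (z / 2)" "ee (- z / 2) = inverse (ee (z / 2))"
    using ee_minus[of "z / 2"] by (simp_all flip: ee_add)
  have 2: "ee (z / 2) - ee (- z / 2) = - ee (- z / 2) * (1 - ee z)"
    unfolding w by (simp add: field_simps)
  have 3: "qp (ee z) (ee t) = (1 - ee z) * qp (ee z * ee t) (ee t)"
    by (rule qp_shift[OF q])
  have "theta0 z t = - ee (- z / 2) * ((1 - ee z) * qp (ee z * ee t) (ee t)) * qp (ee z) (ee t) / qp (ee t) (ee t) ^ 2"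
    unfolding theta0_def 1 2 by (simp only: mult.assoc)
  thus ?thesis
    by (simp only: 3 [symmetric] power2_eq_square mult.assoc)
qed

text \<open>Up to exponentials the three values are squares of the Weber products for -q, u and -u,
  where u^2 = q, each divided by E^2. Separating even and odd exponents in Euler's product gives X =
  1, so E^(-6) remains.\<close>

lemma klein_half_prod:
  assumes t: "Im t > 0"
  shows "(klein 0 (1/2) t * klein (1/2) 0 t * klein (1/2) (1/2) t) ^ 4 = - 16 / eta t ^ 24"
proof -
  define q where "q = ee t"
  define u where "u = ee (t / 2)"
  have q: "norm q < 1" "q \<noteq> 0" by (simp_all add: q_def norm_ee_less_1 t)
  have q2: "norm (q ^ 2) < 1" "q ^ 2 \<noteq> 0"
    using q by (simp_all add: norm_power power_less_one_iff)
  have qu: "q = u ^ 2" using ee_power[of "t/2" 2] by (simp add: q_def u_def)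
  define E where "E = qp q q"
  have E0: "E \<noteq> 0" unfolding E_def by (rule qp_self_nonzero) (use q in auto)
  define X where "X = qp u q * qp (- u) q * qp (- q) q"
  have X: "X = 1"
  proof -
    have "E * X = qp (u ^ 2) (q ^ 2) * qp (q ^ 2) (q ^ 2)"
      using qp_pm[OF q(1), of u] qp_pm[OF q(1), of q] by (simp add: X_def E_def mult_ac)
    also have "\<dots> = E"
      unfolding E_def using qp_even_odd[OF q(1)] qu by simp
    finally show ?thesis using E0 by simp
  qed
  have k1: "klein 0 (1/2) t = 2 * \<i> * qp (- q) q ^ 2 / E ^ 2"
  proof -
    have "ee (1 / 4) = \<i>"
      unfolding ee_def by (simp add: exp_eq_polar cis_conv_exp [symmetric] flip: cis_pi_half)
    hence "ee (1/2/2) - ee (-(1/2)/2) = 2 * \<i>"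
      using ee_minus[of "1/4"] by simp
    moreover have "ee (- (1/2)) = -1" by (subst ee_minus) simp
    ultimately show ?thesis
      unfolding klein_def theta0_def by (simp add: E_def power2_eq_square flip: q_def)
  qed
  have k2: "klein (1/2) 0 t = - (ee (- t / 8) * qp u q ^ 2 / E ^ 2)"
  proof -
    have "theta0 (t / 2) t = - ee (- (t / 2) / 2) * qp u q ^ 2 / E ^ 2"
      using theta0_half_period[OF t, of "t / 2" 0] by (simp add: u_def q_def E_def)
    moreover have "ee (t / 8) * ee (- (t / 2) / 2) = ee (- t / 8)"
      unfolding ee_add [symmetric] by (rule arg_cong[where f = ee]) simp
    ultimately show ?thesis
      by (simp add: klein_def mult.assoc [symmetric])
  qed
  have k3: "klein (1/2) (1/2) t = - (ee (- (t + 1) / 8) * qp (- u) q ^ 2 / E ^ 2)"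
  proof -
    have u': "ee ((t + 1) / 2) = - u"
      using ee_add[of "t/2" "1/2"] by (simp add: u_def add_divide_distrib)
    have "theta0 ((t + 1) / 2) t = - ee (- ((t + 1) / 2) / 2) * qp (- u) q ^ 2 / E ^ 2"
      using theta0_half_period[OF t, of "(t + 1) / 2" 1] by (simp add: u' q_def E_def del: minus_add_distrib)
    moreover have "ee ((t + 1) / 8) * ee (- ((t + 1) / 2) / 2) = ee (- (t + 1) / 8)"
      unfolding ee_add [symmetric] by (rule arg_cong[where f = ee]) (simp add: field_simps)
    moreover have "of_real (1/2) * t + of_real (1/2) = (t + 1) / 2"
      by (simp add: add_divide_distrib)
    moreover have "of_real (1/2) * ((t + 1) / 2) / 2 = (t + 1) / 8"
      by simp
    ultimately show ?thesis
      unfolding klein_def by (simp only: mult.assoc [symmetric] mult_minus_right times_divide_eq_right minus_mult_left [symmetric] minus_divide_left [symmetric])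
  qed
  have "klein 0 (1/2) t * klein (1/2) 0 t * klein (1/2) (1/2) t =
    2 * \<i> * (ee (- t / 8) * ee (- (t + 1) / 8)) * X ^ 2 / E ^ 6"
  proof -
    have "c * z ^ 2 / E ^ 2 * - (a * x ^ 2 / E ^ 2) * - (b * y ^ 2 / E ^ 2) = c * (a * b) * (x * y * z) ^ 2 / E ^ 6"
      for a b c x y z :: complex
      using E0 by (simp add: divide_simps power_mult_distrib)
    thus ?thesis unfolding k1 k2 k3 X_def .
  qed
  hence "(klein 0 (1/2) t * klein (1/2) 0 t * klein (1/2) (1/2) t) ^ 4 =
    (2 * \<i>) ^ 4 * (ee (- t / 8) * ee (- (t + 1) / 8)) ^ 4 / E ^ 24"
    by (simp add: X power_mult_distrib power_divide flip: power_mult)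
  also have "(2 * \<i>) ^ 4 = (16 :: complex)"
    by (simp add: power_mult_distrib power4_eq_xxxx)
  also have "(ee (- t / 8) * ee (- (t + 1) / 8)) ^ 4 = ee (- t + - (1 / 2))"
    unfolding ee_add [symmetric] ee_power by (rule arg_cong[where f = ee]) (simp add: field_simps)
  also have "\<dots> = - 1 / ee t"
    using ee_minus[of "1/2"] ee_minus[of t] by (simp only: ee_add) (simp add: field_simps)
  also have "16 * (- 1 / ee t) / E ^ 24 = - 16 / eta t ^ 24"
    using ee_power[of "t / 24" 24] by (simp add: eta_def E_def q_def power_mult_distrib)
  finally show ?thesis .
qed

text \<open>At half-integral indices the factor in \<open>klein_shift\<close> is a fourth root of
  unity, so the fourth power depends on m and n modulo 2 only.\<close>

definition klein2 :: "int \<Rightarrow> int \<Rightarrow> complex \<Rightarrow> complex" where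
  "klein2 m n t = klein (of_int m / 2) (of_int n / 2) t ^ 4"

lemma klein2_shift:
  assumes t: "Im t > 0"
  shows "klein2 (m + 2 * a) (n + 2 * b) t = klein2 m n t"
proof -
  have "klein (of_int m / 2 + of_int a) (of_int n / 2 + of_int b) t ^ 4 = klein (of_int m / 2) (of_int n / 2) t ^ 4 *
     (((-1) powi (a + b)) ^ 4 * ee ((of_real (of_int m / 2) * of_int b - of_real (of_int n / 2) * of_int a + of_int (a * b)) / 2) ^ 4)"
    by (simp only: klein_shift[OF t] power_mult_distrib mult_ac)
  also have "ee ((of_real (of_int m / 2) * of_int b - of_real (of_int n / 2) * of_int a + of_int (a * b)) / 2) ^ 4 = ee (of_int (m * b - n * a + 2 * a * b))"
    unfolding ee_power by (rule arg_cong[where f = ee]) (simp add: field_simps)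
  also have "((-1) powi (a + b)) ^ 4 = (1 :: complex)"
    by (cases "even (a + b)") simp_all
  finally show ?thesis by (simp only: ee_of_int) (simp add: klein2_def add_divide_distrib)
qed

lemma klein2_mod: "Im t > 0 \<Longrightarrow> klein2 m n t = klein2 (m mod 2) (n mod 2) t"
  using klein2_shift[of t "m mod 2" "m div 2" "n mod 2" "n div 2"] by simp

text \<open>The three nontrivial 2-torsion points are permuted by the modular group, and by \<open>klein_half_prod\<close> the product of
  their Klein forms is a constant multiple of a power of \<open>eta\<close>.\<close>

theorem eta24_modular:
  fixes A B C D :: int
  assumes t: "Im t > 0" and det: "A * D - B * C = 1"
  shows "eta ((of_int A * t + of_int B) / (of_int C * t + of_int D)) ^ 24 = (of_int C * t + of_int D) ^ 12 * eta t ^ 24"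
proof -
  define j where "j = of_int C * t + of_int D"
  define t' where "t' = (of_int A * t + of_int B) / j"
  have j0: "j \<noteq> 0" and t': "Im t' > 0"
    using moebius_aux[OF t det] by (simp_all add: j_def t'_def)
  have K: "klein2 0 1 t * klein2 1 0 t * klein2 1 1 t = - 16 / eta t ^ 24" if "Im t > 0" for t
    using klein_half_prod[OF that] by (simp add: klein2_def power_mult_distrib)
  have mod: "klein2 m n t' = klein2 ((m * A + n * C) mod 2) ((m * B + n * D) mod 2) t / j ^ 4" for m n
  proof -
    have "klein (of_int m / 2) (of_int n / 2) t' = klein (of_int (m * A + n * C) / 2) (of_int (m * B + n * D) / 2) t / j"
      using klein_modular[OF t det, of "of_int m / 2" "of_int n / 2"] by (simp add: t'_def j_def add_divide_distrib)
    thus ?thesis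
      using klein2_mod[OF t, of "m * A + n * C" "m * B + n * D"] by (simp add: klein2_def power_divide)
  qed
  have par: "odd (A * D - B * C)" using det by simp
  have m2: "x mod 2 = (if even x then 0 else 1)" for x :: int by presburger
  have "klein2 0 1 t' * klein2 1 0 t' * klein2 1 1 t' = klein2 0 1 t * klein2 1 0 t * klein2 1 1 t / j ^ 12"
    unfolding mod m2 using par by (cases "even A"; cases "even B"; cases "even C"; cases "even D") (auto simp: mult_ac)
  hence "- 16 / eta t' ^ 24 = - 16 / eta t ^ 24 / j ^ 12"
    unfolding K[OF t] K[OF t'] .
  hence "eta t' ^ 24 = j ^ 12 * eta t ^ 24"
    using eta_nonzero[OF t] eta_nonzero[OF t'] j0 by (simp add: field_simps)
  thus ?thesis by (simp add: t'_def j_def)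
qed

text \<open>The quotient of the two sides is a 24th root of unity depending continuously on \<open>t\<close>, and it is 1 at \<open>\<i>\<close>.\<close>

theorem eta_minus_inverse:
  assumes t: "Im t > 0"
  shows "eta (- 1 / t) = csqrt (- \<i> * t) * eta t"
proof -
  define S where "S = {z. Im z > 0}"
  have inv: "Im (- 1 / z) > 0" if "z \<in> S" for z
    using moebius_aux(2)[of z 0 0 "-1" 1] that by (simp add: S_def)
  define g where "g z = eta (- 1 / z) / (csqrt (- \<i> * z) * eta z)" for z
  have g24: "g z ^ 24 = 1" if "z \<in> S" for z
  proof -
    have "eta (- 1 / z) ^ 24 = z ^ 12 * eta z ^ 24"
      using eta24_modular[of z 0 0 "-1" 1] that by (simp add: S_def)
    moreover have "csqrt (- \<i> * z) ^ 24 = (csqrt (- \<i> * z) ^ 2) ^ 12"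
      by (simp only: power_mult [symmetric]) simp
    moreover have "\<dots> = z ^ 12"
    proof -
      have "(- \<i>) ^ 12 = ((- \<i>) ^ 2) ^ 6"
        by (simp only: power_mult [symmetric]) simp
      thus ?thesis by (simp only: power2_csqrt) (simp add: power_mult_distrib)
    qed
    moreover have "z \<noteq> 0" using that by (auto simp: S_def)
    ultimately show ?thesis
      using eta_nonzero[of z] that by (simp add: g_def S_def power_divide power_mult_distrib)
  qed
  have op: "open S" unfolding S_def by (rule open_halfspace_Im_gt)
  have conn: "connected S"
    unfolding S_def by (intro convex_connected convex_halfspace_Im_gt)
  have "continuous_on S g"
  proof -
    have 1: "(\<lambda>z. eta (- 1 / z)) holomorphic_on S"
      by (intro eta_holomorphic op holomorphic_intros) (use inv in \<open>auto simp: S_def\<close>)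
    have 2: "(\<lambda>z. eta z) holomorphic_on S"
      by (rule eta_holomorphic[OF op holomorphic_on_ident]) (simp add: S_def)
    note c = 1[THEN holomorphic_on_imp_continuous_on] 2[THEN holomorphic_on_imp_continuous_on]
    \<comment> \<open>Re (- \<i> z) = Im z > 0, so the argument avoids the branch cut.\<close>
    have "continuous_on S (\<lambda>z. csqrt (- \<i> * z))"
    proof (rule continuous_on_compose2[of "(\<lambda>z. - \<i> * z) ` S" csqrt])
      show "continuous_on ((\<lambda>z. - \<i> * z) ` S) csqrt"
        by (rule continuous_on_subset[OF continuous_on_csqrt]) (auto simp: S_def complex_nonpos_Reals_iff)
    qed (auto intro!: continuous_intros)
    thus ?thesis unfolding g_def
      by (intro continuous_intros c) (auto simp: S_def eta_nonzero)
  qed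
  moreover have "finite (g ` S)"
  proof (rule finite_subset)
    show "g ` S \<subseteq> {w. w ^ 24 = 1}" using g24 by auto
    show "finite {w :: complex. w ^ 24 = 1}" by (rule finite_roots_unity) simp
  qed
  ultimately have "g constant_on S"
    by (intro continuous_finite_range_constant conn)
  then obtain c where c: "\<And>z. z \<in> S \<Longrightarrow> g z = c"
    by (auto simp: constant_on_def)
  have "\<i> \<in> S" by (simp add: S_def)
  hence "c = g \<i>" using c by simp
  also have "\<dots> = 1"
    using eta_nonzero[of \<i>] by (simp add: g_def)
  finally have "g t = 1" using c t by (simp add: S_def)
  thus ?thesis
    by (auto simp: g_def divide_eq_1_iff)
qed

section \<open>Quadratic Gauss sums\<close>

text \<open>n pairwise incongruent integers already form a complete residue system, so every later
  change of representatives reduces to an injectivity check.\<close>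

lemma bij_betw_residues:
  fixes g :: "'b \<Rightarrow> int"
  assumes "n > 0" "finite I" "card I = n"
    and inj: "\<And>i j. i \<in> I \<Longrightarrow> j \<in> I \<Longrightarrow> [g i = g j] (mod int n) \<Longrightarrow> i = j"
  shows "bij_betw (\<lambda>i. g i mod int n) I {0..<int n}"
proof -
  have inj': "inj_on (\<lambda>i. g i mod int n) I"
    using inj by (auto simp: inj_on_def cong_def)
  moreover have "(\<lambda>i. g i mod int n) ` I = {0..<int n}"
  proof (rule card_subset_eq)
    show "card ((\<lambda>i. g i mod int n) ` I) = card {0..<int n}"
      using assms(3) by (simp add: card_image[OF inj'])
  qed (use assms(1) in auto)
  ultimately show ?thesis by (simp add: bij_betw_def)
qed

lemma prod_residues:
  fixes f :: "int \<Rightarrow> 'a :: comm_monoid_mult"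
  assumes "n > 0" "finite I" "card I = n"
    and "\<And>i j. i \<in> I \<Longrightarrow> j \<in> I \<Longrightarrow> [g i = g j] (mod int n) \<Longrightarrow> i = j"
    and "\<And>k. f (k mod int n) = f k"
  shows "(\<Prod>i\<in>I. f (g i)) = (\<Prod>k\<in>{0..<int n}. f k)"
  using prod.reindex_bij_betw[OF bij_betw_residues[OF assms(1-4)], where g = f] by (simp add: assms(5))

lemma sum_residues:
  fixes f :: "int \<Rightarrow> 'a :: comm_monoid_add"
  assumes "n > 0" "finite I" "card I = n"
    and "\<And>i j. i \<in> I \<Longrightarrow> j \<in> I \<Longrightarrow> [g i = g j] (mod int n) \<Longrightarrow> i = j"
    and "\<And>k. f (k mod int n) = f k"
  shows "(\<Sum>i\<in>I. f (g i)) = (\<Sum>k\<in>{0..<int n}. f k)"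
  using sum.reindex_bij_betw[OF bij_betw_residues[OF assms(1-4)], where g = f] by (simp add: assms(5))

lemma symmetric_interval: "{- int h..int h} = insert 0 ({1..int h} \<union> uminus ` {1..int h})"
proof -
  have "x \<in> uminus ` {1..int h} \<longleftrightarrow> - x \<in> {1..int h}" for x
    by (metis (no_types, opaque_lifting) image_iff minus_minus)
  thus ?thesis by auto
qed

lemma prod_symmetric:
  fixes f :: "int \<Rightarrow> 'a :: comm_monoid_mult"
  shows "(\<Prod>v\<in>{- int h..int h}. f v) = f 0 * (\<Prod>v\<in>{1..int h}. f v * f (- v))"
proof -
  have "(\<Prod>v\<in>{1..int h} \<union> uminus ` {1..int h}. f v) = (\<Prod>v\<in>{1..int h}. f v) * (\<Prod>v\<in>uminus ` {1..int h}. f v)"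
    by (rule prod.union_disjoint) auto
  also have "(\<Prod>v\<in>uminus ` {1..int h}. f v) = (\<Prod>v\<in>{1..int h}. f (- v))"
    by (subst prod.reindex) (auto simp: o_def)
  finally show ?thesis
    unfolding symmetric_interval by (subst prod.insert) (auto simp: prod.distrib)
qed

lemma sum_symmetric:
  fixes f :: "int \<Rightarrow> 'a :: comm_monoid_add"
  shows "(\<Sum>v\<in>{- int h..int h}. f v) = f 0 + (\<Sum>v\<in>{1..int h}. f v + f (- v))"
proof -
  have "(\<Sum>v\<in>{1..int h} \<union> uminus ` {1..int h}. f v) = (\<Sum>v\<in>{1..int h}. f v) + (\<Sum>v\<in>uminus ` {1..int h}. f v)"
    by (rule sum.union_disjoint) auto
  also have "(\<Sum>v\<in>uminus ` {1..int h}. f v) = (\<Sum>v\<in>{1..int h}. f (- v))"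
    by (subst sum.reindex) (auto simp: o_def)
  finally show ?thesis
    unfolding symmetric_interval by (subst sum.insert) (auto simp: sum.distrib)
qed

section \<open>Roots of unity and their products\<close>

definition zeta :: "nat \<Rightarrow> int \<Rightarrow> complex" where
  "zeta l k = ee (of_int k / of_nat l)"

lemma zeta_add: "zeta l (a + b) = zeta l a * zeta l b"
  by (simp add: zeta_def add_divide_distrib ee_add)

lemma zeta_0 [simp]: "zeta l 0 = 1"
  by (simp add: zeta_def)

lemma zeta_minus: "zeta l (- a) = inverse (zeta l a)"
  by (simp add: zeta_def ee_minus)

lemma zeta_nonzero [simp]: "zeta l a \<noteq> 0"
  by (simp add: zeta_def)

lemma zeta_power: "zeta l a ^ n = zeta l (int n * a)"
  by (simp add: zeta_def ee_power)

lemma zeta_sum: "zeta l (\<Sum>i\<in>A. f i) = (\<Prod>i\<in>A. zeta l (f i))"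
  by (induction A rule: infinite_finite_induct) (auto simp: zeta_add)

lemma zeta_eq_1_iff: "l > 0 \<Longrightarrow> zeta l k = 1 \<longleftrightarrow> int l dvd k"
proof
  assume l: "l > 0" and "zeta l k = 1"
  then obtain n :: int where "of_int k / of_nat l = (of_int n :: complex)"
    unfolding zeta_def ee_eq_1_iff by (auto elim: Ints_cases)
  hence "of_int k = (of_int (n * int l) :: complex)"
    using l by (simp add: field_simps)
  hence "k = n * int l" by (simp only: of_int_eq_iff)
  thus "int l dvd k" by simp
next
  assume "l > 0" "int l dvd k"
  thus "zeta l k = 1" by (auto simp: zeta_def elim!: dvdE)
qed

lemma zeta_cong: "l > 0 \<Longrightarrow> [a = b] (mod int l) \<Longrightarrow> zeta l a = zeta l b"
proof -
  assume "l > 0" "[a = b] (mod int l)"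
  hence "zeta l (a - b) = 1"
    by (simp add: zeta_eq_1_iff cong_iff_dvd_diff)
  thus ?thesis using zeta_add[of l "a - b" b] by simp
qed

lemma zeta_eq_iff: "l > 0 \<Longrightarrow> zeta l a = zeta l b \<longleftrightarrow> [a = b] (mod int l)"
proof
  assume l: "l > 0" and "zeta l a = zeta l b"
  hence "zeta l (a - b) = 1" using zeta_add[of l "a - b" b] by simp
  thus "[a = b] (mod int l)" using l by (simp add: zeta_eq_1_iff cong_iff_dvd_diff)
qed (auto intro: zeta_cong)

lemma zeta_mod [simp]: "l > 0 \<Longrightarrow> zeta l (a mod int l) = zeta l a"
  by (rule zeta_cong) auto

text \<open>As polynomials in X both sides have degree at most l and agree at l + 1 points: at 0 and
  at the l-th roots of unity.\<close>

lemma prod_one_minus_zeta: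
  assumes l: "l > 0"
  shows "(\<Prod>k\<in>{0..<int l}. 1 - zeta l k * X) = 1 - X ^ l"
proof -
  define p where "p = (\<Prod>k\<in>{0..<int l}. [:1, - zeta l k:])"
  define q where "q = 1 - Polynomial.monom (1::complex) l"
  have "p = q"
  proof (rule poly_eqI_degree[where A = "insert 0 (zeta l ` {0..<int l})"])
    have inj: "inj_on (zeta l) {0..<int l}"
      using l by (auto simp: inj_on_def zeta_eq_iff cong_def)
    have card: "card (insert 0 (zeta l ` {0..<int l})) = l + 1"
      by (subst card_insert_disjoint) (auto simp: card_image[OF inj])
    have "degree p \<le> (\<Sum>k\<in>{0..<int l}. degree [:1, - zeta l k:])"
      unfolding p_def using degree_prod_sum_le by (metis finite_atLeastLessThan_int o_apply sum.cong)
    also have "\<dots> \<le> (\<Sum>k\<in>{0..<int l}. 1)"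
      by (intro sum_mono) simp
    finally show "degree p < card (insert 0 (zeta l ` {0..<int l}))"
      by (simp add: card)
    have "degree q \<le> l" unfolding q_def by (intro degree_diff_le) (auto simp: degree_monom_eq)
    thus "degree q < card (insert 0 (zeta l ` {0..<int l}))"
      by (simp add: card)
    fix x assume "x \<in> insert 0 (zeta l ` {0..<int l})"
    then consider "x = 0" | k where "k \<in> {0..<int l}" "x = zeta l k" by auto
    thus "poly p x = poly q x"
    proof cases
      case 1
      thus ?thesis using l by (simp add: p_def q_def poly_prod poly_monom)
    next
      case 2
      have "[:1, - zeta l ((- k) mod int l):] dvd p"
        unfolding p_def using l by (intro dvd_prodI) auto
      moreover have "poly [:1, - zeta l ((- k) mod int l):] x = 0"
        using l 2 by (simp add: zeta_minus)
      ultimately have "poly p x = 0" by (meson poly_eq_0_iff_dvd dvd_trans)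
      moreover have "zeta l k ^ l = 1" using l by (simp add: zeta_power zeta_eq_1_iff)
      ultimately show ?thesis using 2 by (simp add: q_def poly_monom)
    qed
  qed
  hence "poly p X = poly q X" by simp
  thus ?thesis by (simp add: p_def q_def poly_prod poly_monom mult.commute)
qed

text \<open>Cancel 1 - X in \<open>prod_one_minus_zeta\<close> and let X tend to 1.\<close>

lemma prod_one_minus_zeta':
  assumes l: "l > 0"
  shows "(\<Prod>k\<in>{1..<int l}. 1 - zeta l k) = of_nat l"
proof -
  have "(\<lambda>X. \<Prod>k\<in>{1..<int l}. 1 - zeta l k * X) \<midarrow>1\<rightarrow> (\<Prod>k\<in>{1..<int l}. 1 - zeta l k * 1)"
    by (intro tendsto_intros)
  moreover have "(\<lambda>X. \<Prod>k\<in>{1..<int l}. 1 - zeta l k * X) \<midarrow>1\<rightarrow> of_nat l"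
  proof (rule Lim_transform_eventually)
    have "(\<lambda>X :: complex. \<Sum>i<l. X ^ i) \<midarrow>1\<rightarrow> (\<Sum>i<l. 1 ^ i)"
      by (intro tendsto_intros)
    thus "(\<lambda>X :: complex. \<Sum>i<l. X ^ i) \<midarrow>1\<rightarrow> of_nat l" by simp
    have "{0..<int l} = insert 0 {1..<int l}" using l by auto
    hence "(1 - X) * (\<Prod>k\<in>{1..<int l}. 1 - zeta l k * X) = 1 - X ^ l" for X
      using prod_one_minus_zeta[OF l, of X] by simp
    moreover have "1 - X ^ l = (1 - X) * (\<Sum>i<l. X ^ i)" for X :: complex
      by (simp add: one_diff_power_eq)
    ultimately have prev: "(1 - X) * (\<Prod>k\<in>{1..<int l}. 1 - zeta l k * X) = (1 - X) * (\<Sum>i<l. X ^ i)" for X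
      by simp
    hence "(\<Prod>k\<in>{1..<int l}. 1 - zeta l k * X) = (\<Sum>i<l. X ^ i)" if "X \<noteq> 1" for X
      using prev[of X] that by simp
    thus "\<forall>\<^sub>F X in at 1. (\<Sum>i<l. X ^ i) = (\<Prod>k\<in>{1..<int l}. 1 - zeta l k * X)"
      unfolding eventually_at_filter by (intro always_eventually allI impI) (rule sym)
  qed
  ultimately have "(\<Prod>k\<in>{1..<int l}. 1 - zeta l k * 1) = of_nat l"
    by (rule LIM_unique)
  thus ?thesis by simp
qed

section \<open>Legendre symbols\<close>

lemma Legendre_cong:
  assumes "[a = b] (mod m)"
  shows "Legendre a m = Legendre b m"
proof -
  have "[a = 0] (mod m) \<longleftrightarrow> [b = 0] (mod m)"
    using assms by (meson cong_sym cong_trans)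
  moreover have "QuadRes m a \<longleftrightarrow> QuadRes m b"
    unfolding QuadRes_def using assms by (meson cong_sym cong_trans)
  ultimately show ?thesis by (simp add: Legendre_def)
qed

lemma Legendre_values: "Legendre a m \<in> {-1, 0, 1}"
  by (simp add: Legendre_def)

lemma Legendre_eq_0_iff: "Legendre a m = 0 \<longleftrightarrow> m dvd a"
  by (simp add: Legendre_def cong_0_iff)

text \<open>Euler's criterion determines a symbol only modulo l; its three possible values are
  incongruent because l > 2.\<close>

lemma cong_values_eq:
  assumes "[a = b] (mod int l)" "l > 2" "a \<in> {-1, 0, 1}" "b \<in> {-1, 0, 1}"
  shows "a = b"
proof -
  have "int l dvd a - b" using assms(1) by (simp add: cong_iff_dvd_diff)
  moreover have "\<bar>a - b\<bar> < int l" using assms by auto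
  ultimately show ?thesis using zdvd_not_zless[of "\<bar>a - b\<bar>" "int l"] by (cases "a = b") auto
qed

lemma Legendre_mult:
  assumes "prime l" "l > 2"
  shows "Legendre (a * b) (int l) = Legendre a (int l) * Legendre b (int l)"
proof (rule cong_values_eq[OF _ assms(2)])
  have "[Legendre (a * b) (int l) = a ^ ((l - 1) div 2) * b ^ ((l - 1) div 2)] (mod int l)"
    using euler_criterion[OF assms, of "a * b"] by (simp add: power_mult_distrib)
  moreover have "[Legendre a (int l) * Legendre b (int l) = a ^ ((l - 1) div 2) * b ^ ((l - 1) div 2)] (mod int l)"
    by (intro cong_mult euler_criterion assms)
  ultimately show "[Legendre (a * b) (int l) = Legendre a (int l) * Legendre b (int l)] (mod int l)"
    by (meson cong_sym cong_trans)
qed (use Legendre_values[of a "int l"] Legendre_values[of b "int l"] Legendre_values[of "a * b" "int l"] in auto)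

lemma Legendre_1: "l > 1 \<Longrightarrow> Legendre 1 (int l) = 1"
proof -
  assume "l > 1"
  hence "\<not> int l dvd 1" by simp
  moreover have "QuadRes (int l) 1" unfolding QuadRes_def by (rule exI[of _ 1]) simp
  ultimately show ?thesis by (simp add: Legendre_def cong_0_iff)
qed

lemma Legendre_square:
  assumes "prime l" "l > 2" "\<not> int l dvd a"
  shows "Legendre a (int l) * Legendre a (int l) = 1"
  using Legendre_values[of a "int l"] Legendre_eq_0_iff[of a "int l"] assms by auto

text \<open>A Gaussian binomial coefficient at an arbitrary base \<open>q\<close>, roots of unity included.\<close>

fun qbinom :: "complex \<Rightarrow> nat \<Rightarrow> nat \<Rightarrow> complex" where
  "qbinom q n 0 = 1"
| "qbinom q 0 (Suc k) = 0"
| "qbinom q (Suc n) (Suc k) = qbinom q n k + q ^ Suc k * qbinom q n (Suc k)"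

lemma qbinom_eq_0: "k > n \<Longrightarrow> qbinom q n k = 0"
proof (induction n arbitrary: k)
  case 0
  thus ?case by (cases k) auto
next
  case (Suc n)
  thus ?case by (cases k) auto
qed

text \<open>Stated without division, since 1 - q^(k+1) can vanish at a root of unity.\<close>

lemma qbinom_step: "(1 - q ^ Suc k) * qbinom q n (Suc k) = (1 - q ^ (n - k)) * qbinom q n k"
proof (induction n arbitrary: k)
  case 0
  show ?case by (cases k) auto
next
  case (Suc n)
  have main: "(1 - q ^ Suc k) * qbinom q (Suc n) (Suc k) = (1 - q ^ Suc n) * qbinom q n k" for k
  proof (cases "k \<le> n")
    case True
    have "(1 - q ^ Suc k) * qbinom q (Suc n) (Suc k) =
      (1 - q ^ Suc k) * qbinom q n k + q ^ Suc k * ((1 - q ^ Suc k) * qbinom q n (Suc k))"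
      by (simp add: algebra_simps)
    also have "\<dots> = (1 - q ^ (Suc k + (n - k))) * qbinom q n k"
      unfolding Suc.IH by (simp add: algebra_simps power_add)
    finally show ?thesis using True by simp
  next
    case False
    thus ?thesis by (simp add: qbinom_eq_0 del: qbinom.simps)
  qed
  show ?case
  proof (cases k)
    case 0
    thus ?thesis using main[of 0] by simp
  next
    case (Suc k')
    show ?thesis
    proof (cases "k' < n")
      case True
      have "(1 - q ^ (Suc n - k)) * qbinom q (Suc n) k =
        (1 - q ^ (n - k')) * qbinom q n k' + (1 - q ^ (n - k')) * q ^ Suc k' * qbinom q n (Suc k')"
        by (simp add: Suc algebra_simps)
      also have "\<dots> = (1 - q ^ (Suc k' + (n - k'))) * qbinom q n (Suc k')"
        unfolding Suc.IH[symmetric] by (simp add: algebra_simps power_add)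
      also have "\<dots> = (1 - q ^ Suc k) * qbinom q (Suc n) (Suc k)"
        using True main[of k] by (simp add: Suc del: qbinom.simps)
      finally show ?thesis by simp
    next
      case False
      hence "k = Suc n \<or> k > Suc n" using Suc by auto
      thus ?thesis by (auto simp: qbinom_eq_0 simp del: qbinom.simps)
    qed
  qed
qed

lemma qbinom_Suc_Suc: "(1 - q ^ Suc k) * qbinom q (Suc n) (Suc k) = (1 - q ^ Suc n) * qbinom q n k"
proof (cases "k \<le> n")
  case True
  have "(1 - q ^ Suc k) * qbinom q (Suc n) (Suc k) =
    (1 - q ^ Suc k) * qbinom q n k + q ^ Suc k * ((1 - q ^ Suc k) * qbinom q n (Suc k))"
    by (simp add: algebra_simps)
  also have "\<dots> = (1 - q ^ (Suc k + (n - k))) * qbinom q n k"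
    unfolding qbinom_step by (simp add: algebra_simps power_add)
  finally show ?thesis using True by simp
next
  case False
  thus ?thesis by (simp add: qbinom_eq_0 del: qbinom.simps)
qed

text \<open>Gauss's identity. Pascal's rule turns the alternating sum over row 2h + 2 into a sum of
  terms (1 - q^(k+1)) [2h+1, k+1], and \<open>qbinom_Suc_Suc\<close> makes this 1 - q^(2h+1) times
  the sum over row 2h.\<close>

lemma qbinom_alternating_sum:
  "(\<Sum>k\<le>2 * h. (-1) ^ k * qbinom q (2 * h) k) = (\<Prod>v=1..h. 1 - q ^ (2 * v - 1))"
proof (induction h)
  case (Suc h)
  define m where "m = 2 * h"
  have "(\<Sum>k\<le>Suc (Suc m). (-1) ^ k * qbinom q (Suc (Suc m)) k) =
     1 - (\<Sum>k\<le>Suc m. (-1) ^ k * (qbinom q (Suc m) k + q ^ Suc k * qbinom q (Suc m) (Suc k)))"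
    by (subst sum.atMost_Suc_shift) (simp add: sum_negf)
  also have "(\<Sum>k\<le>Suc m. (-1) ^ k * (qbinom q (Suc m) k + q ^ Suc k * qbinom q (Suc m) (Suc k))) =
     (\<Sum>k\<le>Suc m. (-1) ^ k * qbinom q (Suc m) k) + (\<Sum>k\<le>Suc m. (-1) ^ k * (q ^ Suc k * qbinom q (Suc m) (Suc k)))"
    by (simp add: sum.distrib distrib_left)
  also have "(\<Sum>k\<le>Suc m. (-1) ^ k * qbinom q (Suc m) k) = 1 - (\<Sum>k\<le>m. (-1) ^ k * qbinom q (Suc m) (Suc k))"
    by (subst sum.atMost_Suc_shift) (simp add: sum_negf del: qbinom.simps(3))
  also have "(\<Sum>k\<le>Suc m. (-1) ^ k * (q ^ Suc k * qbinom q (Suc m) (Suc k))) =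
      (\<Sum>k\<le>m. (-1) ^ k * (q ^ Suc k * qbinom q (Suc m) (Suc k)))"
    by (simp add: qbinom_eq_0 del: qbinom.simps)
  also have "1 - (1 - (\<Sum>k\<le>m. (-1) ^ k * qbinom q (Suc m) (Suc k)) + (\<Sum>k\<le>m. (-1) ^ k * (q ^ Suc k * qbinom q (Suc m) (Suc k)))) =
      (\<Sum>k\<le>m. (-1) ^ k * ((1 - q ^ Suc k) * qbinom q (Suc m) (Suc k)))"
    by (simp add: algebra_simps sum_subtractf sum.distrib del: qbinom.simps power_Suc)
  also have "\<dots> = (1 - q ^ Suc m) * (\<Sum>k\<le>m. (-1) ^ k * qbinom q m k)"
    unfolding qbinom_Suc_Suc by (simp add: sum_distrib_left mult_ac del: power_Suc)
  also have "(\<Sum>k\<le>m. (-1) ^ k * qbinom q m k) = (\<Prod>v=1..h. 1 - q ^ (2 * v - 1))"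
    unfolding m_def by (rule Suc.IH)
  finally show ?case
    by (simp add: m_def mult.commute)
qed simp

locale odd_prime =
  fixes l h :: nat
  assumes l_eq: "l = 2 * h + 1" and prime_l: "prime l"
begin

lemma h_pos: "h > 0"
  using prime_gt_1_nat[OF prime_l] l_eq by simp

lemma l_pos: "l > 0" and l_gt_2: "l > 2"
  using h_pos l_eq by simp_all

lemma coprime_iff: "coprime y (int l) \<longleftrightarrow> \<not> int l dvd y"
  using prime_l by (metis coprime_commute prime_imp_coprime prime_nat_int_transfer
      coprime_absorb_right not_prime_unit dvd_refl coprime_common_divisor)

lemma half_system:
  assumes "\<not> int l dvd y" "i \<in> {- int h..int h}" "j \<in> {- int h..int h}" "[i * y = j * y] (mod int l)"
  shows "i = j"
proof -
  have "[i = j] (mod int l)"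
    using assms cong_mult_rcancel coprime_iff by blast
  hence "int l dvd i - j" by (simp add: cong_iff_dvd_diff)
  moreover have "\<bar>i - j\<bar> < int l" using assms l_eq by auto
  ultimately show ?thesis using zdvd_not_zless[of "\<bar>i - j\<bar>" "int l"] by (cases "i = j") auto
qed

lemma prod_half_system:
  fixes f :: "int \<Rightarrow> 'a :: comm_monoid_mult"
  assumes "\<not> int l dvd y" "\<And>k. f (k mod int l) = f k"
  shows "(\<Prod>v\<in>{- int h..int h}. f (v * y)) = (\<Prod>k\<in>{0..<int l}. f k)"
  by (rule prod_residues) (use l_pos l_eq half_system[OF assms(1)] assms(2) in auto)

definition zeta_diff :: "int \<Rightarrow> complex" where
  "zeta_diff k = zeta l k - zeta l (- k)"

lemma zeta_diff_minus: "zeta_diff (- k) = - zeta_diff k"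
  by (simp add: zeta_diff_def)

lemma zeta_diff_cong: "[a = b] (mod int l) \<Longrightarrow> zeta_diff a = zeta_diff b"
  unfolding zeta_diff_def using zeta_cong[OF l_pos] by (metis cong_minus_minus_iff)

text \<open>A product of factors 2 \<i> sin (2 pi v m / l): a square root of (-1)^h l whose sign
  depends on m through the Legendre symbol. It is the constant of the torsion products
  below.\<close>

definition sinprod :: "int \<Rightarrow> complex" where
  "sinprod m = (\<Prod>v\<in>{1..int h}. zeta_diff (v * m))"

text \<open>For 1 \<le> v \<le> h the angle 2 pi v / l lies between 0 and pi, so every sine is
  positive. The square of their product s is the product of 1 - \<zeta> over all l-th roots of unity
  \<zeta> \<noteq> 1, which is l.\<close>

lemma sinprod_1: "sinprod 1 = \<i> ^ h * of_real (sqrt (real l))"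
proof -
  have zeta_diff: "zeta_diff v = \<i> * of_real (2 * sin (2 * pi * of_int v / real l))" for v
  proof -
    have *: "2 * of_real pi * \<i> * (of_int v / of_nat l) = \<i> * of_real (2 * pi * of_int v / real l)"
      by simp
    show ?thesis
      unfolding zeta_diff_def zeta_minus unfolding zeta_def ee_def * exp_minus[symmetric]
      unfolding of_real_mult[of 2] sin_of_real[symmetric] sin_exp_eq' by (simp add: field_simps)
  qed
  define s where "s = (\<Prod>v\<in>{1..int h}. 2 * sin (2 * pi * of_int v / real l))"
  have C: "sinprod 1 = \<i> ^ h * of_real s"
    by (simp add: sinprod_def zeta_diff prod.distrib s_def)
  have "s > 0"
    unfolding s_def
  proof (rule prod_pos)
    fix v assume v: "v \<in> {1..int h}"
    hence "2 * real_of_int v < real l" using l_eq by auto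
    hence "2 * pi * of_int v / real l < pi" using l_pos pi_gt_zero
      by (simp add: field_simps)
    moreover have "2 * pi * of_int v / real l > 0" using v l_pos by auto
    ultimately show "0 < 2 * sin (2 * pi * of_int v / real l)"
      using sin_gt_zero by simp
  qed
  have l2: "\<not> int l dvd 2" using l_gt_2 zdvd_imp_le by force
  have "(\<Prod>v\<in>{1..int h}. zeta_diff v * zeta_diff (- v)) = (\<Prod>v\<in>{1..int h}. (1 - zeta l (v * 2)) * (1 - zeta l (- v * 2)))"
  proof (intro prod.cong refl)
    fix v
    have "zeta l (v * 2) = zeta l v * zeta l v" "zeta l (- v * 2) = inverse (zeta l v) * inverse (zeta l v)"
      using zeta_add[of l v v] zeta_add[of l "-v" "-v"] by (simp_all add: zeta_minus mult_2_right)
    thus "zeta_diff v * zeta_diff (- v) = (1 - zeta l (v * 2)) * (1 - zeta l (- v * 2))"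
      unfolding zeta_diff_def zeta_minus by (simp add: field_simps)
  qed
  also have "\<dots> = of_nat l"
  proof -
    \<comment> \<open>Replacing the vanishing factor at multiples of l by 1 allows reindexing over a
      complete residue system.\<close>
    define g where "g k = (if int l dvd k then 1 else 1 - zeta l k)" for k
    have g: "g (v * 2) = 1 - zeta l (v * 2)" if "v \<in> {- int h..int h}" "v \<noteq> 0" for v
      using half_system[OF l2, of v 0] that by (auto simp: g_def cong_iff_dvd_diff)
    have "(\<Prod>v\<in>{- int h..int h}. g (v * 2)) = (\<Prod>k\<in>{0..<int l}. g k)"
      by (rule prod_half_system[OF l2]) (auto simp: g_def l_pos dvd_mod_iff)
    also have "{0..<int l} = insert 0 {1..<int l}" using l_pos by auto
    also have "(\<Prod>k\<in>insert 0 {1..<int l}. g k) = (\<Prod>k\<in>{1..<int l}. 1 - zeta l k)"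
    proof -
      have "(\<Prod>k\<in>{1..<int l}. g k) = (\<Prod>k\<in>{1..<int l}. 1 - zeta l k)"
        by (intro prod.cong refl) (auto simp: g_def zdvd_not_zless)
      thus ?thesis by (simp add: g_def)
    qed
    also have "\<dots> = of_nat l" by (rule prod_one_minus_zeta'[OF l_pos])
    finally have "g 0 * (\<Prod>v\<in>{1..int h}. g (v * 2) * g (- v * 2)) = of_nat l"
      by (subst (asm) prod_symmetric) simp
    moreover have "(\<Prod>v\<in>{1..int h}. g (v * 2) * g (- v * 2)) = (\<Prod>v\<in>{1..int h}. (1 - zeta l (v * 2)) * (1 - zeta l (- v * 2)))"
      by (intro prod.cong refl arg_cong2[of _ _ _ _ "(*)"] g) auto
    ultimately show ?thesis by (simp add: g_def)
  qed
  also have "(\<Prod>v\<in>{1..int h}. zeta_diff v * zeta_diff (- v)) = (- 1) ^ h * sinprod 1 ^ 2"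
    by (simp add: zeta_diff_minus sinprod_def prod.distrib power2_eq_square prod_uminus)
  also have "\<dots> = of_real (s ^ 2)"
  proof -
    have "(\<i> ^ h) ^ 2 = (- 1 :: complex) ^ h"
      by (metis power2_i power_mult mult.commute)
    thus ?thesis by (simp add: C power_mult_distrib flip: mult.assoc)
  qed
  finally have "s ^ 2 = real l"
    by (metis of_real_eq_iff of_real_of_nat_eq)
  hence "s = sqrt (real l)"
    using \<open>s > 0\<close> by (simp add: real_sqrt_unique)
  thus ?thesis by (simp add: C)
qed

text \<open>Gauss's lemma. \<open>e v\<close> and \<open>v' v\<close> are sign and absolute value of
  the absolutely least residue of v m, and \<open>v'\<close> permutes 1, ..., h. Comparing the
  products of the v m shows that the product of the signs is m^h modulo l; the odd function
  \<open>zeta_diff\<close> releases the same signs.\<close>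

lemma sinprod_Legendre:
  assumes m: "\<not> int l dvd m"
  shows "sinprod m = of_int (Legendre m (int l)) * sinprod 1"
proof -
  define r where "r v = (v * m) mod int l" for v
  define v' where "v' v = (if r v \<le> int h then r v else int l - r v)" for v
  define e :: "int \<Rightarrow> int" where "e v = (if r v \<le> int h then 1 else -1)" for v
  have r: "r v \<noteq> 0" "0 \<le> r v" "r v < int l" if "v \<in> {1..int h}" for v
  proof -
    show "r v \<noteq> 0"
    proof
      assume "r v = 0"
      hence "[v * m = 0 * m] (mod int l)" by (simp add: r_def cong_def)
      hence "v = 0" using half_system[OF m, of v 0] that by auto
      thus False using that by simp
    qed
  qed (use l_pos in \<open>auto simp: r_def\<close>)
  have cong: "[v * m = e v * v' v] (mod int l)" for v
  proof -
    have "[v * m = r v] (mod int l)" by (simp add: r_def cong_def)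
    moreover have "[r v = r v - int l] (mod int l)" by (simp add: cong_iff_dvd_diff)
    ultimately show ?thesis unfolding e_def v'_def by (auto intro: cong_trans)
  qed
  have e_sq: "e v * e v = 1" for v by (simp add: e_def)
  have v'_in: "v' v \<in> {1..int h}" if "v \<in> {1..int h}" for v
    using r[OF that] l_eq by (auto simp: v'_def)
  have inj: "inj_on v' {1..int h}"
  proof (rule inj_onI)
    fix a b assume ab: "a \<in> {1..int h}" "b \<in> {1..int h}" "v' a = v' b"
    have "[a * m = e a * v' a] (mod int l)" by (rule cong)
    also have "e a * v' a = (e a * e b) * (e b * v' b)"
      using e_sq[of b] ab(3) by (simp add: mult.assoc flip: mult.assoc[of "e b" "e b"])
    also have "[\<dots> = (e a * e b) * (b * m)] (mod int l)"
      by (intro cong_mult cong_refl cong_sym[OF cong])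
    finally have "[a * m = (e a * e b * b) * m] (mod int l)" by (simp add: mult_ac)
    hence "a = e a * e b * b"
      using ab by (intro half_system[OF m]) (auto simp: e_def)
    thus "a = b" using ab by (auto simp: e_def split: if_splits)
  qed
  have bij: "bij_betw v' {1..int h} {1..int h}"
    using inj v'_in by (metis bij_betw_def endo_inj_surj finite_atLeastAtMost_int image_subsetI)
  define E where "E = (\<Prod>v\<in>{1..int h}. e v)"
  have "[m ^ h * (\<Prod>v\<in>{1..int h}. v) = E * (\<Prod>v\<in>{1..int h}. v)] (mod int l)"
  proof -
    have "[(\<Prod>v\<in>{1..int h}. v * m) = (\<Prod>v\<in>{1..int h}. e v * v' v)] (mod int l)"
      by (intro cong_prod cong)
    moreover have "(\<Prod>v\<in>{1..int h}. v * m) = m ^ h * (\<Prod>v\<in>{1..int h}. v)"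
      by (simp add: prod.distrib)
    moreover have "(\<Prod>v\<in>{1..int h}. e v * v' v) = E * (\<Prod>v\<in>{1..int h}. v)"
      using prod.reindex_bij_betw[OF bij, of "\<lambda>v. v"] by (simp add: prod.distrib E_def)
    ultimately show ?thesis by simp
  qed
  moreover have "coprime (\<Prod>v\<in>{1..int h}. v) (int l)"
  proof (intro prod_coprime_left)
    fix v assume "v \<in> {1..int h}"
    hence "\<not> int l dvd v" using l_eq by (intro zdvd_not_zless) auto
    thus "coprime v (int l)" using coprime_iff by blast
  qed
  ultimately have "[m ^ h = E] (mod int l)"
    using cong_mult_rcancel by blast
  moreover have "[Legendre m (int l) = m ^ h] (mod int l)"
    using euler_criterion[OF prime_l l_gt_2, of m] l_eq by simp
  moreover have "E \<in> {-1, 0, 1}"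
  proof -
    have "E * E = 1" by (simp add: E_def e_sq flip: prod.distrib)
    thus ?thesis by (auto simp: zmult_eq_1_iff)
  qed
  ultimately have E: "Legendre m (int l) = E"
    using cong_values_eq[OF _ l_gt_2 Legendre_values] cong_trans by blast
  have "sinprod m = (\<Prod>v\<in>{1..int h}. of_int (e v) * zeta_diff (v' v))"
    unfolding sinprod_def
  proof (intro prod.cong refl)
    fix v
    show "zeta_diff (v * m) = of_int (e v) * zeta_diff (v' v)"
      using zeta_diff_cong[OF cong[of v]] by (auto simp: e_def zeta_diff_minus)
  qed
  also have "\<dots> = of_int E * (\<Prod>v\<in>{1..int h}. zeta_diff (v' v))"
    by (simp add: prod.distrib E_def)
  also have "(\<Prod>v\<in>{1..int h}. zeta_diff (v' v)) = sinprod 1"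
    using prod.reindex_bij_betw[OF bij, of zeta_diff] by (simp add: sinprod_def)
  finally show ?thesis by (simp add: E)
qed

text \<open>Squaring removes the Legendre symbol, which is why \<open>torsion_unit 0 y\<close> will
  not depend on y.\<close>

lemma sinprod_square: "\<not> int l dvd m \<Longrightarrow> sinprod m ^ 2 = (- 1) ^ h * of_nat l"
proof -
  assume m: "\<not> int l dvd m"
  have "sinprod m ^ 2 = of_int (Legendre m (int l) * Legendre m (int l)) * sinprod 1 ^ 2"
    by (simp add: sinprod_Legendre[OF m] power2_eq_square mult_ac)
  also have "\<dots> = (\<i> ^ 2) ^ h * (of_real (sqrt (real l)) ^ 2)"
    by (simp add: Legendre_square[OF prime_l l_gt_2 m] sinprod_1 power_mult_distrib power_mult [symmetric] mult.commute)
  also have "of_real (sqrt (real l)) ^ 2 = (of_nat l :: complex)"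
    by (metis of_nat_0_le_iff of_real_of_nat_eq of_real_power real_sqrt_pow2)
  finally show ?thesis by simp
qed

definition gauss_sum :: complex where
  "gauss_sum = (\<Sum>c\<in>{0..<int l}. of_int (Legendre c (int l)) * zeta l c)"

lemma card_square_roots:
  assumes c: "c \<in> {0..<int l}"
  shows "int (card {n \<in> {0..<int l}. n ^ 2 mod int l = c}) = 1 + Legendre c (int l)"
proof -
  have prime: "prime (int l)" using prime_l by simp
  consider "c = 0" | "c \<noteq> 0" "QuadRes (int l) c" | "c \<noteq> 0" "\<not> QuadRes (int l) c" by blast
  thus ?thesis
  proof cases
    case 1
    have "{n \<in> {0..<int l}. n ^ 2 mod int l = c} = {0}"
    proof -
      have "n = 0" if "n \<in> {0..<int l}" "int l dvd n ^ 2" for n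
        using prime_dvd_power[OF prime that(2)] that(1) zdvd_not_zless[of n "int l"] by (cases "n = 0") auto
      thus ?thesis using 1 l_pos by (auto simp: mod_eq_0_iff_dvd)
    qed
    thus ?thesis using 1 by (simp add: Legendre_def)
  next
    case 2
    have nd: "\<not> int l dvd c" using c 2 zdvd_not_zless[of c "int l"] by auto
    from 2 obtain y where y: "[y ^ 2 = c] (mod int l)" by (auto simp: QuadRes_def)
    have ynd: "\<not> int l dvd y"
    proof
      assume "int l dvd y"
      hence "int l dvd y ^ 2" by (simp add: power2_eq_square)
      thus False using nd cong_dvd_iff[OF y] by simp
    qed
    have eq: "n ^ 2 mod int l = c \<longleftrightarrow> n = y mod int l \<or> n = (- y) mod int l" if n: "n \<in> {0..<int l}" for n
    proof -
      have "n ^ 2 mod int l = c \<longleftrightarrow> [n ^ 2 = y ^ 2] (mod int l)"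
        using y c by (auto simp: cong_def)
      also have "\<dots> \<longleftrightarrow> int l dvd (n - y) * (n + y)"
        by (simp add: cong_iff_dvd_diff power2_eq_square algebra_simps)
      also have "\<dots> \<longleftrightarrow> int l dvd n - y \<or> int l dvd n - (- y)"
        by (simp add: prime_dvd_mult_iff[OF prime])
      also have "\<dots> \<longleftrightarrow> [n = y] (mod int l) \<or> [n = - y] (mod int l)"
        by (simp add: cong_iff_dvd_diff)
      finally show ?thesis using n by (auto simp: cong_def)
    qed
    have ne: "y mod int l \<noteq> (- y) mod int l"
    proof
      assume "y mod int l = (- y) mod int l"
      hence "int l dvd 2 * y" by (simp add: mod_eq_dvd_iff)
      hence "int l dvd 2" using ynd by (simp add: prime_dvd_mult_iff[OF prime])
      thus False using l_gt_2 zdvd_imp_le[of "int l" 2] by simp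
    qed
    have "{n \<in> {0..<int l}. n ^ 2 mod int l = c} = {y mod int l, (- y) mod int l}"
      using eq l_pos by (auto simp del: mod_minus_eq)
    thus ?thesis using ne 2 nd by (simp add: Legendre_def cong_0_iff)
  next
    case 3
    have nd: "\<not> int l dvd c" using c 3 zdvd_not_zless[of c "int l"] by auto
    have "{n \<in> {0..<int l}. n ^ 2 mod int l = c} = {}"
      using 3 c by (auto simp: QuadRes_def cong_def)
    hence "card {n \<in> {0..<int l}. n ^ 2 mod int l = c} = 0" by (simp only: card.empty)
    thus ?thesis using 3 nd by (simp add: Legendre_def cong_0_iff del: card_eq_0_iff)
  qed
qed

lemma sum_zeta: "(\<Sum>c\<in>{0..<int l}. zeta l c) = 0"
proof -
  define S where "S = (\<Sum>c\<in>{0..<int l}. zeta l c)"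
  have "(\<Sum>c\<in>{0..<int l}. zeta l (c + 1)) = S"
    unfolding S_def
  proof (rule sum_residues)
    fix i j assume "i \<in> {0..<int l}" "j \<in> {0..<int l}" "[i + 1 = j + 1] (mod int l)"
    hence "[i = j] (mod int l)" by (simp only: cong_add_rcancel)
    thus "i = j" using \<open>i \<in> _\<close> \<open>j \<in> _\<close> by (simp add: cong_def)
  qed (use l_pos in auto)
  hence "zeta l 1 * S = S" by (simp add: S_def zeta_add sum_distrib_left mult.commute)
  moreover have "zeta l 1 \<noteq> 1" using zeta_eq_1_iff[OF l_pos, of 1] l_gt_2 by simp
  ultimately show ?thesis by (simp add: S_def)
qed

text \<open>Group n by n^2 mod l; in the number 1 + (c/l) of square roots the summand 1 contributes
  the sum of all l-th roots of unity, which is 0.\<close>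

lemma gauss_sum_squares: "gauss_sum = (\<Sum>n\<in>{0..<int l}. zeta l (n ^ 2))"
proof -
  have "(\<Sum>n\<in>{0..<int l}. zeta l (n ^ 2)) =
     (\<Sum>c\<in>{0..<int l}. \<Sum>n\<in>{n \<in> {0..<int l}. n ^ 2 mod int l = c}. zeta l (n ^ 2))"
    by (rule sum.group[symmetric]) (use l_pos in auto)
  also have "\<dots> = (\<Sum>c\<in>{0..<int l}. of_int (1 + Legendre c (int l)) * zeta l c)"
  proof (intro sum.cong refl)
    fix c assume c: "c \<in> {0..<int l}"
    have "(\<Sum>n\<in>{n \<in> {0..<int l}. n ^ 2 mod int l = c}. zeta l (n ^ 2)) =
       (\<Sum>n\<in>{n \<in> {0..<int l}. n ^ 2 mod int l = c}. zeta l c)"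
      by (intro sum.cong refl zeta_cong l_pos) (use c in \<open>auto simp: cong_def\<close>)
    also have "\<dots> = of_int (1 + Legendre c (int l)) * zeta l c"
      by (simp flip: card_square_roots[OF c])
    finally show "(\<Sum>n\<in>{n \<in> {0..<int l}. n ^ 2 mod int l = c}. zeta l (n ^ 2)) = of_int (1 + Legendre c (int l)) * zeta l c" .
  qed
  also have "\<dots> = gauss_sum"
    by (simp add: distrib_right sum.distrib sum_zeta gauss_sum_def)
  finally show ?thesis by simp
qed

text \<open>Gauss's evaluation: the \<open>q\<close>-binomials \<open>[l - 1, k]\<close> at a primitive \<open>l\<close>-th root of unity
  are \<open>(-1)\<^sup>k q\<^bsup>-k(k+1)/2\<^esup>\<close>; here \<open>q\<close> is the root \<open>\<zeta>\<^bsup>-8\<^esup>\<close>, to complete the square.\<close>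

theorem gauss_sum_eq: "gauss_sum = (- \<i>) ^ h * of_int (Legendre 2 (int l)) * of_real (sqrt (real l))"
proof -
  define q where "q = zeta l (- 8)"
  have prime: "prime (int l)" using prime_l by simp
  have l2: "\<not> int l dvd 2" using l_gt_2 zdvd_imp_le[of "int l" 2] by auto
  hence l8: "\<not> int l dvd 8"
    using prime_dvd_power[OF prime, of 2 3] by auto
  have q_ne: "q ^ Suc k \<noteq> 1" if "Suc k < l" for k
  proof -
    have "\<not> int l dvd int (Suc k)" using that by (intro zdvd_not_zless) auto
    hence "\<not> int l dvd int (Suc k) * (- 8)"
      using l8 by (simp only: prime_dvd_mult_iff[OF prime] dvd_minus_iff simp_thms)
    thus ?thesis unfolding q_def zeta_power by (simp add: zeta_eq_1_iff[OF l_pos])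
  qed
  have root_value: "(-1) ^ k * qbinom q (2 * h) k = zeta l (4 * int k * (int k + 1))" if "k \<le> 2 * h" for k
    using that
  proof (induction k)
    case (Suc k)
    have k: "Suc k < l" using Suc.prems l_eq by simp
    have "q ^ (2 * h - k) = zeta l (8 * (int k + 1))"
      unfolding q_def zeta_power
    proof (rule zeta_cong[OF l_pos])
      have "int (2 * h - k) * - 8 - 8 * (int k + 1) = int l * (- 8)"
        using Suc.prems l_eq by (simp add: of_nat_diff)
      thus "[int (2 * h - k) * - 8 = 8 * (int k + 1)] (mod int l)"
        by (simp add: cong_iff_dvd_diff)
    qed
    moreover have "q ^ Suc k * zeta l (8 * (int k + 1)) = 1"
      unfolding q_def zeta_power zeta_add[symmetric] by (simp add: algebra_simps)
    ultimately have "1 - q ^ (2 * h - k) = - zeta l (8 * (int k + 1)) * (1 - q ^ Suc k)"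
      by (simp add: algebra_simps)
    with qbinom_step[of q k "2 * h"] have "(1 - q ^ Suc k) * qbinom q (2 * h) (Suc k) =
      (1 - q ^ Suc k) * (- zeta l (8 * (int k + 1)) * qbinom q (2 * h) k)"
      by (simp add: mult_ac)
    hence "qbinom q (2 * h) (Suc k) = - zeta l (8 * (int k + 1)) * qbinom q (2 * h) k"
      using q_ne[OF k] by (metis eq_iff_diff_eq_0 mult_cancel_left)
    hence "(-1) ^ Suc k * qbinom q (2 * h) (Suc k) = zeta l (8 * (int k + 1)) * ((-1) ^ k * qbinom q (2 * h) k)"
      by simp
    also have "\<dots> = zeta l (8 * (int k + 1) + 4 * int k * (int k + 1))"
      using Suc by (simp only: zeta_add)
    also have "8 * (int k + 1) + 4 * int k * (int k + 1) = 4 * int (Suc k) * (int (Suc k) + 1)"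
      by (simp add: algebra_simps)
    finally show ?case .
  qed simp
  have "gauss_sum = (\<Sum>n\<in>{0..<int l}. zeta l (n ^ 2))"
    by (rule gauss_sum_squares)
  \<comment> \<open>The odd numbers 2k + 1 form a complete residue system, and (2k + 1)^2 = 1 + 4k(k
    + 1) exhibits the exponent of \<open>root_value\<close>.\<close>
  also have "\<dots> = (\<Sum>k\<in>{..2 * h}. zeta l ((2 * int k + 1) ^ 2))"
  proof (rule sum_residues[symmetric, where f = "\<lambda>n. zeta l (n ^ 2)" and g = "\<lambda>k. 2 * int k + 1"])
    fix i j assume ij: "i \<in> {..2 * h}" "j \<in> {..2 * h}" "[2 * int i + 1 = 2 * int j + 1] (mod int l)"
    hence "int l dvd 2 * (int i - int j)" by (simp add: cong_iff_dvd_diff algebra_simps)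
    hence "int l dvd int i - int j" using l2 prime_dvd_mult_iff[OF prime] by blast
    moreover have "\<bar>int i - int j\<bar> < int l" using ij l_eq by auto
    ultimately show "i = j" using zdvd_not_zless[of "\<bar>int i - int j\<bar>" "int l"] by (cases "i = j") auto
  next
    fix k show "zeta l ((k mod int l) ^ 2) = zeta l (k ^ 2)"
      by (intro zeta_cong l_pos cong_pow) auto
  qed (use l_pos l_eq in auto)
  also have "\<dots> = (\<Sum>k\<le>2 * h. zeta l 1 * ((-1) ^ k * qbinom q (2 * h) k))"
  proof (intro sum.cong refl)
    fix k assume "k \<in> {..2 * h}"
    thus "zeta l ((2 * int k + 1) ^ 2) = zeta l 1 * ((-1) ^ k * qbinom q (2 * h) k)"
      by (simp add: root_value flip: zeta_add) (simp add: algebra_simps power2_eq_square)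
  qed
  also have "\<dots> = zeta l 1 * (\<Prod>v=1..h. 1 - q ^ (2 * v - 1))"
    by (simp only: sum_distrib_left [symmetric] qbinom_alternating_sum)
  \<comment> \<open>As q is \<zeta> to the power -8, q^(2v-1) is \<zeta> to the power -2x with x =
    4(2v - 1); extracting half of the exponent leaves \<open>zeta_diff x\<close>.\<close>
  also have "(\<Prod>v=1..h. 1 - q ^ (2 * v - 1)) = (\<Prod>v=1..h. zeta l (- (4 * (2 * int v - 1))) * zeta_diff (4 * (2 * int v - 1)))"
  proof (intro prod.cong refl)
    fix v assume "v \<in> {1..h}"
    moreover define x where "x = 4 * (2 * int v - 1)"
    ultimately have "q ^ (2 * v - 1) = zeta l (- x + - x)"
      unfolding q_def zeta_power by (intro arg_cong[where f = "zeta l"]) (auto simp: of_nat_diff)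
    moreover have "zeta l (- x) * zeta l x = 1"
      by (simp add: zeta_minus)
    ultimately have "1 - q ^ (2 * v - 1) = zeta l (- x) * zeta_diff x"
      by (simp only: zeta_diff_def zeta_add right_diff_distrib)
    thus "1 - q ^ (2 * v - 1) = zeta l (- (4 * (2 * int v - 1))) * zeta_diff (4 * (2 * int v - 1))"
      by (simp only: x_def)
  qed
  also have "\<dots> = zeta l (\<Sum>v=1..h. - (4 * (2 * int v - 1))) * (\<Prod>v=1..h. zeta_diff (4 * (2 * int v - 1)))"
    by (simp add: prod.distrib zeta_sum)
  also have "(\<Sum>v=1..h. - (4 * (2 * int v - 1))) = - (4 * int h ^ 2)"
    by (induction h) (auto simp: algebra_simps power2_eq_square)
  also have "zeta l (- (4 * int h ^ 2)) = zeta l (- 1)"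
  proof (rule zeta_cong[OF l_pos])
    have "- (4 * int h ^ 2) - (- 1) = int l * (1 - 2 * int h)"
      using l_eq by (simp add: algebra_simps power2_eq_square)
    thus "[- (4 * int h ^ 2) = - 1] (mod int l)"
      by (simp add: cong_iff_dvd_diff)
  qed
  \<comment> \<open>Reversing the order, v to h + 1 - v, gives 4(2h + 1) - 8v, which is -8v modulo
    l.\<close>
  also have "(\<Prod>v=1..h. zeta_diff (4 * (2 * int v - 1))) = (\<Prod>v=1..h. - zeta_diff (int v * 8))"
  proof -
    have "(\<Prod>v=1..h. zeta_diff (4 * (2 * int v - 1))) = (\<Prod>v=1..h. zeta_diff (4 * (2 * int (h + 1 - v) - 1)))"
      by (rule prod.reindex_bij_witness[of _ "\<lambda>v. h + 1 - v" "\<lambda>v. h + 1 - v"]) auto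
    also have "\<dots> = (\<Prod>v=1..h. - zeta_diff (int v * 8))"
    proof (intro prod.cong refl)
      fix v assume "v \<in> {1..h}"
      hence "4 * (2 * int (h + 1 - v) - 1) - (- (int v * 8)) = int l * 4"
        using l_eq by (simp add: of_nat_diff algebra_simps)
      hence "zeta_diff (4 * (2 * int (h + 1 - v) - 1)) = zeta_diff (- (int v * 8))"
        by (intro zeta_diff_cong) (simp add: cong_iff_dvd_diff)
      thus "zeta_diff (4 * (2 * int (h + 1 - v) - 1)) = - zeta_diff (int v * 8)" by (simp add: zeta_diff_minus)
    qed
    finally show ?thesis .
  qed
  also have "(\<Prod>v=1..h. - zeta_diff (int v * 8)) = (- 1) ^ h * sinprod 8"
  proof -
    have "(\<Prod>v=1..h. zeta_diff (int v * 8)) = sinprod 8"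
      unfolding sinprod_def by (rule prod.reindex_bij_witness[of _ nat int]) auto
    thus ?thesis by (simp add: prod_uminus)
  qed
  also have "sinprod 8 = of_int (Legendre 2 (int l)) * sinprod 1"
  proof -
    have "Legendre (2 * (2 * 2)) (int l) = Legendre 2 (int l)"
      using Legendre_square[OF prime_l l_gt_2 l2] by (simp only: Legendre_mult[OF prime_l l_gt_2])
    thus ?thesis using sinprod_Legendre[OF l8] by simp
  qed
  finally show ?thesis
    by (simp add: sinprod_1 zeta_minus power_minus[of "\<i>"])
qed

end

section \<open>Products of Klein forms over torsion points\<close>

lemma csqrt_divide_of_nat:
  assumes "n > 0"
  shows "csqrt (z / of_nat n) = csqrt z / of_real (sqrt (real n))"
proof (rule csqrt_unique)
  have "of_real (sqrt (real n)) ^ 2 = (of_nat n :: complex)"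
    by (metis of_nat_0_le_iff of_real_of_nat_eq of_real_power real_sqrt_pow2)
  thus "(csqrt z / of_real (sqrt (real n)))\<^sup>2 = z / of_nat n"
    by (simp add: power_divide)
  show "0 < Re (csqrt z / of_real (sqrt (real n))) \<or>
     Re (csqrt z / of_real (sqrt (real n))) = 0 \<and> 0 \<le> Im (csqrt z / of_real (sqrt (real n)))"
    using csqrt_principal[of z] assms by (auto simp: Re_divide_of_real Im_divide_of_real)
qed

lemma eta_minus_inverse_scaled:
  assumes t: "Im t > 0" and n: "n > 0"
  shows "eta (- of_nat n / t) = csqrt (- \<i> * t) / of_real (sqrt (real n)) * eta (t / of_nat n)"
proof -
  have "Im (t / of_nat n) > 0" using t n by (simp add: Im_divide_of_nat)
  from eta_minus_inverse[OF this] show ?thesis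
    using csqrt_divide_of_nat[OF n, of "- \<i> * t"] by simp
qed

lemma prod_ee_of_int:
  "(\<Prod>v\<in>A. ee (of_int (2 * s v * c) / n)) = ee (of_int (2 * c * (\<Sum>v\<in>A. s v)) / n)"
proof -
  have "2 * c * (\<Sum>v\<in>A. s v) = (\<Sum>v\<in>A. 2 * s v * c)"
    by (simp add: sum_distrib_left sum_distrib_right mult_ac)
  thus ?thesis by (simp add: ee_sum sum_divide_distrib)
qed

context odd_prime
begin

lemma sum_half_system: "(\<Sum>w\<in>{- int h..int h}. w) = 0"
  by (subst sum_symmetric) simp

lemma prod_zeta_half_system: "(\<Prod>w\<in>{- int h..int h}. zeta l (w * y)) = 1"
  using sum_half_system by (simp flip: zeta_sum sum_distrib_right)

lemma nat_minus_half: "nat (2 * int h + 1) = l"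
  using l_eq by simp

lemma prod_one_minus_zeta_half:
  assumes y: "\<not> int l dvd y"
  shows "(\<Prod>w\<in>{- int h..int h}. 1 - zeta l (w * y) * X) = 1 - X ^ l"
  using prod_half_system[OF y, of "\<lambda>k. 1 - zeta l k * X"] prod_one_minus_zeta[OF l_pos] l_pos by simp

lemma qp_half_system:
  assumes y: "\<not> int l dvd y" and q: "norm q < 1"
  shows "(\<Prod>w\<in>{- int h..int h}. qp (u * zeta l (w * y)) q) = qp (u ^ l) (q ^ l)"
proof (rule qp_prod)
  show "norm (q ^ l) < 1"
    using q l_pos by (simp add: norm_power power_less_one_iff)
  fix n
  have "(\<Prod>w\<in>{- int h..int h}. 1 - u * zeta l (w * y) * q ^ n) = 1 - (u * q ^ n) ^ l"
    using prod_one_minus_zeta_half[OF y, of "u * q ^ n"] by (simp add: mult_ac)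
  thus "(\<Prod>w\<in>{- int h..int h}. 1 - u * zeta l (w * y) * q ^ n) = 1 - u ^ l * (q ^ l) ^ n"
    by (simp add: power_mult_distrib mult.commute flip: power_mult)
qed (use q in auto)

lemma eta_quotient:
  assumes t: "Im t > 0"
  shows "eta (of_nat l * t) / eta t ^ l = qp (ee t ^ l) (ee t ^ l) / qp (ee t) (ee t) ^ l"
proof -
  have "ee (of_nat l * t / 24) = ee (t / 24) ^ l"
    by (simp add: ee_power)
  thus ?thesis
    by (simp add: eta_def power_mult_distrib ee_power)
qed

lemma not_dvd_2: "\<not> int l dvd 2"
  using l_gt_2 zdvd_imp_le[of "int l" 2] by auto

lemma prime_int_l: "prime (int l)"
  using prime_l by simp

text \<open>Every linear factor runs over all l-th roots of unity and multiplies up to its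
  counterpart for l z and l t. The 2 in the points makes the prefactor \<open>ee\<close> of half the
  argument move by an l-th root of unity too, and these cancel over the centred range.\<close>

lemma theta0_distribution:
  assumes t: "Im t > 0" and y: "\<not> int l dvd y"
  shows "(\<Prod>w\<in>{- int h..int h}. theta0 (z + of_int (2 * w * y) / of_nat l) t) =
    theta0 (of_nat l * z) (of_nat l * t) * (eta (of_nat l * t) / eta t ^ l) ^ 2"
proof -
  define q where "q = ee t"
  define a where "a = ee (z / 2)"
  have q: "norm q < 1" "q \<noteq> 0" by (simp_all add: q_def norm_ee_less_1 t)
  have ql: "norm (q ^ l) < 1" using q l_pos by (simp add: norm_power power_less_one_iff)
  have a0: "a \<noteq> 0" by (simp add: a_def)
  have y2: "\<not> int l dvd 2 * y" "\<not> int l dvd - (2 * y)"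
    using y not_dvd_2 prime_dvd_mult_iff[OF prime_int_l, of 2 y] by auto
  have ez: "ee z = a ^ 2" by (simp add: a_def ee_power)
  have factor: "theta0 (z + of_int (2 * w * y) / of_nat l) t =
      (a * zeta l (w * y)) * (1 - zeta l (w * - (2 * y)) * inverse (a ^ 2)) *
       qp (ee z * q * zeta l (w * (2 * y))) q * qp (inverse (ee z) * q * zeta l (w * - (2 * y))) q / qp q q ^ 2" for w
  proof -
    have 1: "ee ((z + of_int (2 * w * y) / of_nat l) / 2) = a * zeta l (w * y)"
      unfolding a_def zeta_def ee_add[symmetric] by (rule arg_cong[where f = ee]) (simp add: add_divide_distrib)
    have 2: "ee (- (z + of_int (2 * w * y) / of_nat l) / 2) = inverse (a * zeta l (w * y))"
      unfolding 1[symmetric] ee_minus[symmetric] by (simp only: minus_divide_left)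
    have 3: "ee (z + of_int (2 * w * y) / of_nat l) = ee z * zeta l (w * (2 * y))"
      unfolding zeta_def ee_add[symmetric] by (rule arg_cong[where f = ee]) (simp add: mult_ac)
    have 4: "ee (- (z + of_int (2 * w * y) / of_nat l)) = inverse (ee z) * zeta l (w * - (2 * y))"
      unfolding ee_minus 3 by (simp add: zeta_minus)
    have 5: "zeta l (w * - (2 * y)) = inverse (zeta l (w * y)) * inverse (zeta l (w * y))"
    proof -
      have "w * - (2 * y) = - (w * y) + - (w * y)" by (simp add: algebra_simps)
      thus ?thesis by (simp only: zeta_add zeta_minus)
    qed
    have 6: "a * zeta l (w * y) - inverse (a * zeta l (w * y)) = (a * zeta l (w * y)) * (1 - zeta l (w * - (2 * y)) * inverse (a ^ 2))"
      unfolding 5 using a0 by (simp add: field_simps power2_eq_square)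
    show ?thesis
      unfolding theta0_def 1 2 3 4 6 q_def[symmetric] by (simp add: mult_ac)
  qed
  have "(\<Prod>w\<in>{- int h..int h}. theta0 (z + of_int (2 * w * y) / of_nat l) t) =
     (\<Prod>w\<in>{- int h..int h}. a) * (\<Prod>w\<in>{- int h..int h}. zeta l (w * y)) *
     (\<Prod>w\<in>{- int h..int h}. 1 - zeta l (w * - (2 * y)) * inverse (a ^ 2)) *
     (\<Prod>w\<in>{- int h..int h}. qp (ee z * q * zeta l (w * (2 * y))) q) *
     (\<Prod>w\<in>{- int h..int h}. qp (inverse (ee z) * q * zeta l (w * - (2 * y))) q) / (\<Prod>w\<in>{- int h..int h}. qp q q ^ 2)"
    unfolding factor prod.distrib prod_dividef by simp
  also have "\<dots> = a ^ l * (1 - inverse (a ^ 2) ^ l) * qp ((ee z * q) ^ l) (q ^ l) * qp ((inverse (ee z) * q) ^ l) (q ^ l) / (qp q q ^ 2) ^ l"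
    unfolding prod_zeta_half_system prod_one_minus_zeta_half[OF y2(2)] qp_half_system[OF y2(1) q(1)] qp_half_system[OF y2(2) q(1)]
    by (simp add: nat_minus_half)
  also have "a ^ l * (1 - inverse (a ^ 2) ^ l) = ee (of_nat l * z / 2) - ee (- (of_nat l * z) / 2)"
  proof -
    have "ee (of_nat l * z / 2) = a ^ l" by (simp add: a_def ee_power)
    moreover from this have "ee (- (of_nat l * z) / 2) = inverse (a ^ l)"
      by (simp only: ee_minus flip: minus_divide_left)
    moreover have "a ^ l * (1 - inverse (a ^ 2) ^ l) = a ^ l - inverse (a ^ l)"
      using a0 by (simp add: right_diff_distrib power_inverse field_simps flip: power_mult) (simp add: power_mult power2_eq_square)
    ultimately show ?thesis by simp
  qed
  also have "(ee z * q) ^ l = ee (of_nat l * z) * ee (of_nat l * t)"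
    by (simp add: power_mult_distrib ee_power q_def)
  also have "(inverse (ee z) * q) ^ l = ee (- (of_nat l * z)) * ee (of_nat l * t)"
    by (simp add: power_mult_distrib ee_power q_def ee_minus power_inverse)
  finally have "(\<Prod>w\<in>{- int h..int h}. theta0 (z + of_int (2 * w * y) / of_nat l) t) =
    (ee (of_nat l * z / 2) - ee (- (of_nat l * z) / 2)) * qp (ee (of_nat l * z) * ee (of_nat l * t)) (q ^ l) *
      qp (ee (- (of_nat l * z)) * ee (of_nat l * t)) (q ^ l) / (qp q q ^ 2) ^ l" .
  also have "q ^ l = ee (of_nat l * t)" by (simp add: q_def ee_power)
  also have "(ee (of_nat l * z / 2) - ee (- (of_nat l * z) / 2)) * qp (ee (of_nat l * z) * ee (of_nat l * t)) (ee (of_nat l * t)) *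
      qp (ee (- (of_nat l * z)) * ee (of_nat l * t)) (ee (of_nat l * t)) / (qp q q ^ 2) ^ l =
     theta0 (of_nat l * z) (of_nat l * t) * (qp (q ^ l) (q ^ l) / qp q q ^ l) ^ 2"
  proof -
    have "qp (q ^ l) (q ^ l) \<noteq> 0" using qp_self_nonzero[OF ql] q by auto
    moreover have "(qp q q ^ 2) ^ l = (qp q q ^ l) ^ 2" by (simp flip: power_mult add: mult.commute)
    ultimately show ?thesis
      unfolding theta0_def by (simp add: q_def ee_power power_divide)
  qed
  also have "qp (q ^ l) (q ^ l) / qp q q ^ l = eta (of_nat l * t) / eta t ^ l"
    unfolding eta_quotient[OF t] q_def ..
  finally show ?thesis .
qed

text \<open>As 2 is invertible modulo l, the points 2v (x, y) / l represent the nonzero multiples of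
  (x, y) / l up to sign. Because of the 2, changing x or y by a multiple of l is an even shift, and
  the sign in \<open>klein_shift\<close> disappears.\<close>

definition torsion_prod :: "int \<Rightarrow> int \<Rightarrow> complex \<Rightarrow> complex" where
  "torsion_prod x y t = (\<Prod>v\<in>{1..int h}. klein (of_int (2 * v * x) / real l) (of_int (2 * v * y) / real l) t)"

lemma torsion_prod_modular:
  assumes t: "Im t > 0" and det: "A * D - B * C = 1"
  shows "torsion_prod x y ((of_int A * t + of_int B) / (of_int C * t + of_int D)) =
    torsion_prod (x * A + y * C) (x * B + y * D) t / (of_int C * t + of_int D) ^ h"
proof -
  have "klein (of_int (2 * v * x) / real l) (of_int (2 * v * y) / real l) ((of_int A * t + of_int B) / (of_int C * t + of_int D)) =
     klein (of_int (2 * v * (x * A + y * C)) / real l) (of_int (2 * v * (x * B + y * D)) / real l) t / (of_int C * t + of_int D)" for v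
    by (subst klein_modular[OF t det]) (simp add: add_divide_distrib algebra_simps)
  thus ?thesis by (simp add: torsion_prod_def prod_dividef)
qed

text \<open>The exponents in \<open>klein_torsion_shift\<close> are proportional to v^2, so their
  total over a half system is proportional to this sum.\<close>

definition sqsum :: int where
  "sqsum = (\<Sum>v\<in>{1..int h}. v ^ 2)"

lemma sqsum_eq: "6 * sqsum = int h * (int h + 1) * int l"
proof -
  have "6 * (\<Sum>v\<in>{1..int n}. v ^ 2) = int n * (int n + 1) * (2 * int n + 1)" for n
  proof (induction n)
    case (Suc n)
    have "{1..int (Suc n)} = insert (int n + 1) {1..int n}" by auto
    thus ?case using Suc.IH by (simp add: algebra_simps power2_eq_square)
  qed simp
  thus ?thesis using l_eq by (simp add: sqsum_def)
qed

lemma klein_torsion_shift: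
  assumes t: "Im t > 0" and n: "n > 0"
  shows "klein (of_int (2 * v * (x + int n * a)) / real n) (of_int (2 * v * (y + int n * b)) / real n) t =
    ee (of_int (2 * v ^ 2 * (x * b - y * a)) / of_nat n) * klein (of_int (2 * v * x) / real n) (of_int (2 * v * y) / real n) t"
proof -
  have e: "of_int (2 * v * (x + int n * a)) / real n = of_int (2 * v * x) / real n + of_int (2 * v * a)" for x a
    using n by (simp add: field_simps)
  have "(-1) powi (2 * v * a + 2 * v * b) = (1 :: complex)"
    by (simp flip: distrib_left add: power_int_mult mult.assoc)
  moreover have "ee ((of_real (of_int (2 * v * x) / real n) * of_int (2 * v * b) - of_real (of_int (2 * v * y) / real n) * of_int (2 * v * a)
       + of_int (2 * v * a * (2 * v * b))) / 2) = ee (of_int (2 * v ^ 2 * (x * b - y * a)) / of_nat n)"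
  proof -
    have "ee ((of_real (of_int (2 * v * x) / real n) * of_int (2 * v * b) - of_real (of_int (2 * v * y) / real n) * of_int (2 * v * a)
       + of_int (2 * v * a * (2 * v * b))) / 2) = ee (of_int (2 * v ^ 2 * (x * b - y * a)) / of_nat n + of_int (2 * v ^ 2 * a * b))"
      using n by (intro arg_cong[where f = ee]) (simp add: field_simps power2_eq_square)
    thus ?thesis by (simp only: ee_add_of_int)
  qed
  ultimately show ?thesis
    unfolding e klein_shift[OF t] by (simp only: mult_1)
qed

lemma torsion_prod_shift:
  assumes t: "Im t > 0"
  shows "torsion_prod (x + int l * a) (y + int l * b) t = ee (of_int (2 * (x * b - y * a) * sqsum) / of_nat l) * torsion_prod x y t"
proof -
  have "(\<Prod>v\<in>{1..int h}. ee (of_int (2 * v ^ 2 * (x * b - y * a)) / of_nat l)) = ee (of_int (2 * (x * b - y * a) * sqsum) / of_nat l)"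
    unfolding sqsum_def by (rule prod_ee_of_int)
  thus ?thesis
    unfolding torsion_prod_def klein_torsion_shift[OF t l_pos] prod.distrib by (simp only:)
qed

text \<open>Each Klein form contributes \<open>zeta_diff (v * y)\<close> and Pochhammer symbols for
  v and -v. Together with the missing v = 0, whose symbol is E, these fill a complete residue
  system.\<close>

lemma torsion_prod_0:
  assumes t: "Im t > 0" and y: "\<not> int l dvd y"
  shows "torsion_prod 0 y t = sinprod y * (eta (of_nat l * t) / eta t ^ l)"
proof -
  define q where "q = ee t"
  have q: "norm q < 1" "q \<noteq> 0" by (simp_all add: q_def norm_ee_less_1 t)
  define E where "E = qp q q"
  have E0: "E \<noteq> 0" unfolding E_def using q by (rule qp_self_nonzero)
  have y2: "\<not> int l dvd 2 * y"
    using y not_dvd_2 prime_dvd_mult_iff[OF prime_int_l, of 2 y] by auto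
  have "torsion_prod 0 y t = (\<Prod>v\<in>{1..int h}. zeta_diff (v * y) * (qp (q * zeta l (v * (2 * y))) q * qp (q * zeta l (- v * (2 * y))) q) / E ^ 2)"
    unfolding torsion_prod_def
  proof (intro prod.cong refl)
    fix v
    have 1: "ee (of_real (of_int (2 * v * y) / real l) / 2) = zeta l (v * y)" "ee (- of_real (of_int (2 * v * y) / real l) / 2) = zeta l (- (v * y))"
      "ee (of_real (of_int (2 * v * y) / real l)) = zeta l (v * (2 * y))" "ee (- of_real (of_int (2 * v * y) / real l)) = zeta l (- v * (2 * y))"
      unfolding zeta_def by (rule arg_cong[where f = ee]; simp add: mult_ac)+
    have "klein (of_int (2 * v * 0) / real l) (of_int (2 * v * y) / real l) t = theta0 (of_real (of_int (2 * v * y) / real l)) t"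
      by (simp add: klein_def)
    also have "\<dots> = zeta_diff (v * y) * (qp (q * zeta l (v * (2 * y))) q * qp (q * zeta l (- v * (2 * y))) q) / E ^ 2"
      unfolding theta0_def 1 zeta_diff_def E_def q_def[symmetric] by (simp add: mult_ac)
    finally show "klein (of_int (2 * v * 0) / real l) (of_int (2 * v * y) / real l) t = \<dots>" .
  qed
  also have "\<dots> = sinprod y * (\<Prod>v\<in>{1..int h}. qp (q * zeta l (v * (2 * y))) q * qp (q * zeta l (- v * (2 * y))) q) / (E ^ 2) ^ h"
    by (simp add: prod.distrib prod_dividef sinprod_def)
  also have "(\<Prod>v\<in>{1..int h}. qp (q * zeta l (v * (2 * y))) q * qp (q * zeta l (- v * (2 * y))) q) = qp (q ^ l) (q ^ l) / E"
    using qp_half_system[OF y2 q(1), of q] E0 unfolding prod_symmetric by (simp add: E_def field_simps)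
  also have "sinprod y * (qp (q ^ l) (q ^ l) / E) / (E ^ 2) ^ h = sinprod y * (qp (q ^ l) (q ^ l) / E ^ l)"
    unfolding l_eq by (simp add: power_mult)
  also have "qp (q ^ l) (q ^ l) / E ^ l = eta (of_nat l * t) / eta t ^ l"
    unfolding eta_quotient[OF t] q_def E_def ..
  finally show ?thesis .
qed

text \<open>The inversion exchanges the two coordinates of the index. Since l = 2h + 1, the square
  roots from the eta inversions cancel except for an h-th power.\<close>

lemma torsion_prod_x_0:
  assumes t: "Im t > 0" and x: "\<not> int l dvd x"
  shows "torsion_prod x 0 t = sinprod x * \<i> ^ h / of_real (sqrt (real l)) * (eta (t / of_nat l) / eta t ^ l)"
proof -
  have t0: "t \<noteq> 0" using t by auto
  have t': "Im (- 1 / t) > 0"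
    using moebius_aux(2)[OF t, of 0 0 "-1" 1] by simp
  have "torsion_prod 0 x (- 1 / t) = torsion_prod x 0 t / t ^ h"
    using torsion_prod_modular[OF t, of 0 0 "-1" 1 0 x] by simp
  hence "torsion_prod x 0 t = t ^ h * (sinprod x * (eta (of_nat l * (- 1 / t)) / eta (- 1 / t) ^ l))"
    using torsion_prod_0[OF t' x] t0 by (simp add: field_simps)
  also have "of_nat l * (- 1 / t) = - of_nat l / t" by simp
  also have "eta (- of_nat l / t) = csqrt (- \<i> * t) / of_real (sqrt (real l)) * eta (t / of_nat l)"
    by (rule eta_minus_inverse_scaled[OF t l_pos])
  also have "eta (- 1 / t) ^ l = csqrt (- \<i> * t) * (- \<i> * t) ^ h * eta t ^ l"
  proof -
    have "csqrt (- \<i> * t) ^ l = csqrt (- \<i> * t) * (csqrt (- \<i> * t) ^ 2) ^ h"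
      unfolding l_eq by (simp add: power_mult)
    thus ?thesis unfolding eta_minus_inverse[OF t] power_mult_distrib power2_csqrt by simp
  qed
  finally have "torsion_prod x 0 t = (t ^ h / (- \<i> * t) ^ h) * (sinprod x / of_real (sqrt (real l)) * (eta (t / of_nat l) / eta t ^ l))"
    using t0 by (simp add: field_simps)
  also have "t ^ h / (- \<i> * t) ^ h = \<i> ^ h"
  proof -
    have "t / (- \<i> * t) = \<i>" using t0 by (simp add: divide_simps)
    thus ?thesis by (simp flip: power_divide)
  qed
  finally show ?thesis by simp
qed

end

section \<open>Index vectors modulo l^2\<close>

locale odd_prime_gt_3 = odd_prime +
  assumes l_gt_3: "l > 3"
begin

lemma coprime_6: "coprime (int l) 6"
proof -
  have "\<not> int l dvd 3" using l_gt_3 zdvd_imp_le[of "int l" 3] by auto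
  hence "\<not> int l dvd 2 * 3" using not_dvd_2 prime_dvd_mult_iff[OF prime_int_l] by blast
  thus ?thesis using prime_imp_coprime[OF prime_int_l, of 6] by simp
qed

text \<open>\<open>sqsum_eq\<close> makes 6 * \<open>sqsum\<close> a multiple of l, and l > 3 allows
  the 6 to be removed.\<close>

lemma dvd_sqsum: "int l dvd sqsum"
proof -
  have "int l dvd 6 * sqsum" by (simp add: sqsum_eq)
  thus ?thesis using coprime_6 coprime_dvd_mult_right_iff by blast
qed

lemma ee_sqsum [simp]: "ee (of_int (a * sqsum) / of_nat l) = 1"
proof -
  obtain k where k: "sqsum = int l * k" using dvd_sqsum by blast
  have "of_int (a * sqsum) / of_nat l = (of_int (a * k) :: complex)"
    using l_pos by (simp add: k)
  thus ?thesis by (simp only: ee_of_int)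
qed

lemma dvd_24: "24 dvd l ^ 2 - 1"
proof -
  have "\<not> 3 dvd l"
  proof
    assume "3 dvd l"
    hence "3 = l" using prime_l by (auto simp: prime_nat_iff)
    thus False using l_gt_3 by simp
  qed
  hence "l mod 3 = 1 \<or> l mod 3 = 2" by presburger
  moreover have "l ^ 2 mod 3 = (l mod 3) ^ 2 mod 3" by (simp add: power_mod)
  ultimately have "l ^ 2 mod 3 = 1" by auto
  moreover have "3 dvd x - 1" if "x mod 3 = 1" for x :: nat using that by presburger
  ultimately have 3: "3 dvd l ^ 2 - 1" by blast
  have "even (h * (h + 1))" by simp
  then obtain k where k: "h * (h + 1) = 2 * k" by blast
  have "l ^ 2 - 1 = 4 * (h * (h + 1))" by (simp add: l_eq power2_eq_square algebra_simps)
  hence "l ^ 2 - 1 = 8 * k" by (simp only: k)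
  hence 8: "8 dvd l ^ 2 - 1" by simp
  have "coprime (3::nat) 8" by (intro prime_imp_coprime) auto
  hence "3 * 8 dvd l ^ 2 - 1" using 3 8 divides_mult by blast
  thus ?thesis by simp
qed

lemma torsion_prod_periodic: "Im t > 0 \<Longrightarrow> torsion_prod (x + int l * a) (y + int l * b) t = torsion_prod x y t"
  by (simp only: torsion_prod_shift ee_sqsum mult_1)

text \<open>The range of \<open>w\<close> is centred so that the roots of unity produced by a shift of \<open>x\<close> or \<open>y\<close> by \<open>l\<^sup>2\<close> cancel.\<close>

definition torsion_prod_sq :: "int \<Rightarrow> int \<Rightarrow> complex \<Rightarrow> complex" where
  "torsion_prod_sq x y t = (\<Prod>v\<in>{1..int h}. \<Prod>w\<in>{- int h..int h}.
     klein (of_int (2 * (v + int l * w) * x) / real (l ^ 2)) (of_int (2 * (v + int l * w) * y) / real (l ^ 2)) t)"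

lemma torsion_prod_sq_modular:
  assumes t: "Im t > 0" and det: "A * D - B * C = 1"
  shows "torsion_prod_sq x y ((of_int A * t + of_int B) / (of_int C * t + of_int D)) =
    torsion_prod_sq (x * A + y * C) (x * B + y * D) t / (of_int C * t + of_int D) ^ (h * l)"
proof -
  have "klein (of_int (2 * v * x) / real (l^2)) (of_int (2 * v * y) / real (l^2)) ((of_int A * t + of_int B) / (of_int C * t + of_int D)) =
     klein (of_int (2 * v * (x * A + y * C)) / real (l^2)) (of_int (2 * v * (x * B + y * D)) / real (l^2)) t / (of_int C * t + of_int D)" for v
    by (subst klein_modular[OF t det]) (simp add: add_divide_distrib algebra_simps)
  note K = this
  have "(\<Prod>v\<in>{1..int h}. \<Prod>w\<in>{- int h..int h}. of_int C * t + of_int D) = (of_int C * t + of_int D) ^ (h * l)"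
    by (simp add: nat_minus_half) (metis power_mult mult.commute)
  thus ?thesis unfolding torsion_prod_sq_def K prod_dividef by (simp only:)
qed

text \<open>The total exponent is the sum of (v + l w)^2. Centring w removes the mixed terms; l *
  \<open>sqsum\<close> and the multiple of l^2 that remain are both divisible by l^2.\<close>

lemma torsion_prod_sq_periodic:
  assumes t: "Im t > 0"
  shows "torsion_prod_sq (x + int (l ^ 2) * a) (y + int (l ^ 2) * b) t = torsion_prod_sq x y t"
proof -
  have l2: "l ^ 2 > 0" using l_pos by simp
  have "torsion_prod_sq (x + int (l ^ 2) * a) (y + int (l ^ 2) * b) t =
     (\<Prod>v\<in>{1..int h}. \<Prod>w\<in>{- int h..int h}. ee (of_int (2 * (v + int l * w) ^ 2 * (x * b - y * a)) / of_nat (l ^ 2))) * torsion_prod_sq x y t"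
    unfolding torsion_prod_sq_def klein_torsion_shift[OF t l2] prod.distrib ..
  also have "(\<Prod>v\<in>{1..int h}. \<Prod>w\<in>{- int h..int h}. ee (of_int (2 * (v + int l * w) ^ 2 * (x * b - y * a)) / of_nat (l ^ 2))) =
     ee (of_int (2 * (x * b - y * a) * (\<Sum>v\<in>{1..int h}. \<Sum>w\<in>{- int h..int h}. (v + int l * w) ^ 2)) / of_nat (l ^ 2))"
  proof -
    have "(\<Prod>w\<in>{- int h..int h}. ee (of_int (2 * (v + int l * w) ^ 2 * (x * b - y * a)) / of_nat (l ^ 2))) =
      ee (of_int (2 * (\<Sum>w\<in>{- int h..int h}. (v + int l * w) ^ 2) * (x * b - y * a)) / of_nat (l ^ 2))" for v
      by (subst prod_ee_of_int) (simp only: mult_ac)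
    thus ?thesis by (simp only: prod_ee_of_int)
  qed
  also have "(\<Sum>v\<in>{1..int h}. \<Sum>w\<in>{- int h..int h}. (v + int l * w) ^ 2) = int l * sqsum + int l ^ 2 * (int h * (\<Sum>w\<in>{- int h..int h}. w ^ 2))"
  proof -
    have "(\<Sum>w\<in>{- int h..int h}. (v + int l * w) ^ 2) = int l * v ^ 2 + int l ^ 2 * (\<Sum>w\<in>{- int h..int h}. w ^ 2)" for v
    proof -
      have "(\<Sum>w\<in>{- int h..int h}. (v + int l * w) ^ 2) =
        (\<Sum>w\<in>{- int h..int h}. v ^ 2) + 2 * v * int l * (\<Sum>w\<in>{- int h..int h}. w) + int l ^ 2 * (\<Sum>w\<in>{- int h..int h}. w ^ 2)"
        unfolding sum_distrib_left sum.distrib[symmetric] by (intro sum.cong refl) (simp add: power2_eq_square algebra_simps)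
      thus ?thesis unfolding sum_half_system using l_eq by simp
    qed
    thus ?thesis by (simp add: sum.distrib sqsum_def flip: sum_distrib_left)
  qed
  also have "ee (of_int (2 * (x * b - y * a) * (int l * sqsum + int l ^ 2 * (int h * (\<Sum>w\<in>{- int h..int h}. w ^ 2)))) / of_nat (l ^ 2)) = 1"
  proof -
    obtain k where k: "sqsum = int l * k" using dvd_sqsum by blast
    define S where "S = (\<Sum>w\<in>{- int h..int h}. w ^ 2)"
    have "of_int (2 * (x * b - y * a) * (int l * sqsum + int l ^ 2 * (int h * S))) / of_nat (l ^ 2) = (of_int (2 * (x * b - y * a) * (k + int h * S)) :: complex)"
      using l_pos by (simp add: k field_simps power2_eq_square)
    thus ?thesis by (simp only: S_def ee_of_int)
  qed
  finally show ?thesis by simp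
qed

text \<open>For the index (l x, y) the first coordinate 2 (v + l w) x / l changes with w only by
  even integers, while the second runs through translates by 2 w y / l. The product over w therefore
  collapses, by \<open>theta0_distribution\<close>, to one Klein form at l t.\<close>

lemma torsion_prod_sq_dvd:
  assumes t: "Im t > 0" and y: "\<not> int l dvd y"
  shows "torsion_prod_sq (int l * x) y t = torsion_prod x y (of_nat l * t) * (eta (of_nat l * t) / eta t ^ l) ^ (2 * h)"
proof -
  have lt: "Im (of_nat l * t) > 0" using t l_pos by simp
  define R where "R = eta (of_nat l * t) / eta t ^ l"
  have sq2: "(\<Sum>w\<in>{- int h..int h}. w ^ 2) = 2 * sqsum"
    by (subst sum_symmetric) (simp add: sqsum_def sum_distrib_left)
  have inner: "(\<Prod>w\<in>{- int h..int h}. klein (of_int (2 * (v + int l * w) * (int l * x)) / real (l ^ 2)) (of_int (2 * (v + int l * w) * y) / real (l ^ 2)) t) =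
     klein (of_int (2 * v * x) / real l) (of_int (2 * v * y) / real l) (of_nat l * t) * R ^ 2" for v
  proof -
    define a where "a = of_int (2 * v * x) / real l"
    define b where "b w = of_int (2 * (v + int l * w) * y) / real (l ^ 2)" for w
    have a': "of_int (2 * (v + int l * w) * (int l * x)) / real (l ^ 2) = a + of_int (2 * w * x)" for w
      using l_pos by (simp add: a_def field_simps power2_eq_square)
    have b': "complex_of_real (b w) = of_int (2 * v * y) / of_nat (l ^ 2) + of_int (2 * w * y) / of_nat l" for w
      using l_pos by (simp add: b_def field_simps power2_eq_square)
    have k: "klein (a + of_int (2 * w * x)) (b w) t = ee (- (of_real (b w) * of_int (w * x))) * klein a (b w) t" for w
    proof -
      have "(-1) powi (2 * w * x + 0) = (1 :: complex)"
        by (simp add: power_int_mult mult.assoc)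
      thus ?thesis
        using klein_shift[OF t, of a "2 * w * x" "b w" 0] by simp
    qed
    define z where "z = of_real a * t + of_int (2 * v * y) / of_nat (l ^ 2)"
    have kb: "klein a (b w) t = ee (of_real a * (z + of_int (2 * w * y) / of_nat l) / 2) * theta0 (z + of_int (2 * w * y) / of_nat l) t" for w
      unfolding klein_def b' z_def by (simp add: add.assoc)
    have "(\<Prod>w\<in>{- int h..int h}. klein (a + of_int (2 * w * x)) (b w) t) =
       ee (\<Sum>w\<in>{- int h..int h}. - (of_real (b w) * of_int (w * x))) *
       (ee (\<Sum>w\<in>{- int h..int h}. of_real a * (z + of_int (2 * w * y) / of_nat l) / 2) *
       (\<Prod>w\<in>{- int h..int h}. theta0 (z + of_int (2 * w * y) / of_nat l) t))"
      unfolding k kb prod.distrib ee_sum ..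
    \<comment> \<open>\<open>b w\<close> is linear in w, so the exponent has a linear part, which
      sums to 0, and a quadratic part, which is an integer multiple of \<open>sqsum\<close> /
      l.\<close>
    also have "(\<Sum>w\<in>{- int h..int h}. - (complex_of_real (b w) * of_int (w * x))) = of_int ((- 4 * y * x) * sqsum) / of_nat l"
    proof -
      have "(\<Sum>w\<in>{- int h..int h}. - (complex_of_real (b w) * of_int (w * x))) =
         (\<Sum>w\<in>{- int h..int h}. of_int w * (- of_int (2 * v * y * x) / of_nat (l ^ 2)) + of_int (w ^ 2) * (- of_int (2 * y * x) / of_nat l))"
        by (intro sum.cong refl) (simp add: b' field_simps power2_eq_square)
      also have "\<dots> = of_int (\<Sum>w\<in>{- int h..int h}. w) * (- of_int (2 * v * y * x) / of_nat (l ^ 2)) + of_int (\<Sum>w\<in>{- int h..int h}. w ^ 2) * (- of_int (2 * y * x) / of_nat l)"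
        unfolding of_int_sum sum_distrib_right sum.distrib ..
      also have "\<dots> = of_int ((- 4 * y * x) * sqsum) / of_nat l"
        unfolding sum_half_system sq2 by simp
      finally show ?thesis .
    qed
    also have "ee (of_int ((- 4 * y * x) * sqsum) / of_nat l) = 1"
      by (rule ee_sqsum)
    also have "(\<Sum>w\<in>{- int h..int h}. of_real a * (z + of_int (2 * w * y) / of_nat l) / 2) = of_real a * (of_nat l * z) / 2"
    proof -
      have "(\<Sum>w\<in>{- int h..int h}. of_real a * (z + of_int (2 * w * y) / of_nat l) / 2) =
        (\<Sum>w\<in>{- int h..int h}. of_real a * z / 2 + of_int w * (of_real a * of_int y / of_nat l))"
        by (intro sum.cong refl) (simp add: field_simps)
      also have "\<dots> = of_nat l * (of_real a * z / 2) + of_int (\<Sum>w\<in>{- int h..int h}. w) * (of_real a * of_int y / of_nat l)"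
        unfolding of_int_sum sum_distrib_right sum.distrib by (simp add: nat_minus_half)
      finally show ?thesis unfolding sum_half_system by simp
    qed
    also have "(\<Prod>w\<in>{- int h..int h}. theta0 (z + of_int (2 * w * y) / of_nat l) t) = theta0 (of_nat l * z) (of_nat l * t) * R ^ 2"
      unfolding R_def by (rule theta0_distribution[OF t y])
    also have "of_nat l * z = of_real a * (of_nat l * t) + of_real (of_int (2 * v * y) / real l)"
      using l_pos by (simp add: z_def field_simps power2_eq_square)
    finally show ?thesis
      unfolding a' b_def[symmetric] a_def[symmetric] by (simp add: klein_def)
  qed
  show ?thesis
    unfolding torsion_prod_sq_def inner prod.distrib torsion_prod_def R_def[symmetric] by (simp add: power_mult)
qed

text \<open>Up to constants, \<open>torsion_unit x y t\<close> runs through the quotients by \<open>eta t\<close> of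
  \<open>eta (l\<^sup>2 t)\<close>, \<open>eta (t + b / l)\<close> and \<open>eta ((t + b) / l\<^sup>2)\<close>, that is, through the summands of the Hecke operator
  \<open>T(l\<^sup>2)\<close>. With these constants \<open>torsion_unit_modular\<close> has no multiplier.\<close>

definition torsion_unit :: "int \<Rightarrow> int \<Rightarrow> complex \<Rightarrow> complex" where
  "torsion_unit x y t = torsion_prod x y t * torsion_prod_sq x y t * eta t ^ (l ^ 2 - 1)"

text \<open>The weights -h and -h l of the two products cancel against 12 k = h + h l, where l^2 - 1
  = 24 k; a power of eta^24 brings no multiplier.\<close>

theorem torsion_unit_modular:
  assumes t: "Im t > 0" and det: "A * D - B * C = 1"
  shows "torsion_unit x y ((of_int A * t + of_int B) / (of_int C * t + of_int D)) = torsion_unit (x * A + y * C) (x * B + y * D) t"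
proof -
  define j where "j = of_int C * t + of_int D"
  define t' where "t' = (of_int A * t + of_int B) / j"
  have j0: "j \<noteq> 0" using moebius_aux[OF t det] by (simp add: j_def)
  obtain k where k: "l ^ 2 - 1 = 24 * k" using dvd_24 by blast
  have "eta t' ^ (24 * k) = (j ^ 12) ^ k * eta t ^ (24 * k)"
    using eta24_modular[OF t det] unfolding power_mult by (simp add: t'_def j_def power_mult_distrib)
  moreover have "12 * k = h + h * l"
  proof -
    have "l ^ 2 - 1 = 2 * (h + h * l)" by (simp add: l_eq power2_eq_square algebra_simps)
    thus ?thesis using k by simp
  qed
  ultimately have e: "eta t' ^ (24 * k) = j ^ h * j ^ (h * l) * eta t ^ (24 * k)"
    by (simp flip: power_mult power_add)
  show ?thesis
    unfolding torsion_unit_def torsion_prod_modular[OF t det] torsion_prod_sq_modular[OF t det] k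
    using e j0 by (simp add: j_def t'_def)
qed

lemma torsion_unit_periodic:
  assumes t: "Im t > 0"
  shows "torsion_unit (x + int (l ^ 2) * a) (y + int (l ^ 2) * b) t = torsion_unit x y t"
proof -
  have "torsion_prod (x + int (l ^ 2) * a) (y + int (l ^ 2) * b) t = torsion_prod x y t"
    using torsion_prod_periodic[OF t, of x "int l * a" y "int l * b"] by (simp add: power2_eq_square mult.assoc)
  thus ?thesis by (simp only: torsion_unit_def torsion_prod_sq_periodic[OF t])
qed

lemma torsion_unit_cong:
  assumes "Im t > 0" "[x = x'] (mod int (l ^ 2))" "[y = y'] (mod int (l ^ 2))"
  shows "torsion_unit x y t = torsion_unit x' y' t"
proof -
  obtain a b where "x' = x + int (l ^ 2) * a" "y' = y + int (l ^ 2) * b"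
    using assms(2,3) by (metis cong_iff_lin)
  thus ?thesis using torsion_unit_periodic[OF assms(1)] by simp
qed

lemma torsion_unit_dvd:
  assumes t: "Im t > 0" and y: "\<not> int l dvd y"
  shows "torsion_unit (int l * x) y t = sinprod y * torsion_prod x y (of_nat l * t) * eta (of_nat l * t) ^ l / eta t"
proof -
  have 1: "torsion_prod (int l * x) y t = sinprod y * (eta (of_nat l * t) / eta t ^ l)"
    using torsion_prod_periodic[OF t, of 0 x y 0] torsion_prod_0[OF t y] by simp
  have e0: "eta t \<noteq> 0" by (rule eta_nonzero[OF t])
  have l2: "l ^ 2 = Suc (l ^ 2 - 1)" using l_pos by simp
  have "(eta (of_nat l * t) / eta t ^ l) * (eta (of_nat l * t) / eta t ^ l) ^ (2 * h) = (eta (of_nat l * t) / eta t ^ l) ^ l"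
    by (simp add: l_eq)
  also have "\<dots> = eta (of_nat l * t) ^ l / eta t ^ (l ^ 2)"
    by (simp add: power_divide power2_eq_square flip: power_mult)
  also have "\<dots> = eta (of_nat l * t) ^ l / (eta t * eta t ^ (l ^ 2 - 1))"
    by (subst l2) simp
  finally have R: "(eta (of_nat l * t) / eta t ^ l) * (eta (of_nat l * t) / eta t ^ l) ^ (2 * h) * eta t ^ (l ^ 2 - 1) = eta (of_nat l * t) ^ l / eta t"
    using e0 by simp
  have "torsion_unit (int l * x) y t = sinprod y * torsion_prod x y (of_nat l * t) *
     ((eta (of_nat l * t) / eta t ^ l) * (eta (of_nat l * t) / eta t ^ l) ^ (2 * h) * eta t ^ (l ^ 2 - 1))"
    unfolding torsion_unit_def 1 torsion_prod_sq_dvd[OF t y] by (simp add: mult_ac)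
  thus ?thesis unfolding R by simp
qed

text \<open>\<open>sinprod y\<close> arises once from level l and once from level l^2, so that only
  its square remains and y drops out.\<close>

lemma torsion_unit_0:
  assumes t: "Im t > 0" and y: "\<not> int l dvd y"
  shows "torsion_unit 0 y t = (- 1) ^ h * of_nat l * (eta (of_nat (l ^ 2) * t) / eta t)"
proof -
  have lt: "Im (of_nat l * t) > 0" using t l_pos by simp
  have "torsion_unit 0 y t = sinprod y ^ 2 * eta (of_nat l * (of_nat l * t)) / eta t"
    using torsion_unit_dvd[OF t y, of 0] eta_nonzero[OF lt] by (simp add: torsion_prod_0[OF lt y] power2_eq_square)
  thus ?thesis unfolding sinprod_square[OF y] by (simp add: power2_eq_square mult_ac)
qed

text \<open>A coprime pair is the bottom row of a matrix of determinant 1. This moves the index to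
  (0, m), where the value is independent of m by \<open>torsion_unit_0\<close>.\<close>

lemma torsion_unit_scale:
  assumes t: "Im t > 0" and "coprime x y" and m: "\<not> int l dvd m"
  shows "torsion_unit (m * x) (m * y) t = torsion_unit x y t"
proof -
  obtain A B where AB: "A * y - B * x = 1"
    using bezout_int[of x y] assms(2) by (metis add.commute coprime_iff_gcd_eq_1 diff_minus_eq_add mult_minus_left)
  define t' where "t' = (of_int A * t + of_int B) / (of_int x * t + of_int y)"
  have t': "Im t' > 0" using moebius_aux[OF t AB] by (simp add: t'_def)
  have 1: "\<not> int l dvd 1" using l_gt_2 by simp
  have "torsion_unit (m * x) (m * y) t = torsion_unit 0 m t'"
    using torsion_unit_modular[OF t AB, of 0 m] by (simp add: t'_def)
  also have "\<dots> = torsion_unit 0 1 t'" unfolding torsion_unit_0[OF t' m] torsion_unit_0[OF t' 1] ..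
  also have "\<dots> = torsion_unit x y t"
    using torsion_unit_modular[OF t AB, of 0 1] by (simp add: t'_def)
  finally show ?thesis .
qed

text \<open>(1, b) is the bottom row of a matrix taking t to -1/(t + b), so the value is that of the
  index (0, 1) there, rewritten by the inversion of eta.\<close>

lemma torsion_unit_1:
  assumes t: "Im t > 0"
  shows "torsion_unit 1 b t = (- 1) ^ h * (eta ((t + of_int b) / of_nat (l ^ 2)) / eta (t + of_int b))"
proof -
  define t' where "t' = t + of_int b"
  have t': "Im t' > 0" using t by (simp add: t'_def)
  have t'0: "t' \<noteq> 0" using t' by auto
  have t'': "Im (- 1 / t') > 0"
    using moebius_aux(2)[OF t', of 0 0 "-1" 1] by simp
  have 1: "\<not> int l dvd 1" using l_gt_2 by simp
  have l2: "l ^ 2 > 0" using l_pos by simp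
  have c: "csqrt (- \<i> * t') \<noteq> 0" using t'0 by simp
  have "torsion_unit 1 b t = torsion_unit 0 1 (- 1 / t')"
    using torsion_unit_modular[OF t, of 0 b "-1" 1 0 1] by (simp add: t'_def)
  also have "\<dots> = (- 1) ^ h * of_nat l * (eta (- of_nat (l ^ 2) / t') / eta (- 1 / t'))"
    unfolding torsion_unit_0[OF t'' 1] by simp
  also have "\<dots> = (- 1) ^ h * (eta (t' / of_nat (l ^ 2)) / eta t')"
    unfolding eta_minus_inverse_scaled[OF t' l2] eta_minus_inverse[OF t']
    using c l_pos by (simp add: real_sqrt_power)
  finally show ?thesis by (simp add: t'_def)
qed

text \<open>\<open>torsion_prod\<close> sees y modulo l only, so y may be replaced by 24 b x;
  translation by 24 b, a period of eta, then leads to the index (x, 0). One \<open>sinprod x\<close>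
  and one \<open>sinprod y\<close> combine to the Legendre symbol.\<close>

lemma torsion_unit_l:
  assumes t: "Im t > 0" and x: "\<not> int l dvd x" and y: "\<not> int l dvd y"
    and b: "[x * (24 * b) = y] (mod int l)"
  shows "torsion_unit (int l * x) y t = of_int (Legendre (x * y) (int l)) * (- \<i>) ^ h * of_real (sqrt (real l)) *
    (eta (t + of_int (24 * b) / of_nat l) / eta t)"
proof -
  have lt: "Im (of_nat l * t) > 0" using t l_pos by simp
  define t' where "t' = of_nat l * t + of_int (24 * b)"
  have t': "Im t' > 0" using lt by (simp add: t'_def)
  obtain k where k: "y = x * (24 * b) + int l * k"
    using b by (metis cong_iff_lin)
  have "torsion_prod x y (of_nat l * t) = torsion_prod x (x * (24 * b)) (of_nat l * t)"
    using torsion_prod_periodic[OF lt, of x 0 "x * (24 * b)" k] by (simp add: k)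
  also have "\<dots> = torsion_prod x 0 t'"
    using torsion_prod_modular[OF lt, of 1 1 "24 * b" 0 x 0] by (simp add: t'_def)
  also have "\<dots> = sinprod x * \<i> ^ h / of_real (sqrt (real l)) * (eta (t' / of_nat l) / eta t' ^ l)"
    by (rule torsion_prod_x_0[OF t' x])
  also have "t' / of_nat l = t + of_int (24 * b) / of_nat l"
    using l_pos by (simp add: t'_def add_divide_distrib)
  also have "eta t' = eta (of_nat l * t)"
    using eta_add_24[of "of_nat l * t" b] by (simp add: t'_def)
  finally have torsion_prod: "torsion_prod x y (of_nat l * t) = sinprod x * \<i> ^ h / of_real (sqrt (real l)) *
    (eta (t + of_int (24 * b) / of_nat l) / eta (of_nat l * t) ^ l)" .
  have "torsion_unit (int l * x) y t = (sinprod x * sinprod y) * \<i> ^ h / of_real (sqrt (real l)) * (eta (t + of_int (24 * b) / of_nat l) / eta t)"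
    unfolding torsion_unit_dvd[OF t y] torsion_prod using eta_nonzero[OF lt] by simp
  also have "sinprod x * sinprod y = of_int (Legendre (x * y) (int l)) * ((- 1) ^ h * of_nat l)"
  proof -
    have 1: "\<not> int l dvd 1" using l_gt_2 by simp
    have "sinprod x * sinprod y = of_int (Legendre (x * y) (int l)) * sinprod 1 ^ 2"
      unfolding sinprod_Legendre[OF x] sinprod_Legendre[OF y] Legendre_mult[OF prime_l l_gt_2]
      by (simp add: power2_eq_square)
    thus ?thesis by (simp only: sinprod_square[OF 1])
  qed
  also have "of_int (Legendre (x * y) (int l)) * ((- 1) ^ h * of_nat l) * \<i> ^ h / of_real (sqrt (real l)) =
     of_int (Legendre (x * y) (int l)) * (- \<i>) ^ h * (of_real (sqrt (real l)) :: complex)"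
  proof -
    have "(of_nat l :: complex) = of_real (sqrt (real l)) * of_real (sqrt (real l))"
      by (metis of_nat_0_le_iff of_real_mult of_real_of_nat_eq real_sqrt_mult_self abs_of_nonneg)
    thus ?thesis using l_pos by (simp add: power_minus[of "\<i>"])
  qed
  finally show ?thesis .
qed

lemma coprime_24: "\<not> int l dvd 24"
proof
  assume "int l dvd 24"
  hence "int l dvd 6 * (2 * 2)" by simp
  moreover have "\<not> int l dvd 6"
  proof
    assume "int l dvd 6"
    hence "int l dvd 1" using coprime_common_divisor[OF coprime_6, of "int l"] by simp
    thus False using l_gt_2 by simp
  qed
  ultimately show False
    using not_dvd_2 prime_dvd_mult_iff[OF prime_int_l] by metis
qed

lemma coprime_square: "\<not> int l dvd x \<Longrightarrow> coprime x (int (l ^ 2))"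
  using coprime_iff by simp

lemma solve_mod_square:
  assumes "\<not> int l dvd x"
  obtains z where "[x * z = y] (mod int (l ^ 2))"
proof -
  obtain w where "[x * w = 1] (mod int (l ^ 2))"
    using cong_solve_coprime_int[OF coprime_square[OF assms]] by blast
  hence "[x * w * y = 1 * y] (mod int (l ^ 2))" by (rule cong_scalar_right)
  thus ?thesis using that[of "w * y"] by (simp add: mult.assoc)
qed

lemma torsion_unit_unit_left:
  assumes t: "Im t > 0" and x: "\<not> int l dvd x" and z: "[x * z = y] (mod int (l ^ 2))"
  shows "torsion_unit x y t = torsion_unit 1 z t"
  using torsion_unit_scale[OF t _ x, of 1 z] torsion_unit_cong[OF t _ z, of x x] by simp

lemma torsion_unit_unit_right:
  assumes t: "Im t > 0" and y: "\<not> int l dvd y" and z: "[y * z = x] (mod int (l ^ 2))"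
  shows "torsion_unit x y t = torsion_unit z 1 t"
  using torsion_unit_scale[OF t _ y, of z 1] torsion_unit_cong[OF t z, of y y] by simp

text \<open>Coprimality of x and y is relaxed to primitivity modulo l: modulo l^2 such an index is a
  unit multiple of some (1, z) or (z, 1), and these are coprime pairs.\<close>

lemma torsion_unit_scale':
  assumes t: "Im t > 0" and xy: "\<not> (int l dvd x \<and> int l dvd y)" and m: "\<not> int l dvd m"
  shows "torsion_unit (m * x) (m * y) t = torsion_unit x y t"
proof (cases "int l dvd x")
  case False
  obtain z where z: "[x * z = y] (mod int (l ^ 2))" using solve_mod_square[OF False] .
  have "\<not> int l dvd m * x" using False m prime_dvd_mult_iff[OF prime_int_l] by blast
  moreover have "[m * x * z = m * y] (mod int (l ^ 2))"
    using cong_scalar_left[OF z, of m] by (simp add: mult.assoc)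
  ultimately show ?thesis
    using torsion_unit_unit_left[OF t _ z] torsion_unit_unit_left[OF t, of "m * x" z "m * y"] False by simp
next
  case True
  hence y: "\<not> int l dvd y" using xy by simp
  obtain z where z: "[y * z = x] (mod int (l ^ 2))" using solve_mod_square[OF y] .
  have "\<not> int l dvd m * y" using y m prime_dvd_mult_iff[OF prime_int_l] by blast
  moreover have "[m * y * z = m * x] (mod int (l ^ 2))"
    using cong_scalar_left[OF z, of m] by (simp add: mult.assoc)
  ultimately show ?thesis
    using torsion_unit_unit_right[OF t _ z] torsion_unit_unit_right[OF t, of "m * y" z "m * x"] y by simp
qed

end

section \<open>The Hecke sum\<close>

locale hecke = odd_prime_gt_3 +
  fixes p :: nat and r s :: int
  assumes p_pos: "p > 0" and p_ndvd: "\<not> l dvd p" and odd_rs: "odd (r + s)"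
begin

text \<open>The shifts below are multiples of 24, which makes them periods of \<open>eta\<close>. As \<open>l\<close> is prime to 24, they still represent
  all residues modulo \<open>l\<close> and \<open>l\<^sup>2\<close>.\<close>

definition etaq :: "complex \<Rightarrow> complex" where
  "etaq t = eta t powi s * eta (of_nat p * t) powi r"

text \<open>The index (x, p y) in the second factor keeps both factors in step: a matrix of
  Gamma_0(p) acts on p t through (A, p B; C / p, D), and the new index again has the form (x', p y')
  with the same x', y'.\<close>

definition term_at :: "int \<Rightarrow> int \<Rightarrow> complex \<Rightarrow> complex" where
  "term_at x y t = torsion_unit x y t powi s * torsion_unit x (int p * y) (of_nat p * t) powi r"

text \<open>The l^2 + l indices represent the primitive vectors modulo l^2 up to units, that is, the
  projective line over Z / l^2.\<close>

definition hecke_sum :: "complex \<Rightarrow> complex" where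
  "hecke_sum t = (\<Sum>b\<in>{0..<int (l ^ 2)}. term_at 1 (24 * b) t) + term_at 0 1 t
     + (\<Sum>b\<in>{1..<int l}. term_at (int l) (24 * b) t)"

lemma Im_p: "Im t > 0 \<Longrightarrow> Im (of_nat p * t) > 0"
  using p_pos by simp

lemma ndvd_p: "\<not> int l dvd int p * y \<longleftrightarrow> \<not> int l dvd y"
  using p_ndvd prime_dvd_mult_iff[OF prime_int_l] by simp

lemma term_at_cong:
  assumes t: "Im t > 0" and "[x = x'] (mod int (l ^ 2))" "[y = y'] (mod int (l ^ 2))"
  shows "term_at x y t = term_at x' y' t"
proof -
  have "[int p * y = int p * y'] (mod int (l ^ 2))" using assms(3) by (rule cong_scalar_left)
  thus ?thesis
    unfolding term_at_def using torsion_unit_cong[OF t assms(2,3)] torsion_unit_cong[OF Im_p[OF t] assms(2)] by simp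
qed

lemma term_at_scale:
  assumes t: "Im t > 0" and xy: "\<not> (int l dvd x \<and> int l dvd y)" and m: "\<not> int l dvd m"
  shows "term_at (m * x) (m * y) t = term_at x y t"
proof -
  have "torsion_unit (m * x) (int p * (m * y)) (of_nat p * t) = torsion_unit x (int p * y) (of_nat p * t)"
    using torsion_unit_scale'[OF Im_p[OF t] _ m, of x "int p * y"] xy ndvd_p[of y] by (simp add: mult.left_commute)
  thus ?thesis unfolding term_at_def by (simp only: torsion_unit_scale'[OF t xy m])
qed

lemma term_at_modular:
  assumes t: "Im t > 0" and det: "A * D - B * C = 1" and C: "int p dvd C"
  shows "term_at x y ((of_int A * t + of_int B) / (of_int C * t + of_int D)) = term_at (x * A + y * C) (x * B + y * D) t"
proof -
  obtain C' where C': "C = int p * C'" using C by blast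
  define t' where "t' = (of_int A * t + of_int B) / (of_int C * t + of_int D)"
  have det': "A * D - (int p * B) * C' = 1" using det by (simp add: C' mult_ac)
  have "of_nat p * t' = (of_int A * (of_nat p * t) + of_int (int p * B)) / (of_int C' * (of_nat p * t) + of_int D)"
    by (simp add: t'_def C' algebra_simps)
  hence "torsion_unit x (int p * y) (of_nat p * t') = torsion_unit (x * A + int p * y * C') (x * (int p * B) + int p * y * D) (of_nat p * t)"
    by (simp only: torsion_unit_modular[OF Im_p[OF t] det'])
  also have "x * A + int p * y * C' = x * A + y * C" by (simp add: C')
  also have "x * (int p * B) + int p * y * D = int p * (x * B + y * D)" by (simp add: algebra_simps)
  finally show ?thesis
    unfolding term_at_def t'_def[symmetric] using torsion_unit_modular[OF t det, of x y] by (simp add: t'_def)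
qed

text \<open>Matrices permute the set of all primitive vectors, so no representatives have to be
  tracked. A class under units has l (l - 1) members, whence the factor in
  \<open>sum_prim_pairs_eq\<close>.\<close>

definition prim_pairs :: "(int \<times> int) set" where
  "prim_pairs = {(x, y). x \<in> {0..<int (l ^ 2)} \<and> y \<in> {0..<int (l ^ 2)} \<and> \<not> (int l dvd x \<and> int l dvd y)}"

lemma finite_prim_pairs: "finite prim_pairs"
  by (rule finite_subset[of _ "{0..<int (l ^ 2)} \<times> {0..<int (l ^ 2)}"]) (auto simp: prim_pairs_def)

lemma l_dvd_mod_square: "int l dvd x mod int (l ^ 2) \<longleftrightarrow> int l dvd x"
  by (rule dvd_mod_iff) (simp add: power2_eq_square)

lemma sum_prim_pairs_modular:
  assumes t: "Im t > 0" and det: "A * D - B * C = 1" and C: "int p dvd C"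
  shows "(\<Sum>(x, y)\<in>prim_pairs. term_at x y ((of_int A * t + of_int B) / (of_int C * t + of_int D))) =
    (\<Sum>(x, y)\<in>prim_pairs. term_at x y t)"
proof -
  define N where "N = int (l ^ 2)"
  have N: "N > 0" using l_pos by (simp add: N_def)
  have dvdN: "int l dvd x mod N \<longleftrightarrow> int l dvd x" for x using l_dvd_mod_square by (simp add: N_def)
  define g where "g = (\<lambda>(x, y). ((x * A + y * C) mod N, (x * B + y * D) mod N))"
  have inv: "x = D * (x * A + y * C) - C * (x * B + y * D)" "y = A * (x * B + y * D) - B * (x * A + y * C)" for x y
  proof -
    have "D * (x * A + y * C) - C * (x * B + y * D) = x * (A * D - B * C)" by (simp add: algebra_simps)
    thus "x = D * (x * A + y * C) - C * (x * B + y * D)" using det by simp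
    have "A * (x * B + y * D) - B * (x * A + y * C) = y * (A * D - B * C)" by (simp add: algebra_simps)
    thus "y = A * (x * B + y * D) - B * (x * A + y * C)" using det by simp
  qed
  have mem: "g z \<in> prim_pairs" if "z \<in> prim_pairs" for z
  proof -
    obtain x y where z: "z = (x, y)" by force
    have "\<not> (int l dvd x * A + y * C \<and> int l dvd x * B + y * D)"
    proof
      assume d: "int l dvd x * A + y * C \<and> int l dvd x * B + y * D"
      have "int l dvd D * (x * A + y * C) - C * (x * B + y * D)" "int l dvd A * (x * B + y * D) - B * (x * A + y * C)"
        by (intro dvd_diff dvd_mult; use d in blast)+
      hence "int l dvd x" "int l dvd y" by (simp_all only: inv[symmetric])
      thus False using that z by (auto simp: prim_pairs_def)
    qed
    thus ?thesis using N unfolding z g_def prim_pairs_def N_def[symmetric] by (simp add: dvdN)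
  qed
  have inj: "inj_on g prim_pairs"
  proof (rule inj_onI, clarify)
    fix x y x' y' assume xy: "(x, y) \<in> prim_pairs" "(x', y') \<in> prim_pairs" "g (x, y) = g (x', y')"
    hence c: "[x * A + y * C = x' * A + y' * C] (mod N)" "[x * B + y * D = x' * B + y' * D] (mod N)"
      by (auto simp: g_def cong_def)
    have "[D * (x * A + y * C) - C * (x * B + y * D) = D * (x' * A + y' * C) - C * (x' * B + y' * D)] (mod N)"
      "[A * (x * B + y * D) - B * (x * A + y * C) = A * (x' * B + y' * D) - B * (x' * A + y' * C)] (mod N)"
      by (intro cong_diff cong_scalar_left c)+
    hence "[x = x'] (mod N)" "[y = y'] (mod N)"
      by (simp_all only: inv[symmetric])
    thus "x = x' \<and> y = y'" using xy by (auto simp: prim_pairs_def cong_def N_def)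
  qed
  have "bij_betw g prim_pairs prim_pairs"
    using inj mem by (metis bij_betw_def endo_inj_surj finite_prim_pairs image_subsetI)
  hence "(\<Sum>z\<in>prim_pairs. (case z of (x, y) \<Rightarrow> term_at x y t)) = (\<Sum>z\<in>prim_pairs. (case g z of (x, y) \<Rightarrow> term_at x y t))"
    by (rule sum.reindex_bij_betw[symmetric])
  also have "\<dots> = (\<Sum>(x, y)\<in>prim_pairs. term_at x y ((of_int A * t + of_int B) / (of_int C * t + of_int D)))"
  proof (intro sum.cong refl, clarify)
    fix x y
    show "(case g (x, y) of (x, y) \<Rightarrow> term_at x y t) = term_at x y ((of_int A * t + of_int B) / (of_int C * t + of_int D))"
      unfolding term_at_modular[OF t det C] g_def prod.case by (rule term_at_cong[OF t]) (simp_all add: N_def)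
  qed
  finally show ?thesis by simp
qed

lemma card_units: "card {x \<in> {0..<int (l ^ 2)}. \<not> int l dvd x} = l * (l - 1)"
  and multiples: "{x \<in> {0..<int (l ^ 2)}. int l dvd x} = (\<lambda>x. int l * x) ` {0..<int l}"
proof -
  show *: "{x \<in> {0..<int (l ^ 2)}. int l dvd x} = (\<lambda>x. int l * x) ` {0..<int l}"
  proof (intro equalityI subsetI)
    fix x assume x: "x \<in> {x \<in> {0..<int (l ^ 2)}. int l dvd x}"
    then obtain k where k: "x = int l * k" by blast
    have "int l * 0 \<le> int l * k" "int l * k < int l * int l"
      using x by (simp_all add: k power2_eq_square)
    hence "k \<in> {0..<int l}"
      using l_pos by (simp add: zero_le_mult_iff mult_less_cancel_left)
    thus "x \<in> (\<lambda>x. int l * x) ` {0..<int l}" using k by blast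
  next
    fix x assume "x \<in> (\<lambda>x. int l * x) ` {0..<int l}"
    then obtain k where k: "x = int l * k" "0 \<le> k" "k < int l" by auto
    have "int l * k < int l * int l" using k l_pos by (intro mult_strict_left_mono) auto
    thus "x \<in> {x \<in> {0..<int (l ^ 2)}. int l dvd x}" using k by (simp add: power2_eq_square)
  qed
  have inj: "inj_on (\<lambda>x. int l * x) {0..<int l}"
    using l_pos by (intro inj_onI) simp
  define M where "M = (\<lambda>x. int l * x) ` {0..<int l}"
  have M: "M \<subseteq> {0..<int (l ^ 2)}" "finite M" "card M = l"
    using * card_image[OF inj] by (auto simp: M_def)
  have "{x \<in> {0..<int (l ^ 2)}. \<not> int l dvd x} = {0..<int (l ^ 2)} - M"
    unfolding M_def *[symmetric] by blast
  hence "card {x \<in> {0..<int (l ^ 2)}. \<not> int l dvd x} = card {0..<int (l ^ 2)} - l"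
    by (simp only: card_Diff_subset[OF M(2,1)] M(3))
  also have "\<dots> = l * l - l * 1"
    by (simp add: power2_eq_square nat_mult_distrib)
  also have "\<dots> = l * (l - 1)"
    by (simp only: diff_mult_distrib2)
  finally show "card {x \<in> {0..<int (l ^ 2)}. \<not> int l dvd x} = l * (l - 1)" .
qed

lemma sum_term_at_left:
  assumes t: "Im t > 0" and x: "\<not> int l dvd x"
  shows "(\<Sum>y\<in>{0..<int (l ^ 2)}. term_at x y t) = (\<Sum>b\<in>{0..<int (l ^ 2)}. term_at 1 (24 * b) t)"
proof -
  have "(\<Sum>y\<in>{0..<int (l ^ 2)}. term_at x y t) = (\<Sum>b\<in>{0..<int (l ^ 2)}. term_at x (x * (24 * b)) t)"
  proof (rule sum_residues[symmetric])
    fix i j assume ij: "i \<in> {0..<int (l ^ 2)}" "j \<in> {0..<int (l ^ 2)}" "[x * (24 * i) = x * (24 * j)] (mod int (l ^ 2))"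
    have "[i = j] (mod int (l ^ 2))"
      using ij(3) cong_mult_lcancel[OF coprime_square[OF x]] cong_mult_lcancel[OF coprime_square[OF coprime_24]] by simp
    thus "i = j" using ij by (simp add: cong_def)
  next
    fix k show "term_at x (k mod int (l ^ 2)) t = term_at x k t"
      by (rule term_at_cong[OF t]) auto
  qed (use l_pos in \<open>auto simp: nat_power_eq\<close>)
  also have "\<dots> = (\<Sum>b\<in>{0..<int (l ^ 2)}. term_at 1 (24 * b) t)"
  proof (intro sum.cong refl)
    fix b
    have "\<not> int l dvd 1" using l_gt_2 by simp
    thus "term_at x (x * (24 * b)) t = term_at 1 (24 * b) t"
      using term_at_scale[OF t _ x, of 1 "24 * b"] by simp
  qed
  finally show ?thesis .
qed

lemma sum_term_at_right:
  assumes t: "Im t > 0" and y: "\<not> int l dvd y"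
  shows "(\<Sum>x\<in>{0..<int l}. term_at (int l * x) y t) = (\<Sum>x\<in>{0..<int l}. term_at (int l * x) 1 t)"
proof -
  have "(\<Sum>x\<in>{0..<int l}. term_at (int l * x) y t) = (\<Sum>x\<in>{0..<int l}. term_at (int l * (y * x)) y t)"
  proof (rule sum_residues[symmetric, where f = "\<lambda>x. term_at (int l * x) y t"])
    fix i j assume ij: "i \<in> {0..<int l}" "j \<in> {0..<int l}" "[y * i = y * j] (mod int l)"
    have "[i = j] (mod int l)"
      using ij(3) cong_mult_lcancel y coprime_iff by blast
    thus "i = j" using ij by (simp add: cong_def)
  next
    fix k
    have "[k mod int l = k] (mod int l)" by simp
    hence "[int l * (k mod int l) = int l * k] (mod int (l ^ 2))"
      by (simp add: power2_eq_square cong_cmult_leftI)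
    thus "term_at (int l * (k mod int l)) y t = term_at (int l * k) y t"
      by (intro term_at_cong[OF t]) auto
  qed (use l_pos in auto)
  also have "\<dots> = (\<Sum>x\<in>{0..<int l}. term_at (int l * x) 1 t)"
  proof (intro sum.cong refl)
    fix x
    have "\<not> int l dvd 1" using l_gt_2 by simp
    thus "term_at (int l * (y * x)) y t = term_at (int l * x) 1 t"
      using term_at_scale[OF t _ y, of "int l * x" 1] by (simp add: mult.left_commute)
  qed
  finally show ?thesis .
qed

text \<open>Multiplying the index (l x, 1) by 24 b with 24 b x = 1 modulo l gives (l, 24 b) modulo
  l^2.\<close>

lemma sum_term_at_inverse:
  assumes t: "Im t > 0"
  shows "(\<Sum>x\<in>{1..<int l}. term_at (int l * x) 1 t) = (\<Sum>b\<in>{1..<int l}. term_at (int l) (24 * b) t)"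
proof -
  have nd: "\<not> int l dvd x" if "x \<in> {1..<int l}" for x using that by (intro zdvd_not_zless) auto
  have "\<exists>z \<in> {1..<int l}. [24 * x * z = 1] (mod int l)" if "x \<in> {1..<int l}" for x
  proof -
    have "\<not> int l dvd 24 * x" using nd[OF that] coprime_24 prime_dvd_mult_iff[OF prime_int_l] by blast
    then obtain z where z: "[24 * x * z = 1] (mod int l)"
      using cong_solve_coprime_int coprime_iff by blast
    have "[24 * x * (z mod int l) = 24 * x * z] (mod int l)"
      by (intro cong_scalar_left) simp
    with z have z': "[24 * x * (z mod int l) = 1] (mod int l)" by (meson cong_trans)
    have "z mod int l \<noteq> 0"
    proof
      assume "z mod int l = 0"
      with z' have "int l dvd 1" by (simp add: cong_0_iff cong_sym_eq[of 0])
      thus False using l_gt_2 by simp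
    qed
    moreover have "0 \<le> z mod int l" "z mod int l < int l" using l_pos by auto
    ultimately show ?thesis using z' by (intro bexI[of _ "z mod int l"]) auto
  qed
  then obtain iv where iv: "\<And>x. x \<in> {1..<int l} \<Longrightarrow> iv x \<in> {1..<int l} \<and> [24 * x * iv x = 1] (mod int l)"
    by metis
  have iv_iv: "iv (iv x) = x" if x: "x \<in> {1..<int l}" for x
  proof -
    have "[24 * iv x * iv (iv x) = 24 * iv x * x] (mod int l)"
      using iv[OF x] iv[of "iv x"] by (metis cong_sym cong_trans mult.assoc mult.commute)
    moreover have "\<not> int l dvd 24 * iv x" using nd[of "iv x"] iv[OF x] coprime_24 prime_dvd_mult_iff[OF prime_int_l] by blast
    ultimately have "[iv (iv x) = x] (mod int l)" using cong_mult_lcancel coprime_iff by blast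
    thus ?thesis using iv[of "iv x"] iv[OF x] x by (simp add: cong_def)
  qed
  show ?thesis
  proof (rule sum.reindex_bij_witness[of _ iv iv])
    fix x assume x: "x \<in> {1..<int l}"
    have nd24: "\<not> int l dvd 24 * iv x" using nd[of "iv x"] iv[OF x] coprime_24 prime_dvd_mult_iff[OF prime_int_l] by blast
    have "[24 * iv x * x = 1] (mod int l)" using iv[OF x] by (simp add: mult_ac)
    hence "[int l * (24 * iv x * x) = int l * 1] (mod (int l * int l))" by (rule cong_cmult_leftI)
    hence "[24 * iv x * (int l * x) = int l] (mod int (l ^ 2))"
      by (simp add: power2_eq_square mult_ac)
    hence "term_at (24 * iv x * (int l * x)) (24 * iv x * 1) t = term_at (int l) (24 * iv x) t"
      by (intro term_at_cong[OF t]) auto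
    moreover have "\<not> int l dvd 1" using l_gt_2 by simp
    ultimately show "term_at (int l) (24 * iv x) t = term_at (int l * x) 1 t"
      using term_at_scale[OF t _ nd24, of "int l * x" 1] by simp
  qed (use iv iv_iv in auto)
qed

text \<open>Split by whether l divides x; if it does, y is a unit. In each part the inner sum does
  not depend on the unit coordinate, which is summed outside.\<close>

lemma sum_prim_pairs_eq:
  assumes t: "Im t > 0"
  shows "(\<Sum>(x, y)\<in>prim_pairs. term_at x y t) = of_nat (l * (l - 1)) * hecke_sum t"
proof -
  define N where "N = int (l ^ 2)"
  define U where "U = {x \<in> {0..<N}. \<not> int l dvd x}"
  define M where "M = {x \<in> {0..<N}. int l dvd x}"
  have fin: "finite U" "finite M"
    by (rule finite_subset[of _ "{0..<N}"]; auto simp: U_def M_def)+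
  have split: "prim_pairs = U \<times> {0..<N} \<union> M \<times> U"
    by (auto simp: prim_pairs_def U_def M_def N_def)
  have "(\<Sum>(x, y)\<in>prim_pairs. term_at x y t) = (\<Sum>(x, y)\<in>U \<times> {0..<N}. term_at x y t) + (\<Sum>(x, y)\<in>M \<times> U. term_at x y t)"
    unfolding split by (rule sum.union_disjoint) (use fin in \<open>auto simp: U_def M_def\<close>)
  also have "(\<Sum>(x, y)\<in>U \<times> {0..<N}. term_at x y t) = (\<Sum>x\<in>U. \<Sum>y\<in>{0..<N}. term_at x y t)"
    by (rule sum.cartesian_product[symmetric])
  also have "\<dots> = (\<Sum>x\<in>U. \<Sum>b\<in>{0..<N}. term_at 1 (24 * b) t)"
    unfolding N_def by (intro sum.cong refl sum_term_at_left t) (simp add: U_def)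
  also have "\<dots> = of_nat (l * (l - 1)) * (\<Sum>b\<in>{0..<N}. term_at 1 (24 * b) t)"
    using card_units by (simp add: U_def N_def)
  also have "(\<Sum>(x, y)\<in>M \<times> U. term_at x y t) = (\<Sum>y\<in>U. \<Sum>x\<in>M. term_at x y t)"
    by (subst sum.swap) (rule sum.cartesian_product[symmetric])
  also have "\<dots> = (\<Sum>y\<in>U. \<Sum>x\<in>{0..<int l}. term_at (int l * x) y t)"
  proof -
    have "(\<Sum>x\<in>M. g x) = (\<Sum>x\<in>{0..<int l}. g (int l * x))" for g :: "int \<Rightarrow> complex"
      unfolding M_def N_def multiples by (subst sum.reindex) (use l_pos in \<open>auto simp: inj_on_def\<close>)
    thus ?thesis by (simp only:)
  qed
  also have "\<dots> = (\<Sum>y\<in>U. \<Sum>x\<in>{0..<int l}. term_at (int l * x) 1 t)"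
    by (intro sum.cong refl sum_term_at_right t) (simp add: U_def)
  also have "\<dots> = of_nat (l * (l - 1)) * (\<Sum>x\<in>{0..<int l}. term_at (int l * x) 1 t)"
    using card_units by (simp add: U_def N_def)
  also have "{0..<int l} = insert 0 {1..<int l}" using l_pos by auto
  also have "(\<Sum>x\<in>insert 0 {1..<int l}. term_at (int l * x) 1 t) = term_at 0 1 t + (\<Sum>b\<in>{1..<int l}. term_at (int l) (24 * b) t)"
    by (simp add: sum_term_at_inverse[OF t])
  finally show ?thesis
    by (simp add: hecke_sum_def N_def distrib_left add.assoc)
qed

theorem hecke_sum_modular:
  assumes t: "Im t > 0" and det: "A * D - B * C = 1" and C: "int p dvd C"
  shows "hecke_sum ((of_int A * t + of_int B) / (of_int C * t + of_int D)) = hecke_sum t"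
proof -
  have "of_nat (l * (l - 1)) * hecke_sum ((of_int A * t + of_int B) / (of_int C * t + of_int D)) = of_nat (l * (l - 1)) * hecke_sum t"
    using sum_prim_pairs_modular[OF assms] sum_prim_pairs_eq[OF t] sum_prim_pairs_eq[OF moebius_aux(2)[OF t det]] by simp
  thus ?thesis using l_gt_3 by simp
qed

lemma etaq_nonzero: "Im t > 0 \<Longrightarrow> etaq t \<noteq> 0"
  using eta_nonzero[OF Im_p] eta_nonzero by (simp add: etaq_def)

text \<open>The opposite parity of r and s enters here: signs are not lost when the powers s and r
  are combined.\<close>

lemma powi_odd_sign: "c * c = 1 \<Longrightarrow> c powi (r + s) = (c :: complex)"
proof -
  assume c: "c * c = 1"
  have "c = 1 \<or> c = -1" using c by (simp add: square_eq_1_iff)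
  thus ?thesis using odd_rs by auto
qed

definition sgn_h :: complex where "sgn_h = (- 1) ^ h"

lemma sgn_h_sq: "sgn_h * sgn_h = 1"
  by (simp add: sgn_h_def flip: power_mult_distrib)

lemma term_at_combine:
  assumes "torsion_unit x y t = c1 * (eta u / eta t)" "torsion_unit x (int p * y) (of_nat p * t) = c2 * (eta (of_nat p * u) / eta (of_nat p * t))"
  shows "term_at x y t = c1 powi s * c2 powi r * (etaq u / etaq t)"
  unfolding term_at_def assms etaq_def by (simp add: power_int_mult_distrib power_int_divide_distrib)

lemma term_at_1:
  assumes t: "Im t > 0"
  shows "term_at 1 (24 * b) t = sgn_h * (etaq ((t + of_int (24 * b)) / of_nat (l ^ 2)) / etaq t)"
proof -
  have "torsion_unit 1 (24 * b) t = sgn_h * (eta ((t + of_int (24 * b)) / of_nat (l ^ 2)) / eta t)"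
    using torsion_unit_1[OF t, of "24 * b"] eta_add_24[of t b] by (simp add: sgn_h_def)
  moreover have "torsion_unit 1 (int p * (24 * b)) (of_nat p * t) = sgn_h * (eta (of_nat p * ((t + of_int (24 * b)) / of_nat (l ^ 2))) / eta (of_nat p * t))"
  proof -
    have 1: "of_nat p * t + of_int (int p * (24 * b)) = of_nat p * (t + of_int (24 * b))"
      by (simp add: algebra_simps)
    have 2: "of_nat p * t + of_int (int p * (24 * b)) = of_nat p * t + 24 * of_int (int p * b)"
      by simp
    have 3: "eta (of_nat p * t + of_int (int p * (24 * b))) = eta (of_nat p * t)"
      unfolding 2 by (rule eta_add_24)
    show ?thesis
      unfolding torsion_unit_1[OF Im_p[OF t]] 3 unfolding 1 sgn_h_def by simp
  qed
  ultimately have "term_at 1 (24 * b) t = sgn_h powi s * sgn_h powi r * (etaq ((t + of_int (24 * b)) / of_nat (l ^ 2)) / etaq t)"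
    by (rule term_at_combine)
  moreover have "sgn_h \<noteq> 0" by (simp add: sgn_h_def)
  ultimately show ?thesis
    using powi_odd_sign[OF sgn_h_sq] by (simp add: power_int_add mult.commute)
qed

lemma term_at_0:
  assumes t: "Im t > 0"
  shows "term_at 0 1 t = sgn_h * of_nat l powi (r + s) * (etaq (of_nat (l ^ 2) * t) / etaq t)"
proof -
  have 1: "\<not> int l dvd 1" using l_gt_2 by simp
  have p: "\<not> int l dvd int p * 1" using ndvd_p[of 1] 1 by simp
  have "torsion_unit 0 1 t = (sgn_h * of_nat l) * (eta (of_nat (l ^ 2) * t) / eta t)"
    using torsion_unit_0[OF t 1] by (simp add: sgn_h_def)
  moreover have "torsion_unit 0 (int p * 1) (of_nat p * t) = (sgn_h * of_nat l) * (eta (of_nat p * (of_nat (l ^ 2) * t)) / eta (of_nat p * t))"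
    using torsion_unit_0[OF Im_p[OF t] p] by (simp add: sgn_h_def mult.left_commute)
  ultimately have "term_at 0 1 t = (sgn_h * of_nat l) powi s * (sgn_h * of_nat l) powi r * (etaq (of_nat (l ^ 2) * t) / etaq t)"
    by (rule term_at_combine)
  moreover have "(a * b) powi s * (a * b) powi r = a powi (r + s) * b powi (r + s)" if "a \<noteq> 0" "b \<noteq> 0" for a b :: complex
    using that by (simp add: power_int_mult_distrib power_int_add)
  moreover have "sgn_h \<noteq> 0" "(of_nat l :: complex) \<noteq> 0" using l_pos by (simp_all add: sgn_h_def)
  ultimately show ?thesis
    using powi_odd_sign[OF sgn_h_sq] by simp
qed

text \<open>The symbol of 24 b comes from both factors and so has the odd exponent r + s; the symbol
  of p comes only from the factor at p t and has exponent r.\<close>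

lemma term_at_l:
  assumes t: "Im t > 0" and b: "\<not> int l dvd b"
  shows "term_at (int l) (24 * b) t = of_int (Legendre (24 * b) (int l)) * of_int (Legendre (int p) (int l)) powi r
     * ((- \<i>) ^ h * of_real (sqrt (real l))) powi (r + s) * (etaq (t + of_int (24 * b) / of_nat l) / etaq t)"
proof -
  define K :: complex where "K = (- \<i>) ^ h * of_real (sqrt (real l))"
  define c :: complex where "c = of_int (Legendre (24 * b) (int l))"
  define d :: complex where "d = of_int (Legendre (int p) (int l))"
  have 1: "\<not> int l dvd 1" using l_gt_2 by simp
  have y: "\<not> int l dvd 24 * b" using b coprime_24 prime_dvd_mult_iff[OF prime_int_l] by blast
  have "torsion_unit (int l) (24 * b) t = (c * K) * (eta (t + of_int (24 * b) / of_nat l) / eta t)"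
    using torsion_unit_l[OF t 1 y, of b] by (simp add: c_def K_def)
  moreover have "torsion_unit (int l) (int p * (24 * b)) (of_nat p * t) = (c * d * K) * (eta (of_nat p * (t + of_int (24 * b) / of_nat l)) / eta (of_nat p * t))"
  proof -
    have py: "\<not> int l dvd int p * (24 * b)" using y ndvd_p by blast
    have e: "of_nat p * t + of_int (24 * (int p * b)) / of_nat l = of_nat p * (t + of_int (24 * b) / of_nat l)"
      by (simp add: algebra_simps)
    have cg: "[1 * (24 * (int p * b)) = int p * (24 * b)] (mod int l)"
      by (simp add: mult_ac)
    have "torsion_unit (int l * 1) (int p * (24 * b)) (of_nat p * t) = of_int (Legendre (1 * (int p * (24 * b))) (int l)) * (- \<i>) ^ h *
        of_real (sqrt (real l)) * (eta (of_nat p * (t + of_int (24 * b) / of_nat l)) / eta (of_nat p * t))"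
      using torsion_unit_l[OF Im_p[OF t] 1 py cg] unfolding e .
    moreover have "Legendre (1 * (int p * (24 * b))) (int l) = Legendre (int p) (int l) * Legendre (24 * b) (int l)"
      unfolding mult_1 by (rule Legendre_mult[OF prime_l l_gt_2])
    ultimately show ?thesis
      by (simp add: c_def d_def K_def)
  qed
  ultimately have "term_at (int l) (24 * b) t = (c * K) powi s * (c * d * K) powi r * (etaq (t + of_int (24 * b) / of_nat l) / etaq t)"
    by (rule term_at_combine)
  also have "(c * K) powi s * (c * d * K) powi r = c powi (r + s) * d powi r * K powi (r + s)"
  proof -
    have "K \<noteq> 0" using l_pos by (simp add: K_def)
    moreover have "c \<noteq> 0" using y by (simp add: c_def Legendre_eq_0_iff)
    ultimately show ?thesis by (simp add: power_int_mult_distrib power_int_add)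
  qed
  also have "c powi (r + s) = c"
    by (rule powi_odd_sign) (use Legendre_square[OF prime_l l_gt_2 y] in \<open>simp add: c_def flip: of_int_mult\<close>)
  finally show ?thesis by (simp add: c_def d_def K_def)
qed

end

section \<open>Expansions at the cusps\<close>

lemma fps_mult_trunc:
  fixes f g :: "'a :: comm_ring_1 fps"
  assumes "\<And>i. i \<le> m \<Longrightarrow> f $ i = f' $ i" "\<And>i. i \<le> m \<Longrightarrow> g $ i = g' $ i" "i \<le> m"
  shows "(f * g) $ i = (f' * g') $ i"
  unfolding fps_mult_nth by (intro sum.cong refl) (use assms in simp)

lemma fps_power_trunc:
  fixes f g :: "'a :: comm_ring_1 fps"
  assumes "\<And>i. i \<le> m \<Longrightarrow> f $ i = g $ i" "i \<le> m"
  shows "(f ^ k) $ i = (g ^ k) $ i"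
  using assms(2)
proof (induction k arbitrary: i)
  case (Suc k)
  show ?case unfolding power_Suc by (rule fps_mult_trunc[OF assms(1) Suc.IH Suc.prems])
qed simp

text \<open>Each coefficient of a product is already that of a finite partial product, so the finite
  identity can be used.\<close>

lemma prodinf_fps_mult:
  fixes f g :: "nat \<Rightarrow> complex fps"
  assumes f: "\<And>n i. i \<le> n \<Longrightarrow> f n $ i = 1 $ i" and g: "\<And>n i. i \<le> n \<Longrightarrow> g n $ i = 1 $ i"
  shows "(\<Prod>n. f n * g n) = (\<Prod>n. f n) * (\<Prod>n. g n)"
proof (rule fps_ext)
  fix m
  have fg: "(f n * g n) $ i = 1 $ i" if "i \<le> n" for n i
    using fps_mult_trunc[of n "f n" 1 "g n" 1 i] f g that by simp
  have "(\<Prod>n. f n * g n) $ m = ((\<Prod>i<m. f i) * (\<Prod>i<m. g i)) $ m"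
    using fps_has_prod(2)[of "\<lambda>n. f n * g n" m m] fg by (simp add: prod.distrib)
  also have "\<dots> = ((\<Prod>n. f n) * (\<Prod>n. g n)) $ m"
    by (rule fps_mult_trunc[where m = m]) (use fps_has_prod(2)[of f] fps_has_prod(2)[of g] f g in auto)
  finally show "(\<Prod>n. f n * g n) $ m = ((\<Prod>n. f n) * (\<Prod>n. g n)) $ m" .
qed

lemma prodinf_fps_power:
  fixes f :: "nat \<Rightarrow> complex fps"
  assumes f: "\<And>n i. i \<le> n \<Longrightarrow> f n $ i = 1 $ i"
  shows "(\<Prod>n. f n ^ k) = (\<Prod>n. f n) ^ k"
proof (rule fps_ext)
  fix m
  have fk: "(f n ^ k) $ i = 1 $ i" if "i \<le> n" for n i
    using fps_power_trunc[of n "f n" 1 i k] f that by simp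
  have "(\<Prod>n. f n ^ k) $ m = ((\<Prod>i<m. f i) ^ k) $ m"
    using fps_has_prod(2)[of "\<lambda>n. f n ^ k" m m] fk by (simp add: prod_power_distrib)
  also have "\<dots> = ((\<Prod>n. f n) ^ k) $ m"
    by (rule fps_power_trunc[where m = m]) (use fps_has_prod(2)[of f] f in auto)
  finally show "(\<Prod>n. f n ^ k) $ m = ((\<Prod>n. f n) ^ k) $ m" .
qed

lemma prodinf_fps_nth_0:
  fixes f :: "nat \<Rightarrow> complex fps"
  assumes f: "\<And>n i. i \<le> n \<Longrightarrow> f n $ i = 1 $ i"
  shows "(\<Prod>n. f n) $ 0 = 1"
  using fps_has_prod(2)[of f 0 0] f by simp

lemma prodinf_fps_inverse:
  fixes f :: "nat \<Rightarrow> complex fps"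
  assumes f: "\<And>n i. i \<le> n \<Longrightarrow> f n $ i = 1 $ i"
  shows "(\<Prod>n. inverse (f n)) = inverse (\<Prod>n. f n)"
proof -
  have g: "inverse (f n) $ i = 1 $ i" if "i \<le> n" for n i
    using fps_power_int_nth_eq_one[of n "f n" i "-1"] f that by (simp add: power_int_def)
  have "f n $ 0 \<noteq> 0" for n using f[of 0 n] by simp
  hence "f n * inverse (f n) = 1" for n by (simp add: inverse_mult_eq_1')
  moreover have "(\<Prod>n::nat. 1 :: complex fps) = 1"
  proof (rule fps_ext)
    fix m show "(\<Prod>n::nat. 1 :: complex fps) $ m = 1 $ m"
      using fps_has_prod(2)[of "\<lambda>_. 1 :: complex fps" m m] by simp
  qed
  ultimately have "(\<Prod>n. f n) * (\<Prod>n. inverse (f n)) = 1"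
    using prodinf_fps_mult[of f "\<lambda>n. inverse (f n)", OF f g] by simp
  thus ?thesis
    using prodinf_fps_nth_0[of f, OF f] by (metis fps_inverse_unique)
qed

lemma prodinf_fps_power_int:
  fixes f :: "nat \<Rightarrow> complex fps"
  assumes f: "\<And>n i. i \<le> n \<Longrightarrow> f n $ i = 1 $ i"
  shows "(\<Prod>n. f n powi e) = (\<Prod>n. f n) powi e"
proof (cases "e \<ge> 0")
  case True
  thus ?thesis using prodinf_fps_power[of f, OF f] by (simp add: power_int_def)
next
  case False
  have g: "inverse (f n) $ i = 1 $ i" if "i \<le> n" for n i
    using fps_power_int_nth_eq_one[of n "f n" i "-1"] f that by (simp add: power_int_def)
  show ?thesis using False prodinf_fps_power[of "\<lambda>n. inverse (f n)", OF g] prodinf_fps_inverse[of f, OF f] by (simp add: power_int_def)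
qed

section \<open>Euler products as formal series and as functions on the unit disc\<close>

definition euler_fps :: "nat \<Rightarrow> complex fps" where
  "euler_fps a = (\<Prod>n. 1 - fps_X ^ (a * Suc n))"

lemma euler_fps_factor:
  assumes "a > 0" "i \<le> n"
  shows "(1 - fps_X ^ (a * Suc n) :: complex fps) $ i = 1 $ i"
  using euler_factor_nth[OF assms, of 1] by simp

lemma euler_fps_0: "a > 0 \<Longrightarrow> euler_fps a $ 0 = 1"
  unfolding euler_fps_def by (rule prodinf_fps_nth_0) (rule euler_fps_factor)

lemma phi_star_euler: "p > 0 \<Longrightarrow> phi_star p r s = euler_fps 1 powi s * euler_fps p powi r"
  using prodinf_fps_power_int[of "\<lambda>n. 1 - fps_X ^ (1 * Suc n)" s, OF euler_fps_factor[of 1]]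
    prodinf_fps_power_int[of "\<lambda>n. 1 - fps_X ^ (p * Suc n)" r, OF euler_fps_factor[of p]]
  by (simp add: phi_star_def euler_fps_def)

lemma Phi_inv_euler:
  assumes p: "p > 0"
  shows "Phi_inv p k = fls_X_inv * fps_to_fls (euler_fps 1 ^ k * inverse (euler_fps p) ^ k)"
proof -
  define f where "f n = (1 - fps_X ^ Suc n :: complex fps)" for n
  define g where "g n = (1 - fps_X ^ (p * Suc n) :: complex fps)" for n
  have f: "f n $ i = 1 $ i" if "i \<le> n" for n i
    using euler_fps_factor[of 1 i n] that by (simp add: f_def)
  have g: "g n $ i = 1 $ i" if "i \<le> n" for n i
    using euler_fps_factor[OF p that] by (simp add: g_def)
  have fk: "(f n ^ k) $ i = 1 $ i" if "i \<le> n" for n i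
    using fps_power_trunc[of n "f n" 1 i k] f that by simp
  have gi: "inverse (g n) $ i = 1 $ i" if "i \<le> n" for n i
    using fps_power_int_nth_eq_one[of n "g n" i "-1"] g that by (simp add: power_int_def)
  have gk: "(inverse (g n) ^ k) $ i = 1 $ i" if "i \<le> n" for n i
    using fps_power_trunc[of n "inverse (g n)" 1 i k] gi that by simp
  have "(g n ^ k) $ 0 \<noteq> 0" for n
    using fps_power_trunc[of n "g n" 1 0 k] g[of _ n] by simp
  hence "f n ^ k / g n ^ k = f n ^ k * inverse (g n) ^ k" for n
    by (simp add: fps_divide_unit fps_inverse_power)
  hence "(\<Prod>n. f n ^ k / g n ^ k) = (\<Prod>n. f n) ^ k * inverse (\<Prod>n. g n) ^ k"
    using prodinf_fps_mult[of "\<lambda>n. f n ^ k" "\<lambda>n. inverse (g n) ^ k", OF fk gk]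
      prodinf_fps_power[of f k, OF f] prodinf_fps_power[of "\<lambda>n. inverse (g n)" k, OF gi] prodinf_fps_inverse[of g, OF g] by simp
  thus ?thesis by (simp add: Phi_inv_def euler_fps_def f_def g_def)
qed

definition euler_fun :: "nat \<Rightarrow> complex \<Rightarrow> complex" where
  "euler_fun a q = qp (q ^ a) (q ^ a)"

lemma norm_power_less_1: "a > 0 \<Longrightarrow> norm q < 1 \<Longrightarrow> norm (q ^ a :: complex) < 1"
  by (simp add: norm_power power_less_one_iff)

lemma euler_fun_holomorphic:
  assumes "a > 0"
  shows "euler_fun a holomorphic_on ball 0 1"
  unfolding euler_fun_def [abs_def]
  by (intro qp_holomorphic holomorphic_intros) (auto simp: norm_power_less_1 assms)

lemma euler_fun_nonzero:
  assumes "a > 0" "norm q < 1"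
  shows "euler_fun a q \<noteq> 0"
proof (cases "q = 0")
  case True
  hence "\<not> (\<exists>n. q ^ a * (q ^ a) ^ n = 1)" using assms(1) by (simp add: zero_power)
  thus ?thesis using qp_eq_0_iff[OF norm_power_less_1[OF assms]] by (simp add: euler_fun_def)
next
  case False
  thus ?thesis unfolding euler_fun_def by (intro qp_self_nonzero norm_power_less_1 assms) auto
qed

text \<open>The partial products converge q-adically to the series and uniformly near 0 to the
  function, so the limits correspond as well.\<close>

lemma euler_fun_expansion:
  assumes a: "a > 0"
  shows "euler_fun a has_fps_expansion euler_fps a"
proof -
  have exp: "euler_fun a has_fps_expansion fps_expansion (euler_fun a) 0"
    by (rule has_fps_expansion_fps_expansion[of "ball 0 1"]) (use euler_fun_holomorphic[OF a] in auto)
  have "fps_expansion (euler_fun a) 0 = euler_fps a"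
  proof (rule uniform_limit_imp_fps_expansion_eq[where F = sequentially and A = "ball 0 (1/2)"])
    show "(\<lambda>N. \<Prod>i<N. 1 - fps_X ^ (a * Suc i) :: complex fps) \<longlonglongrightarrow> euler_fps a"
    proof (rule tendsto_fpsI)
      fix m
      show "\<forall>\<^sub>F N in sequentially. (\<Prod>i<N. 1 - fps_X ^ (a * Suc i)) $ m = euler_fps a $ m"
        using eventually_ge_at_top[of m]
        by eventually_elim (use fps_has_prod(2)[OF euler_fps_factor[OF a]] in \<open>simp add: euler_fps_def\<close>)
    qed
    have r: "norm (x ^ a) \<le> 1 / 2" if "x \<in> cball 0 (1/2)" for x :: complex
    proof -
      have "norm x ^ a \<le> norm x ^ 1" using a that by (intro power_decreasing) auto
      thus ?thesis using that by (simp add: norm_power)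
    qed
    have "uniform_limit (cball 0 (1/2)) (\<lambda>n x. \<Prod>i<n. 1 - x ^ a * (x ^ a) ^ i) (\<lambda>x. qp (x ^ a) (x ^ a)) sequentially"
      by (rule qp_uniform_limit[where r = "1/2"]) (use r in \<open>auto intro!: continuous_intros\<close>)
    thus "uniform_limit (ball 0 (1/2)) (\<lambda>n x. \<Prod>i<n. 1 - x ^ (a * Suc i)) (euler_fun a) sequentially"
      unfolding euler_fun_def [abs_def] by (rule uniform_limit_on_subset[THEN uniform_limit_cong'[THEN iffD1, rotated -1]]) (auto simp: power_add power_mult)
    show "\<forall>\<^sub>F N in sequentially. (\<lambda>x. \<Prod>i<N. 1 - x ^ (a * Suc i)) has_fps_expansion (\<Prod>i<N. 1 - fps_X ^ (a * Suc i) :: complex fps)"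
      by (intro always_eventually allI fps_expansion_intros)
    show "\<forall>\<^sub>F N in sequentially. (\<lambda>x. \<Prod>i<N. 1 - x ^ (a * Suc i)) holomorphic_on (ball 0 (1/2) :: complex set)"
      by (intro always_eventually allI holomorphic_intros)
  qed (use exp in auto)
  thus ?thesis using exp by simp
qed

lemma has_fps_expansion_power_int:
  fixes f :: "complex \<Rightarrow> complex" and F :: "complex fps"
  assumes "f has_fps_expansion F" "F $ 0 \<noteq> 0"
  shows "(\<lambda>x. f x powi e) has_fps_expansion (F powi e)"
  unfolding power_int_def using assms by (auto intro!: fps_expansion_intros)

definition phiq :: "nat \<Rightarrow> int \<Rightarrow> int \<Rightarrow> complex \<Rightarrow> complex" where
  "phiq p r s q = euler_fun 1 q powi s * euler_fun p q powi r"

lemma phiq_expansion: "p > 0 \<Longrightarrow> phiq p r s has_fps_expansion phi_star p r s"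
  unfolding phiq_def [abs_def]
  by (simp only: phi_star_euler)
     (intro fps_expansion_intros has_fps_expansion_power_int euler_fun_expansion; simp add: euler_fps_0)

lemma phiq_holomorphic: "p > 0 \<Longrightarrow> phiq p r s holomorphic_on ball 0 1"
  unfolding phiq_def [abs_def]
  by (intro holomorphic_intros euler_fun_holomorphic) (auto simp: euler_fun_nonzero)

lemma phiq_nonzero: "p > 0 \<Longrightarrow> norm q < 1 \<Longrightarrow> phiq p r s q \<noteq> 0"
  by (simp add: phiq_def euler_fun_nonzero)

lemma phiq_sums:
  assumes "p > 0" "norm q < 1"
  shows "(\<lambda>n. phi_star p r s $ n * q ^ n) sums phiq p r s q"
  by (rule has_fps_expansion_imp_sums_complex[where r = 1, OF phiq_expansion])
     (use assms phiq_holomorphic in \<open>auto simp: one_ereal_def\<close>)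

text \<open>Convergence for t on the imaginary axis, where \<open>ee t\<close> takes every value in
  (0, 1), already forces radius of convergence at least 1.\<close>

lemma fps_expansion_of_sums:
  fixes f :: "complex \<Rightarrow> complex"
  assumes "\<And>t. Im t > 0 \<Longrightarrow> (\<lambda>n. c n * ee t ^ n) sums f t"
  shows "eval_fps (Abs_fps c) has_fps_expansion Abs_fps c" and "\<And>t. Im t > 0 \<Longrightarrow> eval_fps (Abs_fps c) (ee t) = f t"
    and "eval_fps (Abs_fps c) holomorphic_on ball 0 1"
proof -
  have "conv_radius c \<ge> 1"
  proof (rule conv_radius_geI_ex')
    fix x :: real assume x: "0 < x" "ereal x < 1"
    define t where "t = \<i> * of_real (- ln x / (2 * pi))"
    have "Im t > 0" using x by (simp add: t_def field_simps one_ereal_def)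
    moreover have "ee t = of_real x"
      using x by (simp add: ee_def t_def) (simp add: exp_of_real)
    ultimately show "summable (\<lambda>n. c n * of_real x ^ n)"
      using assms[of t] by (auto simp: sums_iff)
  qed
  hence R: "fps_conv_radius (Abs_fps c) \<ge> 1" by (simp add: fps_conv_radius_def)
  show "eval_fps (Abs_fps c) has_fps_expansion Abs_fps c"
    by (rule eval_fps_has_fps_expansion) (use R in \<open>auto intro: less_le_trans[of 0 1]\<close>)
  show "eval_fps (Abs_fps c) (ee t) = f t" if "Im t > 0" for t
    using assms[OF that] by (simp add: eval_fps_def sums_iff)
  show "eval_fps (Abs_fps c) holomorphic_on ball 0 1"
    by (rule holomorphic_on_eval_fps, rule ball_eball_mono) (use R in \<open>simp add: one_ereal_def\<close>)
qed

context odd_prime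
begin

lemma sum_Legendre: "(\<Sum>c\<in>{0..<int l}. Legendre c (int l)) = 0"
proof -
  have "(\<Sum>n\<in>{0..<int l}. 1) = (\<Sum>c\<in>{0..<int l}. \<Sum>n\<in>{n \<in> {0..<int l}. n ^ 2 mod int l = c}. 1 :: int)"
    by (rule sum.group[symmetric]) (use l_pos in auto)
  also have "\<dots> = (\<Sum>c\<in>{0..<int l}. int (card {n \<in> {0..<int l}. n ^ 2 mod int l = c}))"
    by simp
  also have "\<dots> = (\<Sum>c\<in>{0..<int l}. 1 + Legendre c (int l))"
    by (intro sum.cong refl card_square_roots)
  finally show ?thesis by (simp add: sum.distrib)
qed

lemma gauss_sum_twist:
  "(\<Sum>c\<in>{0..<int l}. of_int (Legendre c (int l)) * zeta l (c * m)) = of_int (Legendre m (int l)) * gauss_sum"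
proof (cases "int l dvd m")
  case True
  have "zeta l (c * m) = 1" for c using True by (simp add: zeta_eq_1_iff[OF l_pos])
  moreover have "Legendre m (int l) = 0" using True by (simp add: Legendre_eq_0_iff)
  ultimately show ?thesis using sum_Legendre by (simp flip: of_int_sum)
next
  case False
  have "gauss_sum = (\<Sum>c\<in>{0..<int l}. of_int (Legendre (c * m) (int l)) * zeta l (c * m))"
    unfolding gauss_sum_def
  proof (rule sum_residues[symmetric, where f = "\<lambda>c. of_int (Legendre c (int l)) * zeta l c"])
    fix i j assume ij: "i \<in> {0..<int l}" "j \<in> {0..<int l}" "[i * m = j * m] (mod int l)"
    hence "[i = j] (mod int l)" using cong_mult_rcancel False coprime_iff by blast
    thus "i = j" using ij by (simp add: cong_def)
  next
    fix k
    have "Legendre (k mod int l) (int l) = Legendre k (int l)" by (rule Legendre_cong) simp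
    thus "of_int (Legendre (k mod int l) (int l)) * zeta l (k mod int l) = of_int (Legendre k (int l)) * zeta l k"
      using l_pos by simp
  qed (use l_pos in auto)
  also have "\<dots> = of_int (Legendre m (int l)) * (\<Sum>c\<in>{0..<int l}. of_int (Legendre c (int l)) * zeta l (c * m))"
    by (simp add: Legendre_mult[OF prime_l l_gt_2] sum_distrib_left mult_ac)
  finally have "of_int (Legendre m (int l)) * gauss_sum =
    of_int (Legendre m (int l) * Legendre m (int l)) * (\<Sum>c\<in>{0..<int l}. of_int (Legendre c (int l)) * zeta l (c * m))"
    by (simp add: mult.assoc)
  thus ?thesis by (simp only: Legendre_square[OF prime_l l_gt_2 False]) simp
qed

end

lemma sum_zeta_multiples:
  assumes N: "N > 0"
  shows "(\<Sum>b\<in>{0..<int N}. zeta N (m * b)) = (if int N dvd m then of_nat N else 0)"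
proof (cases "int N dvd m")
  case True
  hence "zeta N (m * b) = 1" for b by (simp add: zeta_eq_1_iff[OF N])
  thus ?thesis using True by simp
next
  case False
  define S where "S = (\<Sum>b\<in>{0..<int N}. zeta N (m * b))"
  have "(\<Sum>b\<in>{0..<int N}. zeta N (m * (b + 1))) = S"
    unfolding S_def
  proof (rule sum_residues[where f = "\<lambda>b. zeta N (m * b)"])
    fix i j assume ij: "i \<in> {0..<int N}" "j \<in> {0..<int N}" "[i + 1 = j + 1] (mod int N)"
    hence "[i = j] (mod int N)" by (simp only: cong_add_rcancel)
    thus "i = j" using ij by (simp add: cong_def)
  next
    fix k show "zeta N (m * (k mod int N)) = zeta N (m * k)"
      by (intro zeta_cong N cong_scalar_left) simp
  qed (use N in auto)
  hence "zeta N m * S = S" by (simp add: S_def zeta_add distrib_left sum_distrib_left mult.commute)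
  moreover have "zeta N m \<noteq> 1" using False zeta_eq_1_iff[OF N] by simp
  ultimately have "S = 0" by simp
  thus ?thesis using False by (simp add: S_def)
qed

section \<open>The q-expansions of the three pieces of the Hecke sum\<close>

context hecke
begin

text \<open>24 times the leading exponent of \<open>etaq\<close> at infinity.\<close>

definition lead :: int where "lead = s + r * int p"

definition Del :: int where "Del = Delta_star p r s l"

lemma l2_eq: "int (l ^ 2) - 1 = 24 * ((int l ^ 2 - 1) div 24)"
proof -
  obtain k where k: "l ^ 2 - 1 = 24 * k" using dvd_24 by blast
  have "int (l ^ 2) - 1 = int (l ^ 2 - 1)" using l_pos by (simp add: of_nat_diff)
  also have "\<dots> = 24 * int k" by (simp only: k of_nat_mult of_nat_numeral)
  finally show ?thesis by simp
qed

text \<open>Consequently 24 n + \<open>lead\<close> is 24 (n - \<open>Del\<close>) modulo l^2; this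
  is how Delta enters the coefficients.\<close>

lemma Del_eq: "24 * Del + lead = lead * int (l ^ 2)"
proof -
  have "24 * Del = lead * (int (l ^ 2) - 1)"
    unfolding Del_def Delta_star_def l2_eq lead_def by simp
  thus ?thesis by (simp add: algebra_simps)
qed

lemma etaq_eq:
  assumes t: "Im t > 0"
  shows "etaq t = ee (of_int lead * t / 24) * phiq p r s (ee t)"
proof -
  have pw: "ee z powi k = ee (of_int k * z)" for z k
    by (cases "k \<ge> 0") (auto simp: power_int_def ee_power ee_minus power_inverse)
  have "etaq t = (ee (t / 24) powi s * ee (of_nat p * t / 24) powi r) * phiq p r s (ee t)"
    unfolding etaq_def eta_def phiq_def euler_fun_def ee_power by (simp add: power_int_mult_distrib)
  also have "ee (t / 24) powi s * ee (of_nat p * t / 24) powi r = ee (of_int lead * t / 24)"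
    unfolding pw ee_add[symmetric] lead_def by (rule arg_cong[where f = ee]) (simp add: field_simps)
  finally show ?thesis .
qed

lemma etaq_sums:
  assumes t: "Im t > 0"
  shows "(\<lambda>n. phi_star p r s $ n * ee (of_int (24 * int n + lead) * t / 24)) sums etaq t"
proof -
  have "(\<lambda>n. ee (of_int lead * t / 24) * (phi_star p r s $ n * ee t ^ n)) sums (ee (of_int lead * t / 24) * phiq p r s (ee t))"
    by (intro sums_mult phiq_sums p_pos norm_ee_less_1 t)
  moreover have "ee (of_int (24 * int n + lead) * t / 24) = ee (of_int lead * t / 24) * ee t ^ n" for n
    unfolding ee_power ee_add[symmetric] by (rule arg_cong[where f = ee]) (simp add: field_simps)
  ultimately show ?thesis by (simp add: etaq_eq[OF t] mult_ac)
qed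

text \<open>Orthogonality in b keeps exactly the exponents divisible by l^2, each with weight
  l^2.\<close>

lemma sum_etaq_dvd:
  assumes t: "Im t > 0"
  shows "(\<lambda>n. if int (l ^ 2) dvd 24 * int n + lead then of_nat (l ^ 2) * (phi_star p r s $ n * ee (of_int (24 * int n + lead) * t / (24 * of_nat (l ^ 2)))) else 0)
    sums (\<Sum>b\<in>{0..<int (l ^ 2)}. etaq ((t + of_int (24 * b)) / of_nat (l ^ 2)))"
proof -
  define N where "N = l ^ 2"
  have N: "N > 0" using l_pos by (simp add: N_def)
  have "(\<lambda>n. \<Sum>b\<in>{0..<int N}. phi_star p r s $ n * ee (of_int (24 * int n + lead) * ((t + of_int (24 * b)) / of_nat N) / 24))
     sums (\<Sum>b\<in>{0..<int N}. etaq ((t + of_int (24 * b)) / of_nat N))"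
    by (intro sums_sum etaq_sums) (use t N in \<open>simp add: Im_divide_of_nat\<close>)
  also have "(\<lambda>n. \<Sum>b\<in>{0..<int N}. phi_star p r s $ n * ee (of_int (24 * int n + lead) * ((t + of_int (24 * b)) / of_nat N) / 24)) =
     (\<lambda>n. if int N dvd 24 * int n + lead then of_nat N * (phi_star p r s $ n * ee (of_int (24 * int n + lead) * t / (24 * of_nat N))) else 0)"
  proof
    fix n
    define m where "m = 24 * int n + lead"
    have "ee (of_int m * ((t + of_int (24 * b)) / of_nat N) / 24) = ee (of_int m * t / (24 * of_nat N)) * zeta N (m * b)" for b
      unfolding zeta_def ee_add[symmetric] using N by (intro arg_cong[where f = ee]) (simp add: field_simps)
    hence "(\<Sum>b\<in>{0..<int N}. phi_star p r s $ n * ee (of_int m * ((t + of_int (24 * b)) / of_nat N) / 24)) =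
       (phi_star p r s $ n * ee (of_int m * t / (24 * of_nat N))) * (\<Sum>b\<in>{0..<int N}. zeta N (m * b))"
      by (simp add: sum_distrib_left mult.assoc)
    thus "(\<Sum>b\<in>{0..<int N}. phi_star p r s $ n * ee (of_int (24 * int n + lead) * ((t + of_int (24 * b)) / of_nat N) / 24)) =
       (if int N dvd 24 * int n + lead then of_nat N * (phi_star p r s $ n * ee (of_int (24 * int n + lead) * t / (24 * of_nat N))) else 0)"
      unfolding sum_zeta_multiples[OF N] by (simp add: m_def)
  qed
  finally show ?thesis by (simp only: N_def)
qed

definition coeffA :: "nat \<Rightarrow> complex" where
  "coeffA m = c_star p r s (of_int (int m * int l ^ 2 + Del))"

lemma c_star_int: "c_star p r s (of_int k) = (if k \<ge> 0 then phi_star p r s $ nat k else 0)"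
  by (simp add: c_star_def)

text \<open>The surviving indices are n = m l^2 + \<open>Del\<close>. The bound on
  \<open>lead\<close> gives |\<open>Del\<close>| < l^2, so that n \<ge> 0 forces m \<ge> 0.\<close>

lemma coeffA_sums:
  assumes t: "Im t > 0" and lead: "\<bar>lead\<bar> < 24"
  shows "(\<lambda>m. coeffA m * ee t ^ m) sums
     ((\<Sum>b\<in>{0..<int (l ^ 2)}. etaq ((t + of_int (24 * b)) / of_nat (l ^ 2))) / (of_nat (l ^ 2) * ee (of_int lead * t / 24)))"
proof -
  define N where "N = int (l ^ 2)"
  have N: "N > 0" using l_pos by (simp add: N_def)
  have N24: "coprime N 24"
    using coprime_square[OF coprime_24] by (simp add: N_def coprime_commute)
  have bound: "\<bar>Del\<bar> < N"
  proof -
    have "24 * Del = lead * (N - 1)" using Del_eq by (simp add: N_def algebra_simps)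
    hence "24 * \<bar>Del\<bar> = \<bar>lead\<bar> * (N - 1)" using N by (metis abs_mult abs_numeral abs_of_nonneg zle_diff1_eq)
    also have "\<dots> \<le> 24 * (N - 1)" using lead N by (intro mult_right_mono) auto
    finally show ?thesis by simp
  qed
  define g where "g n = (if N dvd 24 * int n + lead then of_nat (l ^ 2) * (phi_star p r s $ n * ee (of_int (24 * int n + lead) * t / (24 * of_nat (l ^ 2)))) else 0)" for n
  have dvd_iff: "N dvd 24 * int n + lead \<longleftrightarrow> N dvd int n - Del" for n
  proof -
    have "24 * int n + lead = 24 * (int n - Del) + lead * N" using Del_eq by (simp add: N_def algebra_simps)
    hence "N dvd 24 * int n + lead \<longleftrightarrow> N dvd 24 * (int n - Del)" by (metis dvd_add_left_iff dvd_triv_right)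
    also have "\<dots> \<longleftrightarrow> N dvd int n - Del" using coprime_dvd_mult_right_iff[OF N24] by blast
    finally show ?thesis .
  qed
  define C where "C = of_nat (l ^ 2) * ee (of_int lead * t / 24)"
  have C0: "C \<noteq> 0" using l_pos by (simp add: C_def)
  have gm: "g (nat (int m * N + Del)) = C * (coeffA m * ee t ^ m)" if "int m * N + Del \<ge> 0" for m
  proof -
    have n: "int (nat (int m * N + Del)) = int m * N + Del" using that by simp
    have eq: "24 * (int m * N + Del) + lead = (24 * int m + lead) * N"
      using Del_eq by (simp add: N_def algebra_simps)
    have "g (nat (int m * N + Del)) = of_nat (l ^ 2) * (phi_star p r s $ nat (int m * N + Del) *
        ee (of_int ((24 * int m + lead) * N) * t / (24 * of_nat (l ^ 2))))"
      unfolding g_def n eq by simp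
    also have "of_int ((24 * int m + lead) * N) * t / (24 * of_nat (l ^ 2)) = (of_int (24 * int m + lead) * t / 24 :: complex)"
      using l_pos by (simp add: N_def)
    also have "ee (of_int (24 * int m + lead) * t / 24) = ee (of_int lead * t / 24) * ee t ^ m"
      unfolding ee_power ee_add[symmetric] by (rule arg_cong[where f = ee]) (simp add: field_simps)
    also have "phi_star p r s $ nat (int m * N + Del) = coeffA m"
      using that unfolding coeffA_def c_star_int by (simp add: N_def)
    finally show ?thesis by (simp only: C_def mult_ac)
  qed
  have g_sums: "g sums (\<Sum>b\<in>{0..<int (l ^ 2)}. etaq ((t + of_int (24 * b)) / of_nat (l ^ 2)))"
    unfolding g_def N_def by (rule sum_etaq_dvd[OF t])
  have "(\<lambda>m. C * (coeffA m * ee t ^ m)) sums (\<Sum>b\<in>{0..<int (l ^ 2)}. etaq ((t + of_int (24 * b)) / of_nat (l ^ 2)))"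
  proof (cases "Del \<ge> 0")
    case True
    define i where "i m = nat (int m * N + Del)" for m
    have "strict_mono i"
      unfolding strict_mono_Suc_iff i_def
    proof
      fix m
      have "0 \<le> int m * N" "int m * N < int (Suc m) * N" using N by (simp_all add: mult_less_cancel_right)
      thus "nat (int m * N + Del) < nat (int (Suc m) * N + Del)" using True by (simp only: nat_less_eq_zless add_nonneg_nonneg add_less_cancel_right)
    qed
    moreover have "g n = 0" if "n \<notin> range i" for n
    proof (rule ccontr)
      assume "g n \<noteq> 0"
      hence "N dvd int n - Del" by (auto simp: g_def dvd_iff split: if_splits)
      then obtain k where k: "int n = N * k + Del" by (metis diff_eq_eq dvdE)
      have "k \<ge> 0"
      proof (rule ccontr)
        assume "\<not> k \<ge> 0"
        hence "N * k \<le> N * (-1)" using N by (intro mult_left_mono) auto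
        thus False using k bound by simp
      qed
      hence "n = i (nat k)" using k by (simp add: i_def mult.commute flip: k)
      thus False using that by blast
    qed
    ultimately have "(\<lambda>m. g (i m)) sums (\<Sum>b\<in>{0..<int (l ^ 2)}. etaq ((t + of_int (24 * b)) / of_nat (l ^ 2)))"
      using sums_mono_reindex[of i g] g_sums by simp
    moreover have "g (i m) = C * (coeffA m * ee t ^ m)" for m
      unfolding i_def by (rule gm) (use True N in simp)
    ultimately show ?thesis by simp
  next
    case False
    \<comment> \<open>For negative \<open>Del\<close> the value m = 0 would mean n < 0, so the
      reindexing starts at m = 1, and \<open>coeffA 0\<close> is 0.\<close>
    define i where "i m = nat (int (Suc m) * N + Del)" for m
    have pos: "int (Suc m) * N + Del \<ge> 0" for m
    proof -
      have "1 * N \<le> int (Suc m) * N" using N by (intro mult_right_mono) auto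
      thus ?thesis using bound by simp
    qed
    have "strict_mono i"
      unfolding strict_mono_Suc_iff i_def
    proof
      fix m
      have "int (Suc m) * N < int (Suc (Suc m)) * N" using N by (simp add: mult_less_cancel_right)
      thus "nat (int (Suc m) * N + Del) < nat (int (Suc (Suc m)) * N + Del)" using pos[of m] by (simp only: nat_less_eq_zless add_less_cancel_right)
    qed
    moreover have "g n = 0" if "n \<notin> range i" for n
    proof (rule ccontr)
      assume "g n \<noteq> 0"
      hence "N dvd int n - Del" by (auto simp: g_def dvd_iff split: if_splits)
      then obtain k where k: "int n = N * k + Del" by (metis diff_eq_eq dvdE)
      have "k \<ge> 1"
      proof (rule ccontr)
        assume "\<not> k \<ge> 1"
        hence "N * k \<le> N * 0" using N by (intro mult_left_mono) auto
        thus False using k False by simp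
      qed
      hence "int (Suc (nat (k - 1))) = k" by simp
      hence "n = i (nat (k - 1))" using k unfolding i_def by (simp only: mult.commute flip: k)
      thus False using that by blast
    qed
    ultimately have "(\<lambda>m. g (i m)) sums (\<Sum>b\<in>{0..<int (l ^ 2)}. etaq ((t + of_int (24 * b)) / of_nat (l ^ 2)))"
      using sums_mono_reindex[of i g] g_sums by simp
    moreover have "g (i m) = C * (coeffA (Suc m) * ee t ^ Suc m)" for m
      unfolding i_def by (rule gm) (rule pos)
    ultimately have "(\<lambda>m. C * (coeffA (Suc m) * ee t ^ Suc m)) sums (\<Sum>b\<in>{0..<int (l ^ 2)}. etaq ((t + of_int (24 * b)) / of_nat (l ^ 2)))"
      by simp
    moreover have "coeffA 0 = 0" unfolding coeffA_def c_star_int using False by simp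
    ultimately show ?thesis by (subst (asm) sums_Suc_iff) simp
  qed
  hence "(\<lambda>m. C * (coeffA m * ee t ^ m) / C) sums ((\<Sum>b\<in>{0..<int (l ^ 2)}. etaq ((t + of_int (24 * b)) / of_nat (l ^ 2))) / C)"
    by (rule sums_divide)
  thus ?thesis using C0 by (simp add: C_def)
qed

definition coeffB :: "nat \<Rightarrow> complex" where
  "coeffB n = of_int (Legendre (int n - Del) (int l)) * phi_star p r s $ n"

text \<open>The sum over b becomes a Gauss sum twisted by 24 n + \<open>lead\<close>, which modulo l
  is 24 (n - \<open>Del\<close>); substituting c = 24 b leaves the symbol of n -
  \<open>Del\<close>.\<close>

lemma coeffB_sums:
  assumes t: "Im t > 0"
  shows "(\<lambda>n. coeffB n * ee t ^ n) sums
     ((\<Sum>b\<in>{1..<int l}. of_int (Legendre (24 * b) (int l)) * etaq (t + of_int (24 * b) / of_nat l)) / (gauss_sum * ee (of_int lead * t / 24)))"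
proof -
  define C where "C = gauss_sum * ee (of_int lead * t / 24)"
  have C0: "C \<noteq> 0"
    using not_dvd_2 l_pos by (simp add: C_def gauss_sum_eq Legendre_eq_0_iff)
  have "(\<lambda>n. \<Sum>b\<in>{1..<int l}. of_int (Legendre (24 * b) (int l)) * (phi_star p r s $ n * ee (of_int (24 * int n + lead) * (t + of_int (24 * b) / of_nat l) / 24)))
    sums (\<Sum>b\<in>{1..<int l}. of_int (Legendre (24 * b) (int l)) * etaq (t + of_int (24 * b) / of_nat l))"
    by (intro sums_sum sums_mult etaq_sums) (use t in \<open>simp add: Im_divide_of_nat\<close>)
  also have "(\<lambda>n. \<Sum>b\<in>{1..<int l}. of_int (Legendre (24 * b) (int l)) * (phi_star p r s $ n * ee (of_int (24 * int n + lead) * (t + of_int (24 * b) / of_nat l) / 24))) =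
     (\<lambda>n. C * (coeffB n * ee t ^ n))"
  proof
    fix n
    define m where "m = 24 * int n + lead"
    have m: "[m * b = 24 * b * (int n - Del)] (mod int l)" for b
    proof -
      have "m * b - 24 * b * (int n - Del) = (24 * Del + lead) * b" by (simp add: m_def algebra_simps)
      also have "\<dots> = int l * (lead * int l * b)" unfolding Del_eq by (simp add: power2_eq_square)
      finally show ?thesis by (simp add: cong_iff_dvd_diff)
    qed
    have e1: "ee (of_int m * t / 24) = ee (of_int lead * t / 24) * ee t ^ n"
      unfolding m_def ee_power ee_add[symmetric] by (rule arg_cong[where f = ee]) (simp add: field_simps)
    have "ee (of_int m * (t + of_int (24 * b) / of_nat l) / 24) = ee (of_int m * t / 24) * zeta l (24 * b * (int n - Del))" for b
    proof -
      have "ee (of_int m * (t + of_int (24 * b) / of_nat l) / 24) = ee (of_int m * t / 24) * zeta l (m * b)"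
        unfolding zeta_def ee_add[symmetric] using l_pos by (intro arg_cong[where f = ee]) (simp add: field_simps)
      thus ?thesis using zeta_cong[OF l_pos m] by simp
    qed
    hence "(\<Sum>b\<in>{1..<int l}. of_int (Legendre (24 * b) (int l)) * (phi_star p r s $ n * ee (of_int m * (t + of_int (24 * b) / of_nat l) / 24))) =
      phi_star p r s $ n * ee (of_int m * t / 24) * (\<Sum>b\<in>{1..<int l}. of_int (Legendre (24 * b) (int l)) * zeta l (24 * b * (int n - Del)))"
      by (simp add: sum_distrib_left mult_ac)
    also have "(\<Sum>b\<in>{1..<int l}. of_int (Legendre (24 * b) (int l)) * zeta l (24 * b * (int n - Del))) =
      (\<Sum>b\<in>{0..<int l}. of_int (Legendre (24 * b) (int l)) * zeta l (24 * b * (int n - Del)))"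
    proof (rule sum.mono_neutral_left)
      show "\<forall>i\<in>{0..<int l} - {1..<int l}. of_int (Legendre (24 * i) (int l)) * zeta l (24 * i * (int n - Del)) = 0"
      proof
        fix i assume "i \<in> {0..<int l} - {1..<int l}"
        hence "i = 0" by auto
        thus "of_int (Legendre (24 * i) (int l)) * zeta l (24 * i * (int n - Del)) = 0" by (simp add: Legendre_def)
      qed
    qed auto
    also have "\<dots> = (\<Sum>c\<in>{0..<int l}. of_int (Legendre c (int l)) * zeta l (c * (int n - Del)))"
    proof (rule sum_residues[where f = "\<lambda>c. of_int (Legendre c (int l)) * zeta l (c * (int n - Del))"])
      fix i j assume ij: "i \<in> {0..<int l}" "j \<in> {0..<int l}" "[24 * i = 24 * j] (mod int l)"
      hence "[i = j] (mod int l)" using cong_mult_lcancel coprime_24 coprime_iff by blast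
      thus "i = j" using ij by (simp add: cong_def)
    next
      fix k
      have "Legendre (k mod int l) (int l) = Legendre k (int l)" by (rule Legendre_cong) simp
      moreover have "zeta l ((k mod int l) * (int n - Del)) = zeta l (k * (int n - Del))"
        by (intro zeta_cong l_pos cong_scalar_right) simp
      ultimately show "of_int (Legendre (k mod int l) (int l)) * zeta l ((k mod int l) * (int n - Del)) =
        of_int (Legendre k (int l)) * zeta l (k * (int n - Del))" by simp
    qed (use l_pos in auto)
    also have "\<dots> = of_int (Legendre (int n - Del) (int l)) * gauss_sum"
      by (rule gauss_sum_twist)
    finally show "(\<Sum>b\<in>{1..<int l}. of_int (Legendre (24 * b) (int l)) * (phi_star p r s $ n * ee (of_int (24 * int n + lead) * (t + of_int (24 * b) / of_nat l) / 24))) =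
      C * (coeffB n * ee t ^ n)"
      unfolding e1 by (simp add: m_def C_def coeffB_def mult_ac)
  qed
  finally have "(\<lambda>n. C * (coeffB n * ee t ^ n) / C) sums
     ((\<Sum>b\<in>{1..<int l}. of_int (Legendre (24 * b) (int l)) * etaq (t + of_int (24 * b) / of_nat l)) / C)"
    by (rule sums_divide)
  thus ?thesis using C0 by (simp add: C_def)
qed

definition factorB :: complex where
  "factorB = of_int (Legendre (int p) (int l)) powi r * ((- \<i>) ^ h * of_real (sqrt (real l))) powi (r + s) * gauss_sum"

theorem hecke_sum_series:
  assumes t: "Im t > 0" and lead: "\<bar>lead\<bar> < 24"
  shows "hecke_sum t * phiq p r s (ee t) =
    sgn_h * of_nat (l ^ 2) * eval_fps (Abs_fps coeffA) (ee t) + factorB * eval_fps (Abs_fps coeffB) (ee t)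
     + sgn_h * of_nat l powi (r + s) * (ee (of_int Del * t) * phiq p r s (ee t ^ (l ^ 2)))"
proof -
  define E where "E = ee (of_int lead * t / 24)"
  have eq: "etaq t = E * phiq p r s (ee t)" using etaq_eq[OF t] by (simp add: E_def)
  have e0: "etaq t \<noteq> 0" by (rule etaq_nonzero[OF t])
  have g0: "gauss_sum \<noteq> 0"
    using not_dvd_2 l_pos by (simp add: gauss_sum_eq Legendre_eq_0_iff)
  have E0: "E \<noteq> 0" by (simp add: E_def)
  have ratio: "x / etaq t * phiq p r s (ee t) = x / E" for x
    using e0 E0 by (simp add: eq)
  have A: "(\<Sum>b\<in>{0..<int (l ^ 2)}. term_at 1 (24 * b) t) * phiq p r s (ee t) = sgn_h * of_nat (l ^ 2) * eval_fps (Abs_fps coeffA) (ee t)"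
  proof -
    have "(\<Sum>b\<in>{0..<int (l ^ 2)}. term_at 1 (24 * b) t) * phiq p r s (ee t) =
       sgn_h * ((\<Sum>b\<in>{0..<int (l ^ 2)}. etaq ((t + of_int (24 * b)) / of_nat (l ^ 2))) / etaq t * phiq p r s (ee t))"
      unfolding term_at_1[OF t] sum_distrib_left[symmetric] sum_divide_distrib[symmetric] by (simp only: mult.assoc)
    also have "\<dots> = sgn_h * ((\<Sum>b\<in>{0..<int (l ^ 2)}. etaq ((t + of_int (24 * b)) / of_nat (l ^ 2))) / E)"
      by (simp only: ratio)
    also have "(\<Sum>b\<in>{0..<int (l ^ 2)}. etaq ((t + of_int (24 * b)) / of_nat (l ^ 2))) / E = of_nat (l ^ 2) * eval_fps (Abs_fps coeffA) (ee t)"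
      using fps_expansion_of_sums(2)[OF coeffA_sums[OF _ lead] t] l_pos by (simp add: E_def)
    finally show ?thesis by (simp only: mult.assoc)
  qed
  have B: "(\<Sum>b\<in>{1..<int l}. term_at (int l) (24 * b) t) * phiq p r s (ee t) = factorB * eval_fps (Abs_fps coeffB) (ee t)"
  proof -
    define D :: complex where "D = of_int (Legendre (int p) (int l)) powi r * ((- \<i>) ^ h * of_real (sqrt (real l))) powi (r + s)"
    have "(\<Sum>b\<in>{1..<int l}. term_at (int l) (24 * b) t) =
        (\<Sum>b\<in>{1..<int l}. D * (of_int (Legendre (24 * b) (int l)) * etaq (t + of_int (24 * b) / of_nat l) / etaq t))"
    proof (intro sum.cong refl)
      fix b assume "b \<in> {1..<int l}"
      hence "\<not> int l dvd b" by (intro zdvd_not_zless) auto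
      thus "term_at (int l) (24 * b) t = D * (of_int (Legendre (24 * b) (int l)) * etaq (t + of_int (24 * b) / of_nat l) / etaq t)"
        unfolding term_at_l[OF t \<open>\<not> int l dvd b\<close>] D_def by (simp only: mult_ac times_divide_eq_right times_divide_eq_left)
    qed
    hence "(\<Sum>b\<in>{1..<int l}. term_at (int l) (24 * b) t) * phiq p r s (ee t) =
       D * ((\<Sum>b\<in>{1..<int l}. of_int (Legendre (24 * b) (int l)) * etaq (t + of_int (24 * b) / of_nat l)) / etaq t * phiq p r s (ee t))"
      by (simp only: sum_distrib_left[symmetric] sum_divide_distrib[symmetric] mult.assoc)
    also have "\<dots> = D * ((\<Sum>b\<in>{1..<int l}. of_int (Legendre (24 * b) (int l)) * etaq (t + of_int (24 * b) / of_nat l)) / E)"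
      by (simp only: ratio)
    also have "(\<Sum>b\<in>{1..<int l}. of_int (Legendre (24 * b) (int l)) * etaq (t + of_int (24 * b) / of_nat l)) / E = gauss_sum * eval_fps (Abs_fps coeffB) (ee t)"
      using fps_expansion_of_sums(2)[OF coeffB_sums t] g0 by (simp add: E_def)
    finally show ?thesis by (simp only: mult.assoc D_def factorB_def)
  qed
  have C: "term_at 0 1 t * phiq p r s (ee t) = sgn_h * of_nat l powi (r + s) * (ee (of_int Del * t) * phiq p r s (ee t ^ (l ^ 2)))"
  proof -
    have t2: "Im (of_nat (l ^ 2) * t) > 0" using t l_pos by simp
    have "etaq (of_nat (l ^ 2) * t) / E = ee (of_int Del * t) * phiq p r s (ee t ^ (l ^ 2))"
    proof -
      have "ee (of_int lead * (of_nat (l ^ 2) * t) / 24) = E * ee (of_int Del * t)"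
      proof -
        have "of_int lead * of_nat (l ^ 2) = (24 * of_int Del + of_int lead :: complex)"
          using arg_cong[OF Del_eq, of "of_int :: int \<Rightarrow> complex"] by simp
        hence "of_int lead * (of_nat (l ^ 2) * t) / 24 = of_int lead * t / 24 + of_int Del * t"
          by (simp only: mult.assoc[symmetric]) (simp add: field_simps)
        thus ?thesis by (simp only: E_def ee_add)
      qed
      thus ?thesis unfolding etaq_eq[OF t2] ee_power using E0 by simp
    qed
    thus ?thesis unfolding term_at_0[OF t] by (simp only: mult.assoc ratio)
  qed
  show ?thesis
    unfolding hecke_sum_def distrib_right A B C by simp
qed

end

section \<open>Functions invariant under \<open>\<Gamma>\<^sub>0(p)\<close>\<close>

definition uhp :: "complex set" where "uhp = {z. Im z > 0}"

lemma uhp_open: "open uhp" and uhp_connected: "connected uhp"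
  unfolding uhp_def by (rule open_halfspace_Im_gt, intro convex_connected convex_halfspace_Im_gt)

lemma Im_minus_inverse: "Im t > 0 \<Longrightarrow> Im (- 1 / t) > 0"
  using moebius_aux(2)[of t 0 0 "-1" 1] by simp

lemma periodic_shift_int:
  assumes "\<And>t. Im t > 0 \<Longrightarrow> f (t + 1) = f t" "Im t > 0"
  shows "f (t + of_int n) = f t"
proof -
  have nat: "f (t + of_nat n) = f t" if "Im t > 0" for t n
  proof (induction n)
    case (Suc n)
    have "f ((t + of_nat n) + 1) = f (t + of_nat n)" using that by (intro assms(1)) simp
    thus ?case using Suc by (simp add: add_ac)
  qed simp
  show ?thesis
  proof (cases "n \<ge> 0")
    case True
    thus ?thesis using nat[OF assms(2), of "nat n"] by simp
  next
    case False
    thus ?thesis using nat[of "t + of_int n" "nat (- n)"] assms(2) by simp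
  qed
qed

text \<open>The target is larger than a fundamental domain, so a crude estimate suffices: if Im u <
  1/2 and |Re u| \<le> 1/2, then |u|^2 \<le> 1/2, and inversion at least doubles the imaginary
  part.\<close>

lemma modular_reduction:
  assumes T: "\<And>t. Im t > 0 \<Longrightarrow> f (t + 1) = f t" and S: "\<And>t. Im t > 0 \<Longrightarrow> f (- 1 / t) = f t"
    and "Im t > 0"
  obtains t' where "\<bar>Re t'\<bar> \<le> 1 / 2" "Im t' \<ge> 1 / 2" "f t' = f t"
proof -
  have "\<exists>t'. \<bar>Re t'\<bar> \<le> 1 / 2 \<and> Im t' \<ge> 1 / 2 \<and> f t' = f t" if "Im t > 0" "2 ^ n * Im t \<ge> 1 / 2" for n t
    using that
  proof (induction n arbitrary: t)
    case (0 t)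
    define u where "u = t + of_int (- round (Re t))"
    have "f u = f t" unfolding u_def by (rule periodic_shift_int[of f t, OF T 0(1)])
    moreover have "\<bar>Re u\<bar> \<le> 1 / 2" using of_int_round_abs_le[of "Re t"] by (simp add: u_def abs_minus_commute)
    ultimately show ?case using 0 by (intro exI[of _ u]) (simp add: u_def)
  next
    case (Suc n t)
    define u where "u = t + of_int (- round (Re t))"
    have fu: "f u = f t" unfolding u_def by (rule periodic_shift_int[of f t, OF T Suc.prems(1)])
    have Re: "\<bar>Re u\<bar> \<le> 1 / 2" using of_int_round_abs_le[of "Re t"] by (simp add: u_def abs_minus_commute)
    have Im: "Im u = Im t" by (simp add: u_def)
    show ?case
    proof (cases "Im u \<ge> 1 / 2")
      case True
      thus ?thesis using fu Re by blast
    next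
      case False
      have pos: "Im u > 0" using Suc.prems Im by simp
      have "\<bar>Re u\<bar>\<^sup>2 \<le> (1/2)\<^sup>2" using Re by (intro power_mono) auto
      hence "(Re u)\<^sup>2 \<le> (1/2)\<^sup>2" by (simp only: power2_abs)
      moreover have "(Im u)\<^sup>2 \<le> (1/2)\<^sup>2" using False pos by (intro power_mono) auto
      ultimately have n: "(Re u)\<^sup>2 + (Im u)\<^sup>2 \<le> 1 / 2" by (simp add: power2_eq_square)
      have n0: "(Re u)\<^sup>2 + (Im u)\<^sup>2 > 0" using pos by (simp add: sum_power2_gt_zero_iff)
      have "Im (- 1 / u) = Im u / ((Re u)\<^sup>2 + (Im u)\<^sup>2)" by (simp add: Im_divide)
      also have "\<dots> \<ge> 2 * Im u"
      proof -
        have "2 * Im u * ((Re u)\<^sup>2 + (Im u)\<^sup>2) \<le> 2 * Im u * (1 / 2)"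
          using n pos by (intro mult_left_mono) auto
        thus ?thesis using n0 by (simp add: pos_le_divide_eq)
      qed
      finally have "2 ^ n * Im (- 1 / u) \<ge> 2 ^ n * (2 * Im u)" by (intro mult_left_mono) auto
      also have "2 ^ n * (2 * Im u) = 2 ^ Suc n * Im t" by (simp add: Im)
      finally have "2 ^ n * Im (- 1 / u) \<ge> 1 / 2" using Suc.prems(2) by linarith
      from Suc.IH[OF Im_minus_inverse[OF pos] this] show ?thesis
        using S[OF pos] fu by auto
    qed
  qed
  moreover obtain n where "2 ^ n * Im t \<ge> 1 / 2"
  proof -
    obtain n where "(1 / 2) / Im t < 2 ^ n" using real_arch_pow[of 2] by auto
    thus ?thesis using that[of n] assms(3) by (simp add: field_simps)
  qed
  ultimately show ?thesis using that assms(3) by blast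
qed

text \<open>If f were nonzero at t, then above the height M its modulus would be smaller than |f t|.
  The maximum would be attained in the compact box K, f would be constant, and smallness high up
  contradicts this.\<close>

lemma modular_zero:
  assumes T: "\<And>t. Im t > 0 \<Longrightarrow> f (t + 1) = f t" and S: "\<And>t. Im t > 0 \<Longrightarrow> f (- 1 / t) = f t"
    and hol: "f holomorphic_on uhp"
    and lim: "\<And>e. e > 0 \<Longrightarrow> \<exists>M. \<forall>t. Im t \<ge> M \<longrightarrow> norm (f t) < e"
    and t: "Im t > 0"
  shows "f t = 0"
proof (rule ccontr)
  assume ft: "f t \<noteq> 0"
  define e where "e = norm (f t)"
  obtain M where M: "\<And>t. Im t \<ge> M \<Longrightarrow> norm (f t) < e"
    using lim[of e] ft by (auto simp: e_def)
  define K where "K = cbox (Complex (-1/2) (1/2)) (Complex (1/2) M)"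
  have K_iff: "z \<in> K \<longleftrightarrow> \<bar>Re z\<bar> \<le> 1 / 2 \<and> 1 / 2 \<le> Im z \<and> Im z \<le> M" for z
    by (auto simp: K_def in_cbox_complex_iff abs_le_iff)
  have K_uhp: "K \<subseteq> uhp" by (auto simp: K_iff uhp_def)
  obtain t1 where t1: "\<bar>Re t1\<bar> \<le> 1 / 2" "Im t1 \<ge> 1 / 2" "f t1 = f t"
    by (rule modular_reduction[of f, OF T S t])
  have "t1 \<in> K" using t1 M[of t1] by (force simp: K_iff e_def)
  have "compact K" unfolding K_def by (rule compact_cbox)
  moreover have "continuous_on K (\<lambda>z. norm (f z))"
    using holomorphic_on_imp_continuous_on[OF holomorphic_on_subset[OF hol K_uhp]] by (intro continuous_intros)
  ultimately obtain z where z: "z \<in> K" "\<And>w. w \<in> K \<Longrightarrow> norm (f w) \<le> norm (f z)"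
    using continuous_attains_sup[of K "\<lambda>z. norm (f z)"] \<open>t1 \<in> K\<close> by blast
  have max: "norm (f w) \<le> norm (f z)" if "w \<in> uhp" for w
  proof -
    have w: "Im w > 0" using that by (simp add: uhp_def)
    obtain w1 where w1: "\<bar>Re w1\<bar> \<le> 1 / 2" "Im w1 \<ge> 1 / 2" "f w1 = f w"
      by (rule modular_reduction[of f, OF T S w])
    show ?thesis
    proof (cases "Im w1 \<le> M")
      case True
      thus ?thesis using z(2)[of w1] w1 by (simp add: K_iff)
    next
      case False
      hence "norm (f w1) < e" by (intro M) simp
      also have "e \<le> norm (f z)" using z(2)[OF \<open>t1 \<in> K\<close>] t1 by (simp add: e_def)
      finally show ?thesis using w1 by simp
    qed
  qed
  have "f constant_on uhp"
    by (rule maximum_modulus_principle[OF hol uhp_open uhp_connected uhp_open subset_refl, of z])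
       (use z K_uhp max in auto)
  then obtain c where c: "\<And>w. w \<in> uhp \<Longrightarrow> f w = c" by (auto simp: constant_on_def)
  have "norm (f (\<i> * of_real (max M 1))) < e" by (rule M) simp
  moreover have "f (\<i> * of_real (max M 1)) = f t"
    using c[of t] c[of "\<i> * of_real (max M 1)"] t by (simp add: uhp_def max_def)
  ultimately show False by (simp add: e_def)
qed

text \<open>By the identity theorem the holomorphic functions on a connected open set have no zero
  divisors.\<close>

lemma holomorphic_mult_eq_0:
  assumes "open S" "connected S" "f holomorphic_on S" "g holomorphic_on S" "\<And>z. z \<in> S \<Longrightarrow> f z * g z = 0"
    and "w \<in> S" "f w \<noteq> 0" and "z \<in> S"
  shows "g z = 0"
proof -
  define U where "U = {x \<in> S. f x \<noteq> 0}"
  have "open U"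
  proof -
    have "continuous_on S f" using assms(3) by (rule holomorphic_on_imp_continuous_on)
    hence "open (S \<inter> f -` (- {0}))" using assms(1) by (intro continuous_open_preimage) auto
    moreover have "U = S \<inter> f -` (- {0})" by (auto simp: U_def)
    ultimately show ?thesis by simp
  qed
  moreover have "g x = 0" if "x \<in> U" for x using that assms(5)[of x] by (simp add: U_def)
  moreover have "w \<in> U" using assms by (simp add: U_def)
  ultimately show ?thesis
    using analytic_continuation_open[of U S g "\<lambda>_. 0" z] assms(1,2,4,8) by (auto simp: U_def)
qed

lemma holomorphic_prod_eq_0:
  assumes S: "open S" "connected S" and "finite I" "\<And>i. i \<in> I \<Longrightarrow> f i holomorphic_on S"
    and "\<And>z. z \<in> S \<Longrightarrow> (\<Prod>i\<in>I. f i z) = 0" and "S \<noteq> {}"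
  shows "\<exists>i\<in>I. \<forall>z\<in>S. f i z = 0"
  using assms(3-5)
proof (induction I rule: finite_induct)
  case empty
  thus ?case using \<open>S \<noteq> {}\<close> by auto
next
  case (insert i I)
  show ?case
  proof (cases "\<forall>z\<in>S. f i z = 0")
    case False
    then obtain w where w: "w \<in> S" "f i w \<noteq> 0" by blast
    have "(\<Prod>i\<in>I. f i z) = 0" if "z \<in> S" for z
      by (rule holomorphic_mult_eq_0[OF S, of "f i" "\<lambda>z. \<Prod>i\<in>I. f i z" w])
         (use insert w that in \<open>auto intro!: holomorphic_intros\<close>)
    thus ?thesis using insert.IH insert.prems by auto
  qed auto
qed

text \<open>The product of \<open>d\<close> with its translates \<open>d (- 1 / (t + j))\<close>, \<open>0 \<le> j < p\<close>, over the cosets of \<open>\<Gamma>\<^sub>0(p)\<close> is invariant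
  under the full modular group. It vanishes at infinity because one factor does and the others are bounded.\<close>

theorem gamma0_zero:
  fixes d :: "complex \<Rightarrow> complex" and p :: nat
  assumes p: "prime p"
    and inv: "\<And>A B C D t. Im t > 0 \<Longrightarrow> A * D - B * C = 1 \<Longrightarrow> int p dvd C \<Longrightarrow>
      d ((of_int A * t + of_int B) / (of_int C * t + of_int D)) = d t"
    and hol: "d holomorphic_on uhp"
    and lim: "\<And>e. e > 0 \<Longrightarrow> \<exists>M. \<forall>t. Im t \<ge> M \<longrightarrow> norm (d t) < e"
    and bd: "\<exists>M B. \<forall>t. Im t \<ge> M \<longrightarrow> norm (d (- 1 / t)) \<le> B"
    and t: "Im t > 0"
  shows "d t = 0"
proof -
  define dj where "dj j t = d (- 1 / (t + of_int j))" for j :: int and t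
  have p0: "p > 0" using p prime_gt_0_nat by blast
  have T: "d (t + 1) = d t" if "Im t > 0" for t
    using inv[OF that, of 1 1 1 0] by simp
  \<comment> \<open>The matrix (1, 0; -p m, 1) lies in Gamma_0(p).\<close>
  have dj_periodic: "dj (j + int p * m) t = dj j t" if t: "Im t > 0" for j m t
  proof -
    define u where "u = t + of_int j"
    have "Im u > 0" using t by (simp add: u_def)
    moreover from this have "u \<noteq> 0" by auto
    ultimately have u: "Im u > 0" "u \<noteq> 0" by simp_all
    have u': "u + of_int (int p * m) \<noteq> 0"
    proof
      assume "u + of_int (int p * m) = 0"
      hence "Im (u + of_int (int p * m)) = Im 0" by (rule arg_cong)
      thus False using u by simp
    qed
    have "d ((of_int 1 * (- 1 / u) + of_int 0) / (of_int (- (int p * m)) * (- 1 / u) + of_int 1)) = d (- 1 / u)"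
      by (rule inv) (use Im_minus_inverse[OF u(1)] in auto)
    also have "(of_int 1 * (- 1 / u) + of_int 0) / (of_int (- (int p * m)) * (- 1 / u) + of_int 1) = - 1 / (u + of_int (int p * m))"
      using u u' by (simp add: divide_simps) (simp add: algebra_simps)
    finally show ?thesis by (simp add: dj_def u_def add_ac)
  qed
  have dj_mod: "dj (j mod int p) t = dj j t" if "Im t > 0" for j t
    using dj_periodic[OF that, of "j mod int p" "j div int p"] by simp
  have nd: "\<not> int p dvd j" if "j \<in> {1..<int p}" for j
    using that by (intro zdvd_not_zless) auto
  have "\<exists>z \<in> {1..<int p}. [j * z = - 1] (mod int p)" if j: "j \<in> {1..<int p}" for j
  proof -
    have "coprime j (int p)"
      using nd[OF j] p by (metis coprime_commute prime_imp_coprime prime_nat_int_transfer)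
    then obtain z where "[j * z = 1] (mod int p)" using cong_solve_coprime_int by blast
    hence "[- (j * z) = - 1] (mod int p)" by (simp only: cong_minus_minus_iff)
    hence z: "[j * (- z) = - 1] (mod int p)" by simp
    have "[j * ((- z) mod int p) = j * (- z)] (mod int p)" by (intro cong_scalar_left) simp
    with z have z': "[j * ((- z) mod int p) = - 1] (mod int p)" by (meson cong_trans)
    have "(- z) mod int p \<noteq> 0"
    proof
      assume "(- z) mod int p = 0"
      hence "[0 = - 1] (mod int p)" using z' by simp
      hence "int p dvd 1" by (simp add: cong_iff_dvd_diff)
      thus False using p not_prime_unit by auto
    qed
    moreover have "0 \<le> (- z) mod int p" "(- z) mod int p < int p" using p0 by auto
    ultimately show ?thesis using z' by (intro bexI[of _ "(- z) mod int p"]) auto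
  qed
  then obtain iv where iv: "\<And>j. j \<in> {1..<int p} \<Longrightarrow> iv j \<in> {1..<int p} \<and> [j * iv j = - 1] (mod int p)"
    by metis
  have iv_iv: "iv (iv j) = j" if j: "j \<in> {1..<int p}" for j
  proof -
    have "[iv j * iv (iv j) = iv j * j] (mod int p)"
      using iv[OF j] iv[of "iv j"] by (metis cong_sym cong_trans mult.commute)
    moreover have "coprime (iv j) (int p)"
      using nd[of "iv j"] iv[OF j] p by (metis coprime_commute prime_imp_coprime prime_nat_int_transfer)
    ultimately have "[iv (iv j) = j] (mod int p)" using cong_mult_lcancel by blast
    thus ?thesis using iv[of "iv j"] iv[OF j] j by (simp add: cong_def)
  qed
  \<comment> \<open>With j * \<open>iv j\<close> = -1 modulo p the matrix (- \<open>iv j\<close>,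
    -1; j * \<open>iv j\<close> + 1, j) lies in Gamma_0(p) and carries one translate to the
    other.\<close>
  have dj_S: "dj j (- 1 / t) = dj (iv j) t" if t: "Im t > 0" and j: "j \<in> {1..<int p}" for j t
  proof -
    define u where "u = t + of_int (iv j)"
    have "Im u > 0" using t by (simp add: u_def)
    moreover from this have "u \<noteq> 0" by auto
    ultimately have u: "Im u > 0" "u \<noteq> 0" by simp_all
    have t0: "t \<noteq> 0" using t by auto
    have w: "Im (- 1 / t + of_int j) > 0" using Im_minus_inverse[OF t] by simp
    have "int p dvd j * iv j + 1" using iv[OF j] by (simp add: cong_iff_dvd_diff)
    moreover have "- iv j * j - (- 1) * (j * iv j + 1) = 1" by (simp add: algebra_simps)
    ultimately have "d ((of_int (- iv j) * (- 1 / u) + of_int (- 1)) / (of_int (j * iv j + 1) * (- 1 / u) + of_int j)) = d (- 1 / u)"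
      by (intro inv Im_minus_inverse u)
    also have "(of_int (- iv j) * (- 1 / u) + of_int (- 1)) / (of_int (j * iv j + 1) * (- 1 / u) + of_int j) = - 1 / (- 1 / t + of_int j)"
    proof -
      have n: "of_int (- iv j) * (- 1 / u) + of_int (- 1) = - t / u"
        using u by (simp add: field_simps) (simp add: u_def algebra_simps)
      have m: "of_int (j * iv j + 1) * (- 1 / u) + of_int j = (of_int j * t - 1) / u"
        using u by (simp add: field_simps) (simp add: u_def algebra_simps)
      have "- 1 / t + of_int j = (of_int j * t - 1) / t" using t0 by (simp add: field_simps)
      thus ?thesis unfolding n m using u t0 by simp
    qed
    finally show ?thesis by (simp add: dj_def u_def)
  qed
  define f where "f t = d t * (\<Prod>j\<in>{0..<int p}. dj j t)" for t
  have dj_uhp: "dj j holomorphic_on uhp" for j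
  proof -
    have "(d \<circ> (\<lambda>t. - 1 / (t + of_int j))) holomorphic_on uhp"
    proof (rule holomorphic_on_compose_gen[OF _ hol])
      have "t + of_int j \<noteq> 0" if "t \<in> uhp" for t
      proof
        assume "t + of_int j = 0"
        hence "Im (t + of_int j) = Im 0" by (rule arg_cong)
        thus False using that by (simp add: uhp_def)
      qed
      thus "(\<lambda>t. - 1 / (t + of_int j)) holomorphic_on uhp" by (intro holomorphic_intros)
      show "(\<lambda>t. - 1 / (t + of_int j)) ` uhp \<subseteq> uhp"
        using Im_minus_inverse by (auto simp: uhp_def)
    qed
    thus ?thesis by (simp add: dj_def [abs_def] o_def)
  qed
  have "f t = 0" if "Im t > 0" for t
  proof (rule modular_zero[OF _ _ _ _ that])
    fix t :: complex assume t: "Im t > 0"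
    have "(\<Prod>j\<in>{0..<int p}. dj j (t + 1)) = (\<Prod>j\<in>{0..<int p}. dj (j + 1) t)"
      by (simp add: dj_def add_ac)
    also have "\<dots> = (\<Prod>j\<in>{0..<int p}. dj j t)"
    proof (rule prod_residues[where f = "\<lambda>j. dj j t"])
      fix i j assume ij: "i \<in> {0..<int p}" "j \<in> {0..<int p}" "[i + 1 = j + 1] (mod int p)"
      hence "[i = j] (mod int p)" by (simp only: cong_add_rcancel)
      thus "i = j" using ij by (simp add: cong_def)
    qed (use p0 dj_mod[OF t] in auto)
    finally show "f (t + 1) = f t" using T[OF t] by (simp add: f_def)
    have split: "{0..<int p} = insert 0 {1..<int p}" using p0 by auto
    have "(\<Prod>j\<in>{1..<int p}. dj j (- 1 / t)) = (\<Prod>j\<in>{1..<int p}. dj j t)"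
      by (rule prod.reindex_bij_witness[of _ iv iv]) (use iv iv_iv dj_S[OF t] in auto)
    moreover have "dj 0 (- 1 / t) = d t" "d (- 1 / t) = dj 0 t"
      using t by (auto simp: dj_def)
    ultimately show "f (- 1 / t) = f t" by (simp add: f_def split)
  next
    show "f holomorphic_on uhp" unfolding f_def [abs_def]
      by (intro holomorphic_intros hol dj_uhp)
  next
    fix e :: real assume e: "e > 0"
    obtain M B where MB: "\<And>t. Im t \<ge> M \<Longrightarrow> norm (d (- 1 / t)) \<le> B" using bd by blast
    define B' where "B' = max B 1"
    have B': "B' > 0" by (simp add: B'_def)
    obtain M' where M': "\<And>t. Im t \<ge> M' \<Longrightarrow> norm (d t) < e / B' ^ p"
      using lim[of "e / B' ^ p"] e B' by auto
    show "\<exists>M. \<forall>t. Im t \<ge> M \<longrightarrow> norm (f t) < e"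
    proof (intro exI allI impI)
      fix t assume t: "Im t \<ge> max M M'"
      have "(\<Prod>j\<in>{0..<int p}. norm (dj j t)) \<le> (\<Prod>j\<in>{0..<int p}. B')"
      proof (intro prod_mono conjI)
        fix j show "norm (dj j t) \<le> B'"
          using MB[of "t + of_int j"] t by (simp add: dj_def B'_def)
      qed auto
      hence P: "(\<Prod>j\<in>{0..<int p}. norm (dj j t)) \<le> B' ^ p" by simp
      have "norm (f t) = norm (d t) * (\<Prod>j\<in>{0..<int p}. norm (dj j t))"
        by (simp add: f_def norm_mult prod_norm)
      also have "\<dots> \<le> norm (d t) * B' ^ p" by (intro mult_left_mono P) auto
      also have "\<dots> < e / B' ^ p * B' ^ p"
        using M'[of t] t B' by (intro mult_strict_right_mono) auto
      also have "\<dots> = e" using B' by simp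
      finally show "norm (f t) < e" .
    qed
  qed
  hence f0: "d t * (\<Prod>j\<in>{0..<int p}. dj j t) = 0" if "t \<in> uhp" for t
    using that by (simp add: f_def uhp_def)
  show ?thesis
  proof (rule ccontr)
    assume "d t \<noteq> 0"
    hence "(\<Prod>j\<in>{0..<int p}. dj j z) = 0" if "z \<in> uhp" for z
      by (intro holomorphic_mult_eq_0[OF uhp_open uhp_connected hol _ f0 _ _ that, of t] holomorphic_intros dj_uhp)
         (use t in \<open>auto simp: uhp_def\<close>)
    hence "\<exists>j\<in>{0..<int p}. \<forall>z\<in>uhp. dj j z = 0"
      using t by (intro holomorphic_prod_eq_0 uhp_open uhp_connected dj_uhp) (auto simp: uhp_def)
    then obtain j where j: "\<And>z. z \<in> uhp \<Longrightarrow> dj j z = 0" by blast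
    \<comment> \<open>The point that the j-th translate sends back to t.\<close>
    define z where "z = - 1 / t - of_int j"
    have "z \<in> uhp" using Im_minus_inverse[OF t] by (simp add: z_def uhp_def)
    hence "d (- 1 / (- 1 / t)) = 0" using j[of z] by (simp add: dj_def z_def)
    thus False using \<open>d t \<noteq> 0\<close> by simp
  qed
qed

section \<open>The Hauptmodul on the upper half plane\<close>

definition Yfun :: "nat \<Rightarrow> nat \<Rightarrow> complex \<Rightarrow> complex" where
  "Yfun p k t = (eta t / eta (of_nat p * t)) ^ k"

text \<open>The locale's prime is now the level. The matrix takes the index (0, 1) to (C, D), which
  is (0, D) modulo l. The k-th power removes the root of unity this costs, because h k = 12 makes k
  * \<open>sqsum\<close> a multiple of l, and, k being even, it removes the sign of
  \<open>sinprod D\<close>.\<close>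

lemma (in odd_prime) eta_quotient_modular:
  assumes k: "k * (l - 1) = 24" "even k"
    and t: "Im t > 0" and det: "A * D - B * C = 1" and C: "int l dvd C"
  defines "t' \<equiv> (of_int A * t + of_int B) / (of_int C * t + of_int D)"
  shows "Yfun l k t' = Yfun l k t"
proof -
  define j where "j = of_int C * t + of_int D"
  have j0: "j \<noteq> 0" and t': "Im t' > 0" using moebius_aux[OF t det] by (simp_all add: j_def t'_def)
  obtain C' where C': "C = int l * C'" using C by blast
  have 1: "\<not> int l dvd 1" using l_gt_2 by simp
  have D: "\<not> int l dvd D"
  proof
    assume "int l dvd D"
    hence "int l dvd A * D - B * C" using C by (intro dvd_diff dvd_mult) auto
    thus False using det 1 by simp
  qed
  have kh: "h * k = 12" using k(1) l_eq by simp
  have "torsion_prod 0 1 t' = torsion_prod C D t / j ^ h"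
    using torsion_prod_modular[OF t det, of 0 1] by (simp add: t'_def j_def)
  also have "torsion_prod C D t = ee (of_int (2 * (- (D * C')) * sqsum) / of_nat l) * torsion_prod 0 D t"
    using torsion_prod_shift[OF t, of 0 C' D 0] by (simp add: C')
  finally have torsion_prod: "torsion_prod 0 1 t' = ee (of_int (2 * (- (D * C')) * sqsum) / of_nat l) * torsion_prod 0 D t / j ^ h" .
  have e: "ee (of_int (2 * (- (D * C')) * sqsum) / of_nat l) ^ k = 1"
  proof -
    have "6 * (int k * sqsum) = int (h * k) * (int h + 1) * int l"
      using sqsum_eq by (simp add: mult_ac)
    also have "\<dots> = 6 * (2 * (int h + 1) * int l)" unfolding kh by simp
    finally have "int k * sqsum = 2 * (int h + 1) * int l" by simp
    hence "of_nat k * of_int sqsum = (of_int (2 * (int h + 1)) * of_nat l :: complex)"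
      by (metis of_int_mult of_int_of_nat_eq)
    moreover have "of_nat k * (of_int (2 * (- (D * C')) * sqsum) / of_nat l) = of_int (2 * (- (D * C'))) * (of_nat k * of_int sqsum) / (of_nat l :: complex)"
      by simp
    ultimately have "of_nat k * (of_int (2 * (- (D * C')) * sqsum) / of_nat l) = (of_int (2 * (- (D * C')) * (2 * (int h + 1))) :: complex)"
      using l_pos by (simp only: of_int_mult) simp
    thus ?thesis unfolding ee_power by (simp only: ee_of_int)
  qed
  have "sinprod D ^ k = sinprod 1 ^ k"
  proof -
    obtain m where m: "k = 2 * m" using k(2) by blast
    show ?thesis unfolding m power_mult sinprod_square[OF D] sinprod_square[OF 1] ..
  qed
  moreover have "sinprod 1 \<noteq> 0" using sinprod_1 l_pos by simp
  moreover have "(torsion_prod 0 1 t') ^ k = (torsion_prod 0 D t) ^ k / j ^ 12"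
    unfolding torsion_prod power_divide power_mult_distrib e by (simp add: kh flip: power_mult)
  ultimately have P: "(eta (of_nat l * t') / eta t' ^ l) ^ k = (eta (of_nat l * t) / eta t ^ l) ^ k / j ^ 12"
    unfolding torsion_prod_0[OF t' 1] torsion_prod_0[OF t D] power_mult_distrib
    by (metis mult_left_cancel power_not_zero times_divide_eq_right)
  have Y: "Yfun l k t * ((eta (of_nat l * t) / eta t ^ l) ^ k * eta t ^ 24) = 1" if "Im t > 0" for t
  proof -
    have "eta t \<noteq> 0" "eta (of_nat l * t) \<noteq> 0" using that l_pos eta_nonzero by auto
    moreover have "eta t ^ k * eta t ^ 24 = (eta t ^ l) ^ k"
    proof -
      \<comment> \<open>This makes (eta(l t) / eta(t)^l)^k eta(t)^24 the reciprocal of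
        \<open>Yfun\<close>.\<close>
      have "k + 24 = l * k" using k(1) l_pos by (simp add: mult.commute algebra_simps diff_mult_distrib2)
      thus ?thesis by (simp flip: power_add power_mult)
    qed
    moreover have "(a / b) ^ k * ((b / a ^ l) ^ k * a ^ 24) = (a ^ k * a ^ 24) / (a ^ l) ^ k" if "b \<noteq> 0" for a b :: complex
      using that by (simp add: power_divide)
    ultimately show ?thesis by (simp add: Yfun_def)
  qed
  have "eta t' ^ 24 = j ^ 12 * eta t ^ 24"
    using eta24_modular[OF t det] by (simp add: t'_def j_def)
  hence Z: "(eta (of_nat l * t') / eta t' ^ l) ^ k * eta t' ^ 24 = (eta (of_nat l * t) / eta t ^ l) ^ k * eta t ^ 24"
    unfolding P using j0 by simp
  have "Yfun l k t' * ((eta (of_nat l * t) / eta t ^ l) ^ k * eta t ^ 24) = Yfun l k t * ((eta (of_nat l * t) / eta t ^ l) ^ k * eta t ^ 24)"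
    using Y[OF t] Y[OF t'] unfolding Z by simp
  moreover have "(eta (of_nat l * t) / eta t ^ l) ^ k * eta t ^ 24 \<noteq> 0"
    using Y[OF t] by (metis mult_zero_right zero_neq_one)
  ultimately show ?thesis using mult_right_cancel by blast
qed

text \<open>p = 2 is not covered by \<open>odd_prime\<close>, but then k = 24 and the law of eta^24
  at t and at 2 t is enough.\<close>

lemma Yfun_modular:
  assumes p: "p \<in> {2, 3, 5, 7, 13}" and k: "k = 24 div (p - 1)"
    and t: "Im t > 0" and det: "A * D - B * C = 1" and C: "int p dvd C"
  shows "Yfun p k ((of_int A * t + of_int B) / (of_int C * t + of_int D)) = Yfun p k t"
proof (cases "p = 2")
  case False
  have "prime p" using p by auto
  interpret odd_prime p "(p - 1) div 2"
    by standard (use p False \<open>prime p\<close> in auto)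
  show ?thesis
    by (rule eta_quotient_modular[OF _ _ t det C]) (use p k False in auto)
next
  case True
  define j where "j = of_int C * t + of_int D"
  define t' where "t' = (of_int A * t + of_int B) / j"
  have j0: "j \<noteq> 0" using moebius_aux[OF t det] by (simp add: j_def)
  obtain C' where C': "C = 2 * C'" using C True by auto
  have det': "A * D - (2 * B) * C' = 1" using det by (simp add: C' mult_ac)
  have t2: "Im (2 * t) > 0" using t by simp
  have "2 * t' = (of_int A * (2 * t) + of_int (2 * B)) / (of_int C' * (2 * t) + of_int D)"
    by (simp add: t'_def j_def C' algebra_simps)
  hence "eta (2 * t') ^ 24 = j ^ 12 * eta (2 * t) ^ 24"
    using eta24_modular[OF t2 det'] by (simp add: j_def C' mult_ac)
  moreover have "eta t' ^ 24 = j ^ 12 * eta t ^ 24"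
    using eta24_modular[OF t det] by (simp add: t'_def j_def)
  ultimately have "Yfun p k t' = Yfun p k t"
    using True k j0 by (simp add: Yfun_def power_divide)
  thus ?thesis by (simp add: t'_def j_def)
qed

text \<open>Towards the cusp 0 the Hauptmodul is a constant divided by a function with a pole, so
  polynomials in it stay bounded there.\<close>

lemma Yfun_minus_inverse:
  assumes p: "p > 0" and t: "Im t > 0"
  shows "Yfun p k (- 1 / t) * Yfun p k (t / of_nat p) = of_real (sqrt (real p)) ^ k"
proof -
  have u: "Im (t / of_nat p) > 0" using p t by (simp add: Im_divide_of_nat)
  have t0: "csqrt (- \<i> * t) \<noteq> 0" using t by auto
  have e: "of_nat p * (- 1 / t) = - of_nat p / t" "of_nat p * (t / of_nat p) = t" using p by simp_all
  have "eta (- 1 / t) / eta (- of_nat p / t) * (eta (t / of_nat p) / eta t) = of_real (sqrt (real p))"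
    unfolding eta_minus_inverse_scaled[OF t p] eta_minus_inverse[OF t]
    using t0 p eta_nonzero[OF t] eta_nonzero[OF u] by (simp add: field_simps)
  thus ?thesis unfolding Yfun_def e by (simp flip: power_mult_distrib)
qed

section \<open>The Faber polynomials\<close>

lemma delta_q_nth: "delta_q f $$ n = of_int n * f $$ n"
  by (simp add: delta_q_def fls_X_times_conv_shift)

lemma delta_q_mult: "delta_q (f * g) = delta_q f * g + f * delta_q (g :: 'a :: comm_ring_1 fls)"
  by (simp add: delta_q_def fls_deriv_mult algebra_simps)

lemma delta_q_power: "delta_q (f ^ Suc n) = of_nat (Suc n) * f ^ n * delta_q (f :: 'a :: comm_ring_1 fls)"
proof (induction n)
  case (Suc n)
  have "delta_q (f ^ Suc (Suc n)) = delta_q f * f ^ Suc n + f * delta_q (f ^ Suc n)"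
    by (simp only: power_Suc[of f "Suc n"] delta_q_mult)
  also have "\<dots> = of_nat (Suc (Suc n)) * f ^ Suc n * delta_q f"
    unfolding Suc.IH by (simp add: algebra_simps)
  finally show ?case .
qed simp

text \<open>(n + 1) f^n \<open>delta_q f\<close> is the derivative of f^(n+1), and a derivative
  under \<open>delta_q\<close> has no constant term.\<close>

lemma power_delta_q_nth_0: "(f ^ n * delta_q (f :: complex fls)) $$ 0 = 0"
proof -
  have "of_nat (Suc n) * (f ^ n * delta_q f) = delta_q (f ^ Suc n)"
    by (simp only: delta_q_power mult.assoc)
  hence "(fls_const (of_nat (Suc n)) * (f ^ n * delta_q f)) $$ 0 = delta_q (f ^ Suc n) $$ 0"
    by (simp only: fls_of_nat)
  hence "of_nat (Suc n) * (f ^ n * delta_q f) $$ 0 = delta_q (f ^ Suc n) $$ 0"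
    by (simp only: fls_mult_const_nth)
  thus ?thesis by (simp add: delta_q_nth del: of_nat_Suc)
qed

lemma sum_fps_to_fls: "fps_to_fls (\<Sum>i\<in>A. f i) = (\<Sum>i\<in>A. fps_to_fls (f i))"
  by (induction A rule: infinite_finite_induct) auto

locale hauptmodul =
  fixes p k :: nat
  assumes p: "p > 0"
begin

definition Yf :: "complex fls" where "Yf = Phi_inv p k"

definition Zf :: "complex fls" where "Zf = fps_to_fls (Phi p k)"

definition Ef :: "complex fps" where "Ef = euler_fps 1 ^ k * inverse (euler_fps p) ^ k"

lemma YZ: "Yf * Zf = 1"
  unfolding Yf_def Zf_def by (rule Phi_inv_times_Phi[OF p])

lemma Yf_eq: "Yf = fls_X_inv * fps_to_fls Ef"
  unfolding Yf_def Ef_def by (rule Phi_inv_euler[OF p])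

lemma Ef_0: "Ef $ 0 = 1"
  using euler_fps_0[OF p] euler_fps_0[of 1] by (simp add: Ef_def fps_mult_nth fps_power_zeroth)

lemma Yf_nth: "Yf $$ n = fps_to_fls Ef $$ (n + 1)"
  by (simp add: Yf_eq fls_X_inv_times_conv_shift)

lemma Yf_power: "Yf ^ n = fls_shift (int n) (fps_to_fls (Ef ^ n))"
  by (simp add: Yf_eq power_mult_distrib fps_to_fls_power fls_X_inv_power_times_conv_shift)

lemma Yf_power_mult_nth:
  assumes "i \<le> - int n"
  shows "(Yf ^ n * fps_to_fls g) $$ i = (if i = - int n then g $ 0 else 0)"
proof -
  have "Yf ^ n * fps_to_fls g = fls_shift (int n) (fps_to_fls (Ef ^ n * g))"
    by (simp add: Yf_power fls_times_fps_to_fls fls_shifted_times_simps)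
  thus ?thesis using assms by (auto simp: fps_power_zeroth Ef_0)
qed

text \<open>The constant term of a logarithmic derivative is the order, here that of a simple
  pole.\<close>

lemma delta_Yf_Zf_nth_0: "(delta_q Yf * Zf) $$ 0 = - 1"
proof -
  have "delta_q Yf = - Yf + fls_X_inv * delta_q (fps_to_fls Ef)"
  proof (rule fls_eqI)
    fix n
    have "(fls_X_inv * delta_q (fps_to_fls Ef)) $$ n = of_int (n + 1) * fps_to_fls Ef $$ (n + 1)"
      by (simp add: fls_X_inv_times_conv_shift delta_q_nth)
    thus "delta_q Yf $$ n = (- Yf + fls_X_inv * delta_q (fps_to_fls Ef)) $$ n"
      by (simp only: delta_q_nth Yf_nth fls_plus_nth fls_uminus_nth) (simp add: algebra_simps)
  qed
  hence "delta_q Yf * Zf = - (Yf * Zf) + delta_q (fps_to_fls Ef) * (fls_X_inv * Zf)"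
    by (simp only: distrib_right distrib_left mult_minus_left mult_minus_right mult_ac)
  hence "delta_q Yf * Zf = - 1 + delta_q (fps_to_fls Ef) * (fls_X_inv * Zf)"
    by (simp only: YZ)
  moreover have "(delta_q (fps_to_fls Ef) * (fls_X_inv * Zf)) $$ 0 = 0"
  proof -
    have "delta_q (fps_to_fls Ef) = fps_to_fls (fps_X * fps_deriv Ef)"
      by (simp add: delta_q_def fls_deriv_fps_to_fls fls_times_fps_to_fls)
    moreover have "fls_X_inv * Zf = fps_to_fls (\<Prod>n. (1 - fps_X ^ (p * Suc n)) ^ k / (1 - fps_X ^ Suc n) ^ k)"
      by (simp add: Zf_def Phi_def fls_times_fps_to_fls fls_X_inv_times_conv_shift fls_X_times_conv_shift)
    ultimately show ?thesis by (simp flip: fls_times_fps_to_fls)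
  qed
  ultimately show ?thesis by simp
qed

lemma delta_Zf: "delta_q Yf * Zf ^ 2 = - delta_q Zf"
proof -
  have "delta_q (Yf * Zf) = 0" unfolding YZ by (rule fls_eqI) (simp add: delta_q_nth)
  hence "delta_q Yf * Zf + Yf * delta_q Zf = 0" by (simp only: delta_q_mult)
  hence "(delta_q Yf * Zf + Yf * delta_q Zf) * Zf = 0" by simp
  hence "delta_q Yf * Zf ^ 2 + (Yf * Zf) * delta_q Zf = 0" by (simp add: algebra_simps power2_eq_square)
  thus ?thesis unfolding YZ by (simp add: eq_neg_iff_add_eq_0)
qed

text \<open>For i > j the product is Y^n delta(Y) and for i < j it is - Z^n delta(Z), both exact; i
  = j gives the logarithmic derivative of Y.\<close>

lemma residue_pairing: "(Yf ^ i * delta_q Yf * Zf ^ Suc j) $$ 0 = (if i = j then - 1 else 0)"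
proof -
  have YZn: "Yf ^ n * Zf ^ n = 1" for n by (simp add: YZ flip: power_mult_distrib)
  consider "i = j" | "j < i" | "i < j" by linarith
  thus ?thesis
  proof cases
    case 1
    have "Yf ^ i * delta_q Yf * Zf ^ Suc i = (Yf ^ i * Zf ^ i) * (delta_q Yf * Zf)"
      by (simp add: mult_ac)
    thus ?thesis using 1 by (simp only: YZn mult_1 delta_Yf_Zf_nth_0) simp
  next
    case 2
    then obtain n where n: "i = Suc j + n" using less_imp_Suc_add by auto
    have "Yf ^ i * delta_q Yf * Zf ^ Suc j = (Yf ^ Suc j * Zf ^ Suc j) * (Yf ^ n * delta_q Yf)"
      unfolding n power_add by (simp only: mult_ac)
    thus ?thesis using 2 by (simp only: YZn mult_1 power_delta_q_nth_0) simp
  next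
    case 3
    then obtain n where n: "j = Suc (i + n)" using less_imp_Suc_add by auto
    have "Zf ^ Suc j = Zf ^ i * Zf ^ n * Zf ^ 2"
      by (simp add: n power_add power2_eq_square mult_ac)
    hence "Yf ^ i * delta_q Yf * Zf ^ Suc j = (Yf ^ i * Zf ^ i) * (Zf ^ n * (delta_q Yf * Zf ^ 2))"
      by (simp only: mult_ac)
    also have "\<dots> = - (Zf ^ n * delta_q Zf)" by (simp only: YZn mult_1 delta_Zf) simp
    finally show ?thesis using 3 by (simp only: fls_uminus_nth power_delta_q_nth_0) simp
  qed
qed

lemma fls_lift_add: "fls_lift (f + g) = fls_lift f + fls_lift g"
  by (rule fls_eqI) simp

lemma fls_lift_power: "fls_lift (f ^ n) = fls_lift f ^ n"
proof (induction n)
  case 0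
  show ?case by (rule fls_eqI) simp
qed (simp add: fls_lift_mult)

text \<open>\<open>L\<close> begins at q^(-N) or later, and after removal of the terms j \<le> N the
  kernel begins beyond q^N; so only finitely many residue pairings reach the constant term.\<close>

lemma kernel_pairing: "(fls_lift (Yf ^ i * delta_q Yf) * fps_to_fls (kernel p k)) $$ 0 = Polynomial.monom 1 i"
proof -
  define N where "N = Suc i"
  define L where "L = Yf ^ i * delta_q Yf"
  define tt where "tt j = fps_const (Polynomial.monom 1 j) * fps_lift (Phi p k) ^ (j + 1)" for j :: nat
  define R where "R = kernel p k + (\<Sum>j<Suc N. tt j)"
  have R0: "R $ n = 0" if "n \<le> Suc N" for n
    using fps_sums(2)[of tt n "Suc N"] that kernel_term_nth[of _ _ p k] unfolding tt_def R_def kernel_def by simp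
  have L0: "L $$ n = 0" if "n < - int N" for n
  proof -
    have "of_nat (Suc i) * L = delta_q (Yf ^ Suc i)"
      by (simp only: delta_q_power L_def mult.assoc)
    hence "(fls_const (of_nat (Suc i)) * L) $$ n = delta_q (Yf ^ Suc i) $$ n"
      by (simp only: fls_of_nat)
    moreover have "(Yf ^ Suc i) $$ n = 0"
      using Yf_power_mult_nth[of n "Suc i" 1] that by (simp add: N_def)
    ultimately show ?thesis by (simp add: delta_q_nth del: of_nat_Suc)
  qed
  have "(fls_lift L * fps_to_fls R) $$ 0 = 0"
  proof (cases "fls_lift L = 0 \<or> R = 0")
    case False
    have "fls_subdegree (fls_lift L) \<ge> - int N"
      using False L0 by (intro fls_subdegree_geI) auto
    moreover have "fls_subdegree (fps_to_fls R) > int N"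
    proof -
      have "subdegree R > N" using False R0 by (metis leI le_SucI nth_subdegree_nonzero)
      thus ?thesis by (simp add: fls_subdegree_fls_to_fps)
    qed
    ultimately show ?thesis by (intro fls_times_nth_eq0) linarith
  qed auto
  moreover have "fps_to_fls (kernel p k) = fps_to_fls R - (\<Sum>j<Suc N. fps_to_fls (tt j))"
    by (simp add: R_def sum_fps_to_fls)
  ultimately have "(fls_lift L * fps_to_fls (kernel p k)) $$ 0 = - (\<Sum>j<Suc N. (fls_lift L * fps_to_fls (tt j)) $$ 0)"
    by (simp add: right_diff_distrib sum_distrib_left fls_nth_sum del: sum.lessThan_Suc)
  also have "(\<Sum>j<Suc N. (fls_lift L * fps_to_fls (tt j)) $$ 0) = (\<Sum>j<Suc N. if j = i then - Polynomial.monom 1 i else 0)"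
  proof (intro sum.cong refl)
    fix j
    have "fps_to_fls (tt j) = fls_const (Polynomial.monom 1 j) * fls_lift (Zf ^ Suc j)"
      by (simp add: tt_def fls_times_fps_to_fls fps_to_fls_power fps_to_fls_lift Zf_def fls_lift_power fls_lift_mult)
    hence "fls_lift L * fps_to_fls (tt j) = fls_const (Polynomial.monom 1 j) * fls_lift (L * Zf ^ Suc j)"
      by (simp only: fls_lift_mult mult_ac)
    hence "(fls_lift L * fps_to_fls (tt j)) $$ 0 = Polynomial.monom 1 j * [:(L * Zf ^ Suc j) $$ 0:]"
      by (simp only: fls_mult_const_nth fls_lift_nth)
    also have "(L * Zf ^ Suc j) $$ 0 = (if i = j then - 1 else 0)"
      unfolding L_def by (rule residue_pairing)
    finally show "(fls_lift L * fps_to_fls (tt j)) $$ 0 = (if j = i then - Polynomial.monom 1 i else 0)"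
      by (auto simp: smult_monom minus_monom)
  qed
  also have "- \<dots> = Polynomial.monom 1 i"
    by (simp add: N_def)
  finally show ?thesis by (simp add: L_def)
qed

lemma eval_poly_fls_pCons: "eval_poly_fls (pCons a P) f = fls_const a + f * eval_poly_fls P f"
  by (simp add: eval_poly_fls_def map_poly_pCons)

lemma eval_poly_fls_add: "eval_poly_fls (P + Q) f = eval_poly_fls P f + eval_poly_fls Q f"
proof -
  have "map_poly fls_const (P + Q) = map_poly fls_const P + map_poly fls_const Q"
    by (rule poly_eqI) (simp add: coeff_map_poly fls_plus_const)
  thus ?thesis by (simp add: eval_poly_fls_def)
qed

text \<open>The extra power Y^i lets the induction over \<open>pCons\<close> absorb the factor
  Y.\<close>

lemma kernel_pairing_poly: "(fls_lift (Yf ^ i * eval_poly_fls P Yf * delta_q Yf) * fps_to_fls (kernel p k)) $$ 0 = Polynomial.monom 1 i * P"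
proof (induction P arbitrary: i)
  case 0
  have "fls_lift 0 = 0" by (rule fls_eqI) simp
  thus ?case by (simp add: eval_poly_fls_def)
next
  case (pCons a P)
  have "fls_lift (Yf ^ i * eval_poly_fls (pCons a P) Yf * delta_q Yf) =
      fls_lift (fls_const a) * fls_lift (Yf ^ i * delta_q Yf) + fls_lift (Yf ^ Suc i * eval_poly_fls P Yf * delta_q Yf)"
    unfolding fls_lift_mult[symmetric] fls_lift_add[symmetric] eval_poly_fls_pCons
    by (rule arg_cong[where f = fls_lift]) (simp add: algebra_simps)
  also have "fls_lift (fls_const a) = fls_const [:a:]"
    by (rule fls_eqI) simp
  finally have "(fls_lift (Yf ^ i * eval_poly_fls (pCons a P) Yf * delta_q Yf) * fps_to_fls (kernel p k)) $$ 0 =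
     [:a:] * (fls_lift (Yf ^ i * delta_q Yf) * fps_to_fls (kernel p k)) $$ 0
       + (fls_lift (Yf ^ Suc i * eval_poly_fls P Yf * delta_q Yf) * fps_to_fls (kernel p k)) $$ 0"
    by (simp only: distrib_right fls_plus_nth mult.assoc fls_mult_const_nth)
  also have "\<dots> = [:a:] * Polynomial.monom 1 i + Polynomial.monom 1 (Suc i) * P"
    by (simp only: kernel_pairing pCons.IH)
  also have "\<dots> = Polynomial.monom 1 i * pCons a P"
    by (simp add: monom_Suc)
  finally show ?case .
qed

text \<open>Here \<open>fls_shift (int m) 1\<close> is \<open>q\<^bsup>-m\<^esup>\<close>. Multiplying the assumption by the generating series of the
  \<open>frakB n\<close> leaves the constant term \<open>frakB m - P\<close>, by \<open>kernel_pairing_poly\<close>.\<close>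

lemma frakB_eqI:
  assumes P: "\<And>n. n \<le> 0 \<Longrightarrow> (fls_shift (int m) 1 - eval_poly_fls P Yf * fps_to_fls (phi_star p r s)) $$ n = 0"
  shows "frakB p k r s m = P"
proof -
  define phi where "phi = fps_to_fls (phi_star p r s)"
  define W where "W = fls_lift (delta_q Yf / phi) * fps_to_fls (kernel p k)"
  have W: "W = fps_to_fls (Abs_fps (frakB p k r s))"
    using frakB_generating_series[OF p, of k r s] by (simp add: W_def Yf_def phi_def)
  have phi0: "phi \<noteq> 0" using phi_star_nth_0[OF p, of r s] by (auto simp: phi_def)
  define D where "D = fls_shift (int m) 1 - eval_poly_fls P Yf * phi"
  have "(fls_lift D * W) $$ 0 = 0"
  proof (cases "fls_lift D = 0 \<or> W = 0")
    case False
    have "D \<noteq> 0" using False by (metis fls_lift_nth fls_eqI fls_zero_nth pCons_0_0 )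
    have "fls_subdegree (fls_lift D) \<ge> 1"
      using False P by (intro fls_subdegree_geI) (auto simp: D_def phi_def)
    moreover have "fls_subdegree W \<ge> 0" unfolding W by (rule fls_subdegree_fls_to_fps_gt0)
    ultimately show ?thesis by (intro fls_times_nth_eq0) linarith
  qed auto
  moreover have "fls_lift (fls_shift (int m) 1) = fls_lift D + fls_lift (eval_poly_fls P Yf * phi)"
    by (simp add: D_def flip: fls_lift_add)
  ultimately have "(fls_lift (fls_shift (int m) 1) * W) $$ 0 = (fls_lift (eval_poly_fls P Yf * phi) * W) $$ 0"
    by (simp only: distrib_right fls_plus_nth add_0_left)
  also have "fls_lift (eval_poly_fls P Yf * phi) * W = fls_lift (Yf ^ 0 * eval_poly_fls P Yf * delta_q Yf) * fps_to_fls (kernel p k)"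
    unfolding W_def mult.assoc[symmetric] fls_lift_mult[symmetric] using phi0 by simp
  also have "\<dots> $$ 0 = P" unfolding kernel_pairing_poly by simp
  finally have "(fls_lift (fls_shift (int m) 1) * W) $$ 0 = P" .
  moreover have "fls_lift (fls_shift (int m) 1) = fls_shift (int m) 1"
    by (rule fls_eqI) auto
  ultimately have "W $$ int m = P" by (simp add: fls_shifted_times_simps)
  thus ?thesis by (simp add: W)
qed

text \<open>Poles are removed one order at a time: since g(0) = 1, the leading term of Y^N g is
  q^(-N).\<close>

lemma faber_exists:
  fixes g :: "complex fps"
  assumes g: "g $ 0 = 1" and "\<And>n. n < 1 - int N \<Longrightarrow> F $$ n = 0"
  shows "\<exists>P. \<forall>n\<le>0. (F - eval_poly_fls P Yf * fps_to_fls g) $$ n = 0"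
  using assms(2)
proof (induction N arbitrary: F)
  case 0
  show ?case by (rule exI[of _ 0]) (use 0 in \<open>auto simp: eval_poly_fls_def\<close>)
next
  case (Suc N)
  define c where "c = F $$ (- int N)"
  define F' where "F' = F - fls_const c * (Yf ^ N * fps_to_fls g)"
  have "F' $$ n = 0" if "n < 1 - int N" for n
  proof (cases "n = - int N")
    case True
    thus ?thesis using Yf_power_mult_nth[of n N g] g by (simp add: F'_def c_def fls_mult_const_nth)
  next
    case False
    thus ?thesis using Yf_power_mult_nth[of n N g] Suc.prems[of n] that by (simp add: F'_def fls_mult_const_nth)
  qed
  then obtain P where P: "\<forall>n\<le>0. (F' - eval_poly_fls P Yf * fps_to_fls g) $$ n = 0"
    using Suc.IH[of F'] by blast
  have monom: "eval_poly_fls (Polynomial.monom c N) Yf = fls_const c * Yf ^ N"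
    by (simp add: eval_poly_fls_def map_poly_monom poly_monom)
  have "F - eval_poly_fls (P + Polynomial.monom c N) Yf * fps_to_fls g = F' - eval_poly_fls P Yf * fps_to_fls g"
    unfolding eval_poly_fls_add monom F'_def by (simp add: algebra_simps)
  thus ?case using P by metis
qed

end

section \<open>Comparison of the two sides\<close>

text \<open>If a / b is a' / b' in lowest terms, then a b' = a' b, so a b and a' b' differ by
  squares of integers prime to l.\<close>

lemma Legendre_rat_divide:
  assumes l: "prime l" "l > 2" and a: "\<not> int l dvd a" and b: "\<not> int l dvd b"
  shows "Legendre_rat (of_int a / of_int b) (int l) = Legendre (a * b) (int l)"
proof -
  have prime: "prime (int l)" using l by simp
  define x :: rat where "x = of_int a / of_int b"
  obtain a' b' where q: "quotient_of x = (a', b')" by force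
  have x': "x = of_int a' / of_int b'" and b'0: "b' > 0" and cop: "coprime a' b'"
    using quotient_of_div[OF q] quotient_of_denom_pos[OF q] quotient_of_coprime[OF q] by auto
  have b0: "b \<noteq> 0" using b by auto
  have "of_int (a * b') = (of_int (a' * b) :: rat)"
    using x' b0 b'0 unfolding x_def by (simp add: field_simps)
  hence eq: "a * b' = a' * b" by (simp only: of_int_eq_iff)
  have b': "\<not> int l dvd b'"
  proof
    assume d: "int l dvd b'"
    hence "int l dvd a * b'" by (rule dvd_mult)
    hence "int l dvd a' * b" unfolding eq .
    hence "int l dvd a'" using b prime_dvd_mult_iff[OF prime, of a' b] by simp
    hence "int l dvd 1" using d cop coprime_common_divisor[of a' b' "int l"] by simp
    thus False using l by simp
  qed
  have "Legendre (a' * b') (int l) * (Legendre b (int l) * Legendre b (int l)) = Legendre ((a' * b) * (b' * b)) (int l)"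
    by (simp only: Legendre_mult[OF l] mult_ac)
  also have "(a' * b) * (b' * b) = (a * b) * (b' * b')" unfolding eq[symmetric] by simp
  also have "Legendre ((a * b) * (b' * b')) (int l) = Legendre (a * b) (int l) * (Legendre b' (int l) * Legendre b' (int l))"
    by (simp only: Legendre_mult[OF l] mult_ac)
  finally have "Legendre (a' * b') (int l) = Legendre (a * b) (int l)"
    by (simp only: Legendre_square[OF l b] Legendre_square[OF l b'] mult_1_right)
  thus ?thesis unfolding Legendre_rat_def x_def[symmetric] q by simp
qed

lemma has_laurent_expansion_poly:
  assumes "f has_laurent_expansion F"
  shows "(\<lambda>x. poly P (f x)) has_laurent_expansion eval_poly_fls P F"
proof (induction P)
  case 0
  show ?case by (simp add: eval_poly_fls_def)
next
  case (pCons a P)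
  have "eval_poly_fls (pCons a P) F = fls_const a + F * eval_poly_fls P F"
    by (simp add: eval_poly_fls_def map_poly_pCons)
  thus ?case using pCons.IH assms by (auto intro!: laurent_expansion_intros)
qed

context odd_prime
begin

lemma Legendre_minus_1: "Legendre (- 1) (int l) = (- 1) ^ h"
proof (rule cong_values_eq[OF _ l_gt_2 Legendre_values])
  show "[Legendre (- 1) (int l) = (- 1) ^ h] (mod int l)"
    using euler_criterion[OF prime_l l_gt_2, of "-1"] l_eq by simp
  show "(- 1 :: int) ^ h \<in> {- 1, 0, 1}" by (cases "even h") auto
qed

lemma Legendre_power:
  "Legendre (a ^ n) (int l) = Legendre a (int l) ^ n"
proof (induction n)
  case 0
  show ?case using Legendre_1[of l] l_gt_2 by simp
qed (simp add: Legendre_mult[OF prime_l l_gt_2])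

end

section \<open>The Fricke involution and the constant of the middle term\<close>

context hecke
begin

lemma hecke_swap: "hecke l h p s r"
  using p_pos p_ndvd odd_rs by unfold_locales (auto simp: add.commute)

text \<open>The involution sends (x, y) to (p y, -x). With u = t / p the factors at t and at p t
  trade places, once scaling by the unit p has changed (y, -x) into (p y, - p x).\<close>

theorem hecke_sum_fricke:
  assumes t: "Im t > 0"
  shows "hecke_sum (- 1 / t) = hecke.hecke_sum l h p s r (t / of_nat p)"
proof -
  interpret sw: hecke l h p s r by (rule hecke_swap)
  define N where "N = int (l ^ 2)"
  have N: "N > 0" using l_pos by (simp add: N_def)
  have dvdN: "int l dvd x mod N \<longleftrightarrow> int l dvd x" for x using l_dvd_mod_square by (simp add: N_def)
  define u where "u = t / of_nat p"
  have u: "Im u > 0" using t p_pos by (simp add: u_def Im_divide_of_nat)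
  have pu: "of_nat p * u = t" using p_pos by (simp add: u_def)
  have t': "Im (- 1 / t) > 0" by (rule Im_minus_inverse[OF t])
  have S: "torsion_unit x y (- 1 / z) = torsion_unit y (- x) z" if "Im z > 0" for x y z
    using torsion_unit_modular[OF that, of 0 0 "-1" 1 x y] by simp
  have term_eq: "term_at x y (- 1 / t) = sw.term_at (int p * y) (- x) u" if xy: "\<not> (int l dvd x \<and> int l dvd y)" for x y
  proof -
    have "of_nat p * (- 1 / t) = - 1 / u" using p_pos by (simp add: u_def)
    hence "torsion_unit x (int p * y) (of_nat p * (- 1 / t)) = torsion_unit (int p * y) (- x) u" using S[OF u] by simp
    moreover have "torsion_unit (int p * y) (int p * (- x)) t = torsion_unit y (- x) t"
      by (rule torsion_unit_scale'[OF t]) (use xy p_ndvd in auto)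
    ultimately show ?thesis
      unfolding term_at_def sw.term_at_def pu S[OF t] by (simp add: mult.commute)
  qed
  define g where "g = (\<lambda>(x, y). ((int p * y) mod N, (- x) mod N))"
  have mem: "g z \<in> prim_pairs" if "z \<in> prim_pairs" for z
  proof -
    obtain x y where z: "z = (x, y)" by (cases z)
    have "\<not> (int l dvd int p * y \<and> int l dvd x)" using that ndvd_p[of y] by (auto simp: z prim_pairs_def)
    thus ?thesis using N unfolding z g_def prim_pairs_def N_def[symmetric] by (simp add: dvdN)
  qed
  have inj: "inj_on g prim_pairs"
  proof (rule inj_onI, clarify)
    fix x y x' y' assume xy: "(x, y) \<in> prim_pairs" "(x', y') \<in> prim_pairs" "g (x, y) = g (x', y')"
    hence c: "[int p * y = int p * y'] (mod N)" "[- x = - x'] (mod N)"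
      by (auto simp: g_def cong_def)
    have "\<not> int l dvd int p" using p_ndvd by simp
    hence "[y = y'] (mod N)" using c(1) cong_mult_lcancel coprime_square unfolding N_def by blast
    moreover have "[x = x'] (mod N)" using c(2) by (simp only: cong_minus_minus_iff)
    ultimately show "x = x' \<and> y = y'" using xy by (auto simp: prim_pairs_def cong_def N_def)
  qed
  have bij: "bij_betw g prim_pairs prim_pairs"
    using inj mem by (simp add: bij_betw_def endo_inj_surj finite_prim_pairs image_subsetI)
  have "of_nat (l * (l - 1)) * hecke_sum (- 1 / t) = (\<Sum>(x, y)\<in>prim_pairs. term_at x y (- 1 / t))"
    by (rule sum_prim_pairs_eq[OF t', symmetric])
  also have "\<dots> = (\<Sum>z\<in>prim_pairs. (case g z of (x, y) \<Rightarrow> sw.term_at x y u))"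
  proof (intro sum.cong refl, clarify)
    fix x y assume xy: "(x, y) \<in> prim_pairs"
    hence "\<not> (int l dvd x \<and> int l dvd y)" by (auto simp: prim_pairs_def)
    hence "term_at x y (- 1 / t) = sw.term_at (int p * y) (- x) u" by (rule term_eq)
    also have "\<dots> = sw.term_at ((int p * y) mod N) ((- x) mod N) u"
      by (rule sw.term_at_cong[OF u]) (simp_all add: N_def cong_def)
    finally show "term_at x y (- 1 / t) = (case g (x, y) of (x, y) \<Rightarrow> sw.term_at x y u)"
      by (simp add: g_def)
  qed
  also have "\<dots> = (\<Sum>z\<in>prim_pairs. (case z of (x, y) \<Rightarrow> sw.term_at x y u))"
    by (rule sum.reindex_bij_betw[OF bij])
  also have "\<dots> = of_nat (l * (l - 1)) * sw.hecke_sum u"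
    using sw.sum_prim_pairs_eq[OF u] by (simp add: sw.prim_pairs_def prim_pairs_def)
  finally show ?thesis using l_gt_3 by (simp add: u_def)
qed

text \<open>The coefficient of the last term of the Hecke sum, which is 1 in
  \<open>G_star\<close>.\<close>

definition norm_const :: complex where "norm_const = sgn_h * of_nat l powi (r + s)"

lemma norm_const_nonzero: "norm_const \<noteq> 0"
  using l_pos by (simp add: norm_const_def sgn_h_def)

text \<open>K is a square root of (-1/l) l, and the Gauss sum is K (2/l). As r + s = 1 - 2 m, the
  product K^(r+s) K is the integral power (K^2)^(1-m). Its sign, with (2/l) and the symbol of p^r,
  makes up the symbol of theta*, apart from the sign in \<open>norm_const\<close>.\<close>

lemma theta_factor_eq:
  assumes r: "r < 0"
  shows "theta_factor p r s l * norm_const = factorB"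
proof -
  define m where "m = half_minus_eps r s"
  define n where "n = nat (- r)"
  define L2 where "L2 = Legendre 2 (int l)"
  define Lp where "Lp = Legendre (int p) (int l)"
  have rs: "r + s = 1 - 2 * m" using odd_rs by (simp add: m_def half_minus_eps_def)
  have rn: "r = - int n" using r by (simp add: n_def)
  have pnd: "\<not> int l dvd int p" using p_ndvd by simp
  define e :: int where "e = (if even m then 1 else - 1)"
  have e: "(-1) powi m = (of_int e :: rat)" "(-1) powi m = (of_int e :: complex)"
    by (simp_all add: e_def power_int_minus_left)
  have Le: "Legendre e (int l) = (if even m then 1 else (- 1) ^ h)"
    using Legendre_1[of l] l_gt_2 Legendre_minus_1 by (simp add: e_def)
  have "theta_star p r s = of_int (e * 2) / of_int (int p ^ n)"
  proof -
    have "(of_nat p :: rat) powi r = inverse (of_nat p ^ n)" by (simp add: rn power_int_minus)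
    thus ?thesis unfolding theta_star_def m_def[symmetric] e(1) by (simp add: divide_inverse)
  qed
  moreover have "\<not> int l dvd e * 2" using not_dvd_2 by (auto simp: e_def)
  moreover have "\<not> int l dvd int p ^ n" using pnd prime_dvd_power[OF prime_int_l] by blast
  ultimately have "Legendre_rat (theta_star p r s) (int l) = Legendre ((e * 2) * int p ^ n) (int l)"
    using Legendre_rat_divide[OF prime_l l_gt_2] by metis
  also have "\<dots> = Legendre e (int l) * L2 * Lp ^ n"
    by (simp only: Legendre_mult[OF prime_l l_gt_2] Legendre_power L2_def Lp_def)
  also have "of_int \<dots> = sgn_h powi m * of_int L2 * of_int Lp powi r"
  proof -
    have "of_int Lp powi r = (of_int Lp ^ n :: complex)"
    proof -
      have "Lp = 1 \<or> Lp = - 1"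
        using Legendre_values[of "int p" "int l"] pnd Legendre_eq_0_iff[of "int p" "int l"] by (auto simp: Lp_def)
      thus ?thesis by (auto simp: rn power_int_minus simp flip: power_inverse)
    qed
    moreover have "sgn_h powi m = of_int (Legendre e (int l))"
      unfolding Le sgn_h_def by (cases "even h") auto
    ultimately show ?thesis by simp
  qed
  finally have th: "theta_factor p r s l = sgn_h powi m * of_int L2 * of_int Lp powi r * of_nat l powi m"
    by (simp add: theta_factor_def m_def)
  define K :: complex where "K = (- \<i>) ^ h * of_real (sqrt (real l))"
  have sqrt2: "of_real (sqrt (real l)) * of_real (sqrt (real l)) = (of_nat l :: complex)"
    by (metis of_nat_0_le_iff of_real_mult of_real_of_nat_eq real_sqrt_mult_self abs_of_nonneg)
  have i2: "(- \<i>) ^ h * (- \<i>) ^ h = sgn_h"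
    by (simp add: sgn_h_def flip: power_mult_distrib)
  have K2: "K * K = sgn_h * of_nat l"
  proof -
    have "K * K = ((- \<i>) ^ h * (- \<i>) ^ h) * (of_real (sqrt (real l)) * of_real (sqrt (real l)))"
      unfolding K_def by (simp only: mult_ac)
    thus ?thesis unfolding sqrt2 i2 .
  qed
  have K0: "K \<noteq> 0" using l_pos by (simp add: K_def)
  have l0: "(of_nat l :: complex) \<noteq> 0" using l_pos by simp
  have s0: "sgn_h \<noteq> 0" by (simp add: sgn_h_def)
  have "K powi (r + s) = K * (K * K) powi (- m)"
    unfolding rs using K0 by (simp add: power_int_diff power_int_minus power_int_mult power2_eq_square divide_inverse)
  also have "\<dots> = K * (sgn_h powi (- m) * of_nat l powi (- m))"
    unfolding K2 by (simp only: power_int_mult_distrib)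
  finally have "factorB = of_int Lp powi r * (K * (sgn_h powi (- m) * of_nat l powi (- m))) * (K * of_int L2)"
    unfolding factorB_def gauss_sum_eq by (simp only: K_def Lp_def L2_def mult_ac)
  also have "\<dots> = (K * K) * of_int Lp powi r * of_int L2 * sgn_h powi (- m) * of_nat l powi (- m)"
    by (simp only: mult_ac)
  also have "\<dots> = sgn_h * of_nat l * of_int Lp powi r * of_int L2 * sgn_h powi (- m) * of_nat l powi (- m)"
    by (simp only: K2)
  also have "sgn_h powi (- m) = sgn_h powi m"
    by (cases "even h"; cases "even m") (simp_all add: sgn_h_def power_int_minus)
  also have "sgn_h * of_nat l * of_int Lp powi r * of_int L2 * sgn_h powi m * of_nat l powi (- m) =
    theta_factor p r s l * norm_const"
  proof -
    have "(of_nat l :: complex) * of_nat l powi (- m) = of_nat l powi m * of_nat l powi (r + s)"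
    proof -
      have "m + (r + s) = 1 + - m" using rs by simp
      thus ?thesis using l0 by (metis power_int_1_right power_int_add)
    qed
    hence "sgn_h * (of_nat l * of_nat l powi (- m)) * of_int Lp powi r * of_int L2 * sgn_h powi m =
      sgn_h * (of_nat l powi m * of_nat l powi (r + s)) * of_int Lp powi r * of_int L2 * sgn_h powi m" by simp
    thus ?thesis unfolding th norm_const_def by (simp only: mult_ac)
  qed
  finally show ?thesis ..
qed

text \<open>The Hecke sum times phi as a function of q. Only the last summand can be singular at 0,
  and for the exchanged exponents (s, r) it is not.\<close>

definition numerator :: "complex \<Rightarrow> complex" where
  "numerator q = sgn_h * of_nat (l ^ 2) * eval_fps (Abs_fps coeffA) q + factorB * eval_fps (Abs_fps coeffB) q
     + norm_const * (phiq p r s (q ^ (l ^ 2)) * q powi Del)"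

lemma hecke_sum_numerator:
  assumes t: "Im t > 0" and lead: "\<bar>lead\<bar> < 24"
  shows "hecke_sum t = numerator (ee t) / phiq p r s (ee t)"
proof -
  have "ee (of_int Del * t) = ee t powi Del"
    by (cases "Del \<ge> 0") (auto simp: power_int_def ee_power ee_minus power_inverse)
  hence "hecke_sum t * phiq p r s (ee t) = numerator (ee t)"
    unfolding hecke_sum_series[OF t lead] numerator_def norm_const_def by (simp add: mult_ac)
  moreover have "phiq p r s (ee t) \<noteq> 0" by (intro phiq_nonzero p_pos norm_ee_less_1 t)
  ultimately show ?thesis by (simp add: field_simps)
qed

lemma eval_coeff_holomorphic:
  assumes lead: "\<bar>lead\<bar> < 24"
  shows "eval_fps (Abs_fps coeffA) holomorphic_on ball 0 1" "eval_fps (Abs_fps coeffB) holomorphic_on ball 0 1"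
  by (rule fps_expansion_of_sums(3)[OF coeffA_sums[OF _ lead]], assumption)
     (rule fps_expansion_of_sums(3)[OF coeffB_sums])

lemma phiq_power_holomorphic: "(\<lambda>q. phiq p r s (q ^ (l ^ 2))) holomorphic_on ball 0 1"
proof -
  have "(phiq p r s \<circ> (\<lambda>q. q ^ (l ^ 2))) holomorphic_on ball 0 1"
    by (rule holomorphic_on_compose_gen[OF _ phiq_holomorphic[OF p_pos]])
       (use l_pos norm_power_less_1[of "l ^ 2"] in \<open>auto intro!: holomorphic_intros\<close>)
  thus ?thesis by (simp add: o_def)
qed

lemma numerator_holomorphic:
  assumes "\<bar>lead\<bar> < 24"
  shows "numerator holomorphic_on ball 0 1 - {0}"
  unfolding numerator_def [abs_def]
  by (intro holomorphic_intros holomorphic_on_subset[OF eval_coeff_holomorphic(1)[OF assms]]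
      holomorphic_on_subset[OF eval_coeff_holomorphic(2)[OF assms]] holomorphic_on_subset[OF phiq_power_holomorphic]) auto

lemma numerator_holomorphic':
  assumes "\<bar>lead\<bar> < 24" "Del \<ge> 0"
  shows "numerator holomorphic_on ball 0 1"
proof -
  have "(\<lambda>q. q powi Del) holomorphic_on ball 0 1"
    using assms(2) by (simp add: power_int_def holomorphic_intros)
  thus ?thesis
    unfolding numerator_def [abs_def]
    by (intro holomorphic_on_add holomorphic_on_mult holomorphic_on_const
        eval_coeff_holomorphic[OF assms(1)] phiq_power_holomorphic)
qed

definition hecke_fls :: "complex fls" where
  "hecke_fls = Abs_fls (\<lambda>n. if n \<ge> Del then hecke_coeff p r s l n else 0)"

lemma hecke_fls_nth: "hecke_fls $$ n = (if n \<ge> Del then hecke_coeff p r s l n else 0)"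
  unfolding hecke_fls_def Del_def by (rule G_star_series_nth)

lemma G_star_eq: "G_star p r s l = 1 / fps_to_fls (phi_star p r s) * hecke_fls"
  unfolding G_star_def hecke_fls_def Del_def ..

lemma c_star_divide:
  "c_star p r s (of_int k / of_nat l ^ 2) = (if k \<ge> 0 \<and> l ^ 2 dvd nat k then phi_star p r s $ (nat k div l ^ 2) else 0)"
proof (cases "int (l ^ 2) dvd k")
  case True
  then obtain m where m: "k = int (l ^ 2) * m" by blast
  have "of_int k / of_nat l ^ 2 = (of_int m :: rat)" using l_pos by (simp add: m)
  moreover have "k \<ge> 0 \<longleftrightarrow> m \<ge> 0" using l_pos by (simp add: m zero_le_mult_iff)
  moreover have "nat k div l ^ 2 = nat m" "l ^ 2 dvd nat k" if "m \<ge> 0"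
    using that l_pos by (simp_all add: m nat_mult_distrib nat_power_eq)
  ultimately show ?thesis by (auto simp: c_star_int)
next
  case False
  have "of_int k / of_nat l ^ 2 \<notin> (\<int> :: rat set)"
  proof
    assume "of_int k / of_nat l ^ 2 \<in> (\<int> :: rat set)"
    then obtain m where "of_int k / of_nat l ^ 2 = (of_int m :: rat)" by (auto elim: Ints_cases)
    hence "of_int k = (of_int (int (l ^ 2) * m) :: rat)" using l_pos by (simp add: field_simps)
    hence "k = int (l ^ 2) * m" by (simp only: of_int_eq_iff)
    thus False using False by simp
  qed
  moreover have "\<not> (k \<ge> 0 \<and> l ^ 2 dvd nat k)"
  proof
    assume "k \<ge> 0 \<and> l ^ 2 dvd nat k"
    hence "int (l ^ 2) dvd int (nat k)" by (simp only: int_dvd_int_iff)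
    thus False using False \<open>k \<ge> 0 \<and> _\<close> by simp
  qed
  ultimately show ?thesis by (simp only: c_star_def simp_thms if_False)
qed

text \<open>For negative \<open>Del\<close> the lower limit of summation cuts nothing off: below it
  every argument of \<open>c_star\<close> is negative.\<close>

lemma hecke_fls_eq:
  assumes Del: "Del < 0"
  shows "hecke_fls = fls_const (of_nat l powi (2 - (r + s))) * fps_to_fls (Abs_fps coeffA)
    + fls_const (theta_factor p r s l) * fps_to_fls (Abs_fps coeffB)
    + fls_shift (- Del) (fps_to_fls (phi_star p r s oo fps_X ^ (l ^ 2)))" (is "_ = ?R")
proof (rule fls_eqI)
  fix n
  have A: "fps_to_fls (Abs_fps coeffA) $$ n = c_star p r s (of_int (n * int l ^ 2 + Del))"
  proof (cases "n \<ge> 0")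
    case False
    hence "n * int l ^ 2 \<le> 0" by (simp add: mult_nonpos_nonneg)
    hence "n * int l ^ 2 + Del < 0" using Del by simp
    hence "c_star p r s (of_int (n * int l ^ 2 + Del)) = 0" unfolding c_star_int by simp
    thus ?thesis using False by simp
  qed (simp add: coeffA_def)
  have B: "fps_to_fls (Abs_fps coeffB) $$ n = of_int (Legendre (n - Del) (int l)) * c_star p r s (of_int n)"
    by (simp add: coeffB_def c_star_int)
  have C: "fls_shift (- Del) (fps_to_fls (phi_star p r s oo fps_X ^ (l ^ 2))) $$ n = c_star p r s (of_int (n - Del) / of_nat l ^ 2)"
    unfolding c_star_divide by (simp add: fps_nth_compose_X_power)
  have R: "?R $$ n = hecke_coeff p r s l n"
    unfolding hecke_coeff_def Let_def Del_def[symmetric] fls_plus_nth fls_mult_const_nth A B C by (simp only: mult.assoc)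
  show "hecke_fls $$ n = ?R $$ n"
  proof (cases "n \<ge> Del")
    case True
    thus ?thesis unfolding hecke_fls_nth R by simp
  next
    case False
    hence n: "n < 0" "n - Del < 0" using Del by auto
    have "hecke_fls $$ n = 0" using False by (simp add: hecke_fls_nth)
    moreover have "?R $$ n = 0" using n by simp
    ultimately show ?thesis by simp
  qed
qed

lemma G_star_expansion:
  assumes lead: "\<bar>lead\<bar> < 24" and Del: "Del < 0" and r: "r < 0"
  shows "(\<lambda>q. numerator q / (norm_const * phiq p r s q)) has_laurent_expansion G_star p r s l"
proof -
  have phi: "phiq p r s has_laurent_expansion fps_to_fls (phi_star p r s)"
    by (intro has_laurent_expansion_fps phiq_expansion p_pos)
  have "(phiq p r s \<circ> (\<lambda>q. q ^ (l ^ 2))) has_fps_expansion (phi_star p r s oo fps_X ^ (l ^ 2))"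
    by (rule has_fps_expansion_compose[OF phiq_expansion[OF p_pos]])
       (use l_pos in \<open>auto intro!: fps_expansion_intros\<close>)
  hence C: "(\<lambda>q. phiq p r s (q ^ (l ^ 2)) * q powi Del) has_laurent_expansion
      fls_shift (- Del) (fps_to_fls (phi_star p r s oo fps_X ^ (l ^ 2)))"
    by (intro has_laurent_expansion_shift has_laurent_expansion_fps) (simp add: o_def)
  have A: "eval_fps (Abs_fps coeffA) has_laurent_expansion fps_to_fls (Abs_fps coeffA)"
    by (rule has_laurent_expansion_fps[OF fps_expansion_of_sums(1)[OF coeffA_sums[OF _ lead]]])
  have B: "eval_fps (Abs_fps coeffB) has_laurent_expansion fps_to_fls (Abs_fps coeffB)"
    by (rule has_laurent_expansion_fps[OF fps_expansion_of_sums(1)[OF coeffB_sums]])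
  have "(\<lambda>q. of_nat l powi (2 - (r + s)) * eval_fps (Abs_fps coeffA) q + theta_factor p r s l * eval_fps (Abs_fps coeffB) q
     + phiq p r s (q ^ (l ^ 2)) * q powi Del) has_laurent_expansion hecke_fls"
    unfolding hecke_fls_eq[OF Del] by (intro laurent_expansion_intros A B C)
  hence "(\<lambda>q. 1 / phiq p r s q * (of_nat l powi (2 - (r + s)) * eval_fps (Abs_fps coeffA) q + theta_factor p r s l * eval_fps (Abs_fps coeffB) q
     + phiq p r s (q ^ (l ^ 2)) * q powi Del)) has_laurent_expansion G_star p r s l"
    unfolding G_star_eq by (intro laurent_expansion_intros phi)
  also have "(\<lambda>q. 1 / phiq p r s q * (of_nat l powi (2 - (r + s)) * eval_fps (Abs_fps coeffA) q + theta_factor p r s l * eval_fps (Abs_fps coeffB) q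
     + phiq p r s (q ^ (l ^ 2)) * q powi Del)) = (\<lambda>q. numerator q / (norm_const * phiq p r s q))"
  proof
    fix q
    have l0: "(of_nat l :: complex) \<noteq> 0" using l_pos by simp
    have "norm_const * of_nat l powi (2 - (r + s)) = sgn_h * of_nat (l ^ 2)"
      unfolding norm_const_def mult.assoc power_int_add[symmetric, OF disjI1[OF l0]] by simp
    hence "numerator q = norm_const * (of_nat l powi (2 - (r + s)) * eval_fps (Abs_fps coeffA) q + theta_factor p r s l * eval_fps (Abs_fps coeffB) q
     + phiq p r s (q ^ (l ^ 2)) * q powi Del)"
      unfolding numerator_def theta_factor_eq[OF r, symmetric] by (simp add: distrib_left mult_ac)
    thus "1 / phiq p r s q * (of_nat l powi (2 - (r + s)) * eval_fps (Abs_fps coeffA) q + theta_factor p r s l * eval_fps (Abs_fps coeffB) q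
     + phiq p r s (q ^ (l ^ 2)) * q powi Del) = numerator q / (norm_const * phiq p r s q)"
      using norm_const_nonzero by simp
  qed
  finally show ?thesis .
qed

text \<open>For n \<le> 0 the first argument is negative, the second is nonnegative only at n = 0,
  and (n - \<open>Del\<close>) / l^2 is less than 1, hence a nonnegative integer only at n =
  \<open>Del\<close>.\<close>

lemma hecke_fls_nonpos:
  assumes Del: "Del < 0" and bound: "- Del < int (l ^ 2)" and n: "n \<le> 0"
  shows "hecke_fls $$ n = (if n = Del then 1 else 0) + (if n = 0 then theta_factor p r s l * of_int (Legendre (- Del) (int l)) else 0)"
proof (cases "n \<ge> Del")
  case False
  thus ?thesis using Del by (auto simp: hecke_fls_nth)
next
  case True
  have phi0: "phi_star p r s $ 0 = 1" by (rule phi_star_nth_0[OF p_pos])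
  have "n * int l ^ 2 \<le> 0" using n by (simp add: mult_nonpos_nonneg)
  hence "n * int l ^ 2 + Del < 0" using Del by simp
  hence A: "c_star p r s (of_int (n * int l ^ 2 + Del)) = 0" unfolding c_star_int by simp
  have B: "c_star p r s (of_int n) = (if n = 0 then 1 else 0)" using n by (simp add: c_star_int phi0)
  have C: "c_star p r s (of_int (n - Del) / of_nat l ^ 2) = (if n = Del then 1 else 0)"
  proof -
    have "nat (n - Del) < l ^ 2" using bound n True
      by (subst nat_less_iff) linarith+
    hence "l ^ 2 dvd nat (n - Del) \<longleftrightarrow> nat (n - Del) = 0" by (auto dest: dvd_imp_le)
    thus ?thesis unfolding c_star_divide using True phi0 by auto
  qed
  show ?thesis
    using True unfolding hecke_fls_nth hecke_coeff_def Let_def Del_def[symmetric] A B C by auto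
qed

lemma abs_Del_less: "\<bar>lead\<bar> < 24 \<Longrightarrow> \<bar>Del\<bar> < int (l ^ 2)"
proof -
  assume lead: "\<bar>lead\<bar> < 24"
  have N: "int (l ^ 2) > 0" using l_pos by simp
  have "24 * Del = lead * (int (l ^ 2) - 1)" using Del_eq by (simp add: algebra_simps)
  hence "\<bar>24 * Del\<bar> = \<bar>lead * (int (l ^ 2) - 1)\<bar>" by (rule arg_cong)
  hence "24 * \<bar>Del\<bar> = \<bar>lead\<bar> * (int (l ^ 2) - 1)" using N by (simp add: abs_mult)
  also have "\<dots> \<le> 24 * (int (l ^ 2) - 1)" using lead N by (intro mult_right_mono) auto
  finally show ?thesis by simp
qed

end

section \<open>The Hauptmodul as a function of q\<close>

context hauptmodul
begin

definition Yq :: "complex \<Rightarrow> complex" where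
  "Yq q = inverse q * (euler_fun 1 q / euler_fun p q) ^ k"

lemma Yq_expansion: "Yq has_laurent_expansion Phi_inv p k"
proof -
  have e1: "euler_fun 1 has_laurent_expansion fps_to_fls (euler_fps 1)"
    by (intro has_laurent_expansion_fps euler_fun_expansion) simp
  have ep: "(\<lambda>q. inverse (euler_fun p q)) has_laurent_expansion fps_to_fls (inverse (euler_fps p))"
    by (intro has_laurent_expansion_fps has_fps_expansion_inverse euler_fun_expansion p) (simp add: euler_fps_0 p)
  have "(\<lambda>q. inverse q * (euler_fun 1 q ^ k * inverse (euler_fun p q) ^ k)) has_laurent_expansion
     fls_X_inv * (fps_to_fls (euler_fps 1) ^ k * fps_to_fls (inverse (euler_fps p)) ^ k)"
    by (intro laurent_expansion_intros e1 ep)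
  moreover have "(\<lambda>q. inverse q * (euler_fun 1 q ^ k * inverse (euler_fun p q) ^ k)) = Yq"
    by (rule ext) (simp add: Yq_def divide_inverse power_mult_distrib power_inverse)
  ultimately show ?thesis
    by (simp add: Phi_inv_euler[OF p] fls_times_fps_to_fls fps_to_fls_power)
qed

text \<open>The powers of q in front of the two eta products combine to the exponent k (1 - p) / 24
  = -1.\<close>

lemma Yfun_eq:
  assumes k: "k * (p - 1) = 24" and t: "Im t > 0"
  shows "Yfun p k t = Yq (ee t)"
proof -
  have "Yfun p k t = (ee (t / 24) / ee (of_nat p * t / 24)) ^ k * (euler_fun 1 (ee t) / euler_fun p (ee t)) ^ k"
    unfolding Yfun_def eta_def euler_fun_def by (simp add: ee_power flip: power_mult_distrib)
  also have "(ee (t / 24) / ee (of_nat p * t / 24)) ^ k = ee (- t)"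
  proof -
    have "of_nat k * (of_nat p - 1) = (24 :: complex)"
      using arg_cong[OF k, of "of_nat :: nat \<Rightarrow> complex"] p by (simp add: of_nat_diff)
    hence "of_nat k * (t / 24 - of_nat p * t / 24) = - t"
      by (simp add: field_simps)
    thus ?thesis unfolding ee_diff[symmetric] ee_power by simp
  qed
  finally show ?thesis by (simp add: Yq_def ee_minus)
qed

lemma Yq_holomorphic: "Yq holomorphic_on ball 0 1 - {0}"
  unfolding Yq_def [abs_def]
  by (intro holomorphic_intros holomorphic_on_subset[OF euler_fun_holomorphic])
     (auto simp: euler_fun_nonzero p)

end

lemma fls_mult_fps_nonpos:
  assumes "\<And>n. n \<le> 0 \<Longrightarrow> F $$ n = 0" "n \<le> 0"
  shows "(F * fps_to_fls g) $$ n = (0 :: complex)"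
proof (cases "F = 0")
  case False
  hence "fls_subdegree F \<ge> 1" using assms(1) by (intro fls_subdegree_geI) auto
  thus ?thesis using assms(2) fls_subdegree_fls_to_fps_gt0[of g] by (intro fls_times_nth_eq0) linarith
qed simp

theorem theorem4p4:
  fixes p k l :: nat and r s :: int
  assumes "p \<in> {2, 3, 5, 7, 13}"
    and "k = 24 div (p - 1)"
    and "prime l" and "l \<noteq> p" and "l > 3"
    and "s > 0" and "r < 0" and "odd (r + s)"
    and "0 < r + s * int p" and "r + s * int p < 24"
    and "-24 < s + r * int p" and "s + r * int p < 0"
  shows "G_star p r s l =
    eval_poly_fls (frakB p k r s (nat (- Delta_star p r s l))) (Phi_inv p k)
    + fls_const (theta_factor p r s l * of_int (Legendre (- Delta_star p r s l) (int l)))"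
proof -
  have p: "prime p" "p > 0" and k: "k * (p - 1) = 24" using assms(1,2) by auto
  define h where "h = (l - 1) div 2"
  have "odd l" using assms(3,5) prime_odd_nat[of l] by simp
  hence l_eq: "l = 2 * h + 1" by (auto simp: h_def elim!: oddE)
  have "\<not> l dvd p" using assms(3,4) p(1) primes_dvd_imp_eq by blast
  interpret H: hecke l h p r s
    by standard (use assms l_eq \<open>\<not> l dvd p\<close> p in auto)
  interpret W: hecke l h p s r by (rule H.hecke_swap)
  interpret M: hauptmodul p k by standard (rule p)
  have lead: "\<bar>H.lead\<bar> < 24" "\<bar>W.lead\<bar> < 24" using assms by (simp_all add: H.lead_def W.lead_def)
  have "int l ^ 2 - 1 \<ge> 24"
  proof -
    have "5 ^ 2 \<le> int l ^ 2" using assms(5) l_eq by (intro power_mono) auto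
    thus ?thesis by simp
  qed
  hence q24: "(int l ^ 2 - 1) div 24 > 0" by (simp add: pos_imp_zdiv_pos_iff)
  \<comment> \<open>The signs of s + r p and r + s p decide this: a pole at infinity and none at the
    cusp 0.\<close>
  have Del: "H.Del < 0" "W.Del \<ge> 0"
    using q24 assms by (simp_all add: H.Del_def W.Del_def Delta_star_def mult_neg_pos)
  have bound: "- H.Del < int (l ^ 2)" using H.abs_Del_less[OF lead(1)] by simp
  define m where "m = nat (- H.Del)"
  define phi where "phi = fps_to_fls (phi_star p r s)"
  define c where "c = theta_factor p r s l * of_int (Legendre (- H.Del) (int l))"
  have phi0: "phi_star p r s $ 0 = 1" by (rule phi_star_nth_0[OF p(2)])
  \<comment> \<open>The constant term is matched as well, so that the difference vanishes at
    infinity instead of being merely bounded.\<close>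
  have "\<exists>P. \<forall>n\<le>0. (fls_shift (int m) 1 - eval_poly_fls P M.Yf * phi) $$ n = 0"
    unfolding phi_def by (rule M.faber_exists[OF phi0, of "Suc m"]) simp
  then obtain P where P: "\<And>n. n \<le> 0 \<Longrightarrow> (fls_shift (int m) 1 - eval_poly_fls P M.Yf * phi) $$ n = 0"
    by blast
  have frakB: "frakB p k r s m = P"
    by (rule M.frakB_eqI) (use P in \<open>simp add: phi_def\<close>)
  define D where "D = G_star p r s l - eval_poly_fls P (Phi_inv p k) - fls_const c"
  have D_nonpos: "D $$ n = 0" if n: "n \<le> 0" for n
  proof -
    have phi_ne: "phi \<noteq> 0" using phi0 by (auto simp: phi_def)
    have "D * phi = H.hecke_fls - eval_poly_fls P M.Yf * phi - fls_const c * phi"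
      using phi_ne by (simp add: D_def H.G_star_eq left_diff_distrib M.Yf_def phi_def[symmetric])
    \<comment> \<open>Neither bracket has a term of exponent \<le> 0: the first by the choice of P,
      the second by \<open>hecke_fls_nonpos\<close> and phi(0) = 1.\<close>
    also have "\<dots> = (fls_shift (int m) 1 - eval_poly_fls P M.Yf * phi) + (H.hecke_fls - fls_shift (int m) 1 - fls_const c * phi)"
      by simp
    finally have Dphi: "(D * phi) $$ n = 0" if "n \<le> 0" for n
    proof -
      have "(H.hecke_fls - fls_shift (int m) 1 - fls_const c * phi) $$ n = 0"
        using that Del H.hecke_fls_nonpos[OF Del(1) bound that] phi0
        by (auto simp: m_def phi_def fls_mult_const_nth c_def)
      thus ?thesis using P[OF that] unfolding \<open>D * phi = _\<close> fls_plus_nth by simp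
    qed
    have "inverse phi = fps_to_fls (inverse (phi_star p r s))"
      unfolding phi_def by (rule fls_inverse_fps_to_fls) (use phi0 in \<open>auto simp: subdegree_eq_0_iff\<close>)
    moreover have "D = (D * phi) * inverse phi" using phi_ne by simp
    ultimately have "D = (D * phi) * fps_to_fls (inverse (phi_star p r s))" by (rule subst)
    also have "\<dots> $$ n = 0" by (rule fls_mult_fps_nonpos[OF Dphi n])
    finally show ?thesis .
  qed
  define dq where "dq q = H.numerator q / (H.norm_const * phiq p r s q) - poly P (M.Yq q) - c" for q
  have dq_exp: "dq has_laurent_expansion D"
    unfolding dq_def [abs_def] D_def
    by (intro laurent_expansion_intros H.G_star_expansion lead Del assms has_laurent_expansion_poly M.Yq_expansion)
  define d where "d t = H.hecke_sum t / H.norm_const - poly P (Yfun p k t) - c" for t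
  have d_eq: "d t = dq (ee t)" if "Im t > 0" for t
    unfolding d_def dq_def H.hecke_sum_numerator[OF that lead(1)] M.Yfun_eq[OF k that] by (simp add: mult.commute)
  have dq_hol: "dq holomorphic_on ball 0 1 - {0}"
  proof -
    have "(\<lambda>q. poly P (M.Yq q)) holomorphic_on ball 0 1 - {0}"
      by (intro poly_holomorphic_on M.Yq_holomorphic)
    moreover have "phiq p r s holomorphic_on ball 0 1 - {0}"
      by (rule holomorphic_on_subset[OF phiq_holomorphic[OF p(2)]]) auto
    ultimately show ?thesis unfolding dq_def [abs_def]
      by (intro holomorphic_on_diff holomorphic_on_divide holomorphic_on_mult holomorphic_on_const
          H.numerator_holomorphic lead) (auto simp: H.norm_const_nonzero phiq_nonzero p)
  qed
  have d_zero: "d t = 0" if "Im t > 0" for t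
  proof (rule gamma0_zero[OF p(1) _ _ _ _ that])
    fix A B C D' :: int and t :: complex assume t: "Im t > 0" "A * D' - B * C = 1" "int p dvd C"
    show "d ((of_int A * t + of_int B) / (of_int C * t + of_int D')) = d t"
      unfolding d_def H.hecke_sum_modular[OF t] Yfun_modular[OF assms(1,2) t] ..
  next
    have "(dq \<circ> ee) holomorphic_on uhp"
    proof (rule holomorphic_on_compose_gen[OF _ dq_hol])
      show "ee holomorphic_on uhp" unfolding ee_def [abs_def] by (intro holomorphic_intros)
      show "ee ` uhp \<subseteq> ball 0 1 - {0}" by (auto simp: uhp_def norm_ee_less_1)
    qed
    thus "d holomorphic_on uhp"
      by (rule holomorphic_transform) (simp add: d_eq uhp_def)
  next
    fix e :: real assume e: "e > 0"
    have "dq \<midarrow>0\<rightarrow> D $$ 0"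
    proof (cases "D = 0")
      case False
      have "fls_subdegree D \<ge> 0" using False D_nonpos by (intro fls_subdegree_geI) auto
      thus ?thesis by (rule has_laurent_expansion_imp_tendsto_0[OF dq_exp])
    next
      case True
      thus ?thesis using has_laurent_expansion_imp_tendsto_0[OF dq_exp] by simp
    qed
    hence "dq \<midarrow>0\<rightarrow> 0" using D_nonpos[of 0] by simp
    then obtain \<delta> where \<delta>: "\<delta> > 0" "\<And>q. q \<noteq> 0 \<Longrightarrow> norm q < \<delta> \<Longrightarrow> norm (dq q) < e"
      using e unfolding LIM_eq by (metis diff_zero)
    show "\<exists>M. \<forall>t. Im t \<ge> M \<longrightarrow> norm (d t) < e"
    proof (intro exI allI impI)
      fix t :: complex assume t: "Im t \<ge> max 1 (1 - ln \<delta> / (2 * pi))"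
      have "Im t > - ln \<delta> / (2 * pi)" using t by (simp add: max_def split: if_splits)
      hence "- ln \<delta> < Im t * (2 * pi)" by (subst (asm) pos_divide_less_eq) simp_all
      hence "- 2 * pi * Im t < ln \<delta>" by (simp add: mult_ac)
      hence "exp (- 2 * pi * Im t) < \<delta>" using \<delta>(1) by (metis exp_less_cancel_iff exp_ln)
      hence "norm (ee t) < \<delta>" by (simp add: norm_ee)
      moreover have "Im t > 0" using t by simp
      ultimately show "norm (d t) < e" using \<delta>(2)[of "ee t"] d_eq by simp
    qed
  next
    define sp :: complex where "sp = of_real (sqrt (real p)) ^ k"
    \<comment> \<open>The difference near the cusp 0, in its local parameter
      \<open>ee (t / p)\<close>; it extends holomorphically to q = 0 and is therefore bounded
      nearby.\<close>
    define w where "w q = W.numerator q / (H.norm_const * phiq p s r q)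
       - poly P (sp * (q * (euler_fun p q / euler_fun 1 q) ^ k)) - c" for q
    have w_hol: "w holomorphic_on ball 0 1"
    proof -
      have "(\<lambda>q. poly P (sp * (q * (euler_fun p q / euler_fun 1 q) ^ k))) holomorphic_on ball 0 1"
        by (intro poly_holomorphic_on holomorphic_intros euler_fun_holomorphic) (auto simp: euler_fun_nonzero p)
      thus ?thesis unfolding w_def [abs_def]
        by (intro holomorphic_on_diff holomorphic_on_divide holomorphic_on_mult holomorphic_on_const
            W.numerator_holomorphic' lead Del phiq_holomorphic p) (auto simp: H.norm_const_nonzero phiq_nonzero p)
    qed
    have d_w: "d (- 1 / t) = w (ee (t / of_nat p))" if t: "Im t > 0" for t
    proof -
      have u: "Im (t / of_nat p) > 0" using t p by (simp add: Im_divide_of_nat)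
      have e0: "euler_fun 1 (ee (t / of_nat p)) \<noteq> 0" "euler_fun p (ee (t / of_nat p)) \<noteq> 0"
        using norm_ee_less_1[OF u] p by (simp_all add: euler_fun_nonzero)
      have "Yfun p k (- 1 / t) * Yfun p k (t / of_nat p) = sp"
        unfolding sp_def by (rule Yfun_minus_inverse[OF p(2) t])
      hence "Yfun p k (- 1 / t) = sp * (ee (t / of_nat p) * (euler_fun p (ee (t / of_nat p)) / euler_fun 1 (ee (t / of_nat p))) ^ k)"
        unfolding M.Yfun_eq[OF k u] M.Yq_def using e0 by (simp add: field_simps power_divide)
      thus ?thesis
        unfolding d_def w_def H.hecke_sum_fricke[OF t] W.hecke_sum_numerator[OF u lead(2)] by (simp add: mult.commute)
    qed
    have "compact (w ` cball 0 (1 / 2))"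
      by (intro compact_continuous_image holomorphic_on_imp_continuous_on holomorphic_on_subset[OF w_hol]) auto
    then obtain B where B: "\<And>q. q \<in> cball 0 (1 / 2) \<Longrightarrow> norm (w q) \<le> B"
      by (force dest!: compact_imp_bounded simp: bounded_iff)
    show "\<exists>M B. \<forall>t. Im t \<ge> M \<longrightarrow> norm (d (- 1 / t)) \<le> B"
    proof (intro exI allI impI)
      fix t :: complex assume t: "Im t \<ge> real p"
      have "Im (t / of_nat p) \<ge> 1" using t p by (simp add: Im_divide_of_nat)
      hence "1 * 1 \<le> (2 * pi) * Im (t / of_nat p)" using pi_ge_two by (intro mult_mono) auto
      hence "norm (ee (t / of_nat p)) \<le> exp (- 1)"
        unfolding norm_ee by simp
      also have "\<dots> \<le> 1 / 2"
      proof -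
        have "2 \<le> exp (1 :: real)" using exp_ge_add_one_self[of 1] by simp
        thus ?thesis by (simp add: exp_minus field_simps)
      qed
      finally have "norm (w (ee (t / of_nat p))) \<le> B" by (intro B) simp
      moreover have "Im t > 0" using t p by (metis of_nat_0_less_iff order_less_le_trans)
      ultimately show "norm (d (- 1 / t)) \<le> B" by (simp only: d_w)
    qed
  qed
  \<comment> \<open>Every q with 0 < |q| < 1 is \<open>ee t\<close> for some t in the upper half
    plane, so \<open>dq\<close> vanishes on a punctured disc.\<close>
  have "D = 0"
  proof (rule zero_has_laurent_expansion_imp_eq_0)
    have "\<forall>\<^sub>F q in at 0. q \<in> ball 0 1 - {0 :: complex}"
      by (intro eventually_at_in_open) auto
    hence "\<forall>\<^sub>F q in at 0. dq q = 0"
    proof eventually_elim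
      case (elim q)
      then obtain t where t: "ee t = q" using ee_surj_ex[of q] by auto
      have "norm (ee t) < 1" using elim t by simp
      hence "Im t > 0" using pi_gt_zero by (simp add: norm_ee zero_less_mult_iff)
      thus ?case using d_zero[of t] d_eq[of t] t by simp
    qed
    thus "(\<lambda>_. 0) has_laurent_expansion D"
      using dq_exp has_laurent_expansion_cong[of dq "\<lambda>_. 0" D D] by simp
  qed
  thus ?thesis
    by (simp add: D_def frakB[symmetric] m_def c_def H.Del_def algebra_simps)
qed

end
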